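(* Let $(\omega_x)_{x\in\mathbb Z^2}$ be i.i.d. real random variables under $\mathbb P$ with $\mathbb E[|\omega_0|^{2+\epsilon}]<\infty$ for some $\epsilon>0$ and $\mathrm{Var}(\omega_0)>0$, and let $\{I^\xi_x,J^\xi_x\}$ be the stationary boundary weights described in the context. Suppose the following two hypotheses hold. (1) There exist $\nu>2$ and $\delta_0\in(0,1)$ such that for any $\delta\in(0,\delta_0)$ and $\kappa\ge0$ there exist positive finite constants $C_0(\delta)$, $N_0(\delta,\kappa)$, $s_0(\delta,\kappa)$ such that $$\mathbb P\bigl\{|Z^{\xi,\mathbf e_1}(m,n)|\vee|Z^{\xi,\mathbf e_2}(m,n)|\ge s(m+n)^{2/3}\bigr\}\le C_0s^{-\nu}$$ for all $(m,n)\in S_\delta\cap\mathbb Z^2_{\ge N_0}$, $s\ge s_0$, and $\xi\in\mathrm{ri}\,\mathcal U$ with $\xi_1\in(\delta,1-\delta)$ and $|\xi_1-\frac m{m+n}|\le\kappa(m+n)^{-1/3}$. (2) There exist $a_0\in(1/3,2/3)$ and $\delta_0\in(0,1)$ such that for any $\delta\in(0,\delta_0)$ there exist positive finite constants $C_3(\delta)$, $N_3(\delta)$ such that for all $N\ge N_3$ and all $\eta_\star,\eta^\star,\xi_\star,\xi^\star\in\mathrm{ri}\,\mathcal U$ with $\mathbf e_1$-coordinate in $(\delta,1-\delta)$ and with $$-N^{-a_0/2}\le\xi_\star\cdot\mathbf e_1-\eta^\star\cdot\mathbf e_1<0\quad\text{and}\quad-N^{-a_0/2}\le\eta_\star\cdot\mathbf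 e_1-\xi^\star\cdot\mathbf e_1<0,$$ we have $$\mathbb P\Bigl\{\sup_{0<k\le N^{2/3}}S_k^{\xi_\star,\eta^\star}\le0\ \text{ and }\sup_{-N^{2/3}+1\le k<0}S_k^{\xi^\star,\eta_\star}\le0\Bigr\}\le C_3N^{-a_0}.$$ Suppose moreover that $a_0<\frac{2(\nu-1)}{3\nu}$. Then with $\mathbb P$-probability one there are no non-trivial bi-infinite geodesics.
   Context: LPP. $\mathbf e_1=(1,0)$, $\mathbf e_2=(0,1)$, $\mathbf 0=(0,0)$; $x\le y$ is coordinatewise. An up-right path has increments in $\{\mathbf e_1,\mathbf e_2\}$; $\Pi_x^y$ is the set of up-right paths from $x$ to $y$; $G_{x,y}=\max_{\pi\in\Pi_x^y}\sum_{v\in\pi}\omega_v$ for $x\le y$; maximizers are called geodesics. A bi-infinite up-right path $(\pi_n)_{n\in\mathbb Z}$ is a bi-infinite geodesic if every segment $(\pi_m,\dots,\pi_n)$ is a geodesic between its endpoints; it is trivial if it is of the form $(x+j\mathbf e_k)_{j\in\mathbb Z}$ for some $x\in\mathbb Z^2$, $k\in\{1,2\}$, and non-trivial otherwise. Directions and shape function. $\mathrm{ri}\,\mathcal U=\{t\mathbf e_1+(1-t)\mathbf e_2:0<t<1\}$. For $\delta\in(0,1)$, $S_\delta=\{x\in\mathbb R^2_{>0}:x_1\ge\delta x_2,\ x_2\ge\delta x_1\}$. $\gamma$ is the limit shape: almost surely $\lim_{n\to\infty}n^{-1}\max_{x\in\mathbb Z_{\ge0}^2,|x|_1=n}|G_{\mathbf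 0,x}-\gamma(x)|=0$. $\nabla\gamma(\xi+)$ is the vector with $\mathbf e_1\cdot\nabla\gamma(\xi+)=\lim_{\varepsilon\searrow0}\varepsilon^{-1}(\gamma(\xi+\varepsilon\mathbf e_1)-\gamma(\xi))$ and $\mathbf e_2\cdot\nabla\gamma(\xi+)=\lim_{\varepsilon\searrow0}\varepsilon^{-1}(\gamma(\xi)-\gamma(\xi-\varepsilon\mathbf e_2))$. Stationary boundary weights. On a probability space extending that of $\omega$ (its measure still denoted $\mathbb P$) there is a process $\{I^\xi_x,J^\xi_x:x\in\mathbb Z^2,\xi\in\mathrm{ri}\,\mathcal U\}$ (known to exist under the moment assumption), fixed throughout, such that: (a) the joint law of $\{\omega_x,I^\xi_x,J^\xi_x\}$ is invariant under translations of $\mathbb Z^2$; (b) for any $A\subset\mathbb Z^2$, $\{\omega_x,I^\xi_x,J^\xi_x:x\in A,\xi\in\mathrm{ri}\,\mathcal U\}$ is independent of $\{\omega_x:x\in\mathbb Z^2,\ x\not\le y\ \forall y\in A\}$; (c) $I^\xi_x,J^\xi_x$ are integrable with $\mathbb E[(I^\xi_x,J^\xi_x)]=\nabla\gamma(\xi+)$; (d) almost surely, for all $x\in\mathbb Z^2$ and $\xi,\zeta\in\mathrm{ri}\,\mathcal U$ with $\xi_1\le\zeta_1$: $\omega_x=I^\xi_x\wedge J^\xi_x$, $\omega_x\le I^\zeta_x\le I^\xi_x$, $\omega_x\le J^\xi_x\le J^\zeta_x$; and, with $G^\xi$ defined next, $G^\xi_{x,y}+G^\xi_{y,z}=G^\xi_{x,z}$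 for all $x\le y\le z$. Boundary passage times. $G^\xi_{x,x}=0$, $G^\xi_{x,x+k\mathbf e_1}=\sum_{i=1}^kI^\xi_{x+i\mathbf e_1}$, $G^\xi_{x,x+k\mathbf e_2}=\sum_{i=1}^kJ^\xi_{x+i\mathbf e_2}$ ($k\in\mathbb N$), and for $y\in x+\mathbb N^2$ ($\mathbb N=\{1,2,\dots\}$) $$G^\xi_{x,y}=\max_{1\le k\le y_1-x_1}\Bigl\{\sum_{i=1}^kI^\xi_{x+i\mathbf e_1}+G_{x+k\mathbf e_1+\mathbf e_2,y}\Bigr\}\vee\max_{1\le\ell\le y_2-x_2}\Bigl\{\sum_{j=1}^\ell J^\xi_{x+j\mathbf e_2}+G_{x+\mathbf e_1+\ell\mathbf e_2,y}\Bigr\}.$$ $\mathrm{Exit}^\xi_{x,y}$ is the set of all $k\in\{1,\dots,y_1-x_1\}$ attaining $G^\xi_{x,y}$ in the first family, together with all $-\ell$, $\ell\in\{1,\dots,y_2-x_2\}$, attaining $G^\xi_{x,y}$ in the second family. $Z^{\xi,\mathbf e_1}_{x,y}=\max\mathrm{Exit}^\xi_{x,y}$, $Z^{\xi,\mathbf e_2}_{x,y}=\min\mathrm{Exit}^\xi_{x,y}$, and $Z^{\xi,\mathbf e_k}(m,n)=Z^{\xi,\mathbf e_k}_{\mathbf 0,(m,n)}$. Reflected weights and random walks. With $\hat\omega_x=\omega_{-x}$, let $\hat I^\xi_x(\omega)=I^\xi_{-x}(\hat\omega)$ and $\hat J^\xi_x(\omega)=J^\xi_{-x}(\hat\omega)$,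 i.e. the weights obtained by applying the construction to the reflected environment and reflecting back, so that $\{\omega_{-x},\hat I^\xi_{-x},\hat J^\xi_{-x}\}$ has the same law as $\{\omega_x,I^\xi_x,J^\xi_x\}$; all weights live on one probability space. For $\xi,\eta\in\mathrm{ri}\,\mathcal U$: $S^{\xi,\eta}_0=0$, $S^{\xi,\eta}_n=\sum_{j=1}^n(J^\xi_{j\mathbf e_2}-\hat J^\eta_{\mathbf e_1+(j-1)\mathbf e_2})$ for $n\ge1$, and $S^{\xi,\eta}_n=-\sum_{j=n+1}^0(J^\xi_{j\mathbf e_2}-\hat J^\eta_{\mathbf e_1+(j-1)\mathbf e_2})$ for $n\le-1$. *)

theory Defs
  imports "HOL-Probability.Probability"
begin

text \<open>
  Sites are elements of \<^typ>\<open>int \<times> int\<close>; group operations and the order \<open>\<le>\<close> on pairs are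
  coordinatewise.  A realization of the environment is a function \<open>w\<close> from sites to reals; a random
  environment is a function \<open>\<omega>\<close> from sites to random variables.
\<close>

type_synonym site = "int \<times> int"

definition up_right_step :: "site \<Rightarrow> site \<Rightarrow> bool" where
  "up_right_step u v \<longleftrightarrow> v - u \<in> {(1, 0), (0, 1)}"

definition up_right_paths :: "site \<Rightarrow> site \<Rightarrow> site list set" where
  "up_right_paths x y =
     {\<pi>. \<pi> \<noteq> [] \<and> hd \<pi> = x \<and> last \<pi> = y \<and> successively up_right_step \<pi>}"

definition path_weight :: "(site \<Rightarrow> real) \<Rightarrow> site list \<Rightarrow> real" where
  "path_weight w \<pi> = (\<Sum>v\<leftarrow>\<pi>. w v)"

text \<open>Both endpoints are included.  Only meaningful for \<open>x \<le> y\<close>.\<close>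

definition lpp :: "(site \<Rightarrow> real) \<Rightarrow> site \<Rightarrow> site \<Rightarrow> real" where
  "lpp w x y = Max (path_weight w ` up_right_paths x y)"

definition geodesic :: "(site \<Rightarrow> real) \<Rightarrow> site \<Rightarrow> site \<Rightarrow> site list \<Rightarrow> bool" where
  "geodesic w x y \<pi> \<longleftrightarrow> \<pi> \<in> up_right_paths x y \<and> path_weight w \<pi> = lpp w x y"

definition bi_infinite_geodesic :: "(site \<Rightarrow> real) \<Rightarrow> (int \<Rightarrow> site) \<Rightarrow> bool" where
  "bi_infinite_geodesic w \<pi> \<longleftrightarrow>
     (\<forall>n. up_right_step (\<pi> n) (\<pi> (n + 1))) \<and>
     (\<forall>m n. m \<le> n \<longrightarrow> geodesic w (\<pi> m) (\<pi> n) (map \<pi> [m..n]))"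

definition trivial_path :: "(int \<Rightarrow> site) \<Rightarrow> bool" where
  "trivial_path \<pi> \<longleftrightarrow> (\<exists>x. \<pi> = (\<lambda>j. x + (j, 0)) \<or> \<pi> = (\<lambda>j. x + (0, j)))"


definition ri_U :: "(real \<times> real) set" where
  "ri_U = {t *\<^sub>R (1, 0) + (1 - t) *\<^sub>R (0, 1) | t. 0 < t \<and> t < 1}"

definition S_cone :: "real \<Rightarrow> (real \<times> real) set" where
  "S_cone \<delta> = {x. 0 < fst x \<and> 0 < snd x \<and> \<delta> * snd x \<le> fst x \<and> \<delta> * fst x \<le> snd x}"

text \<open>
  The shape limit only sees \<open>\<gamma>\<close> at lattice points and up to errors of order \<open>o(|x|)\<close>.  Continuity and
  homogeneity of degree one, which are part of the notion of a limit shape, make \<open>\<gamma>\<close> unique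
  on the closed quadrant.
\<close>

definition limit_shape ::
  "'a measure \<Rightarrow> (site \<Rightarrow> 'a \<Rightarrow> real) \<Rightarrow> (real \<times> real \<Rightarrow> real) \<Rightarrow> bool" where
  "limit_shape M \<omega> \<gamma> \<longleftrightarrow>
     continuous_on {x. 0 \<le> x} \<gamma> \<and>
     (\<forall>c x. 0 \<le> c \<and> 0 \<le> x \<longrightarrow> \<gamma> (c *\<^sub>R x) = c * \<gamma> x) \<and>
     (AE p in M.
        (\<lambda>n::nat.
           Max ((\<lambda>x. \<bar>lpp (\<lambda>v. \<omega> v p) (0, 0) x - \<gamma> (of_int (fst x), of_int (snd x))\<bar>) `
                  {x. (0, 0) \<le> x \<and> fst x + snd x = int n}) / real n)
        \<longlonglongrightarrow> 0)"

text \<open>\<open>v\<close> is the vector \<open>\<nabla>\<gamma>(\<xi>+)\<close>.\<close>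

definition has_grad_plus ::
  "(real \<times> real \<Rightarrow> real) \<Rightarrow> real \<times> real \<Rightarrow> real \<times> real \<Rightarrow> bool" where
  "has_grad_plus \<gamma> \<xi> v \<longleftrightarrow>
     ((\<lambda>\<epsilon>. (\<gamma> (\<xi> + \<epsilon> *\<^sub>R (1, 0)) - \<gamma> \<xi>) / \<epsilon>) \<longlongrightarrow> fst v) (at_right 0) \<and>
     ((\<lambda>\<epsilon>. (\<gamma> \<xi> - \<gamma> (\<xi> - \<epsilon> *\<^sub>R (0, 1))) / \<epsilon>) \<longlongrightarrow> snd v) (at_right 0)"


text \<open>
  Passage times from \<open>x\<close> with horizontal boundary weights \<open>I\<close> and vertical boundary weights \<open>J\<close>.
  \<open>horiz_exit\<close> and \<open>vert_exit\<close> are the values over paths leaving the boundary at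
  \<open>x + k e\<^sub>1\<close> and \<open>x + l e\<^sub>2\<close>.
\<close>

definition horiz_exit ::
  "(site \<Rightarrow> real) \<Rightarrow> (site \<Rightarrow> real) \<Rightarrow> site \<Rightarrow> site \<Rightarrow> int \<Rightarrow> real" where
  "horiz_exit w I x y k = (\<Sum>i=1..k. I (x + (i, 0))) + lpp w (x + (k, 1)) y"

definition vert_exit ::
  "(site \<Rightarrow> real) \<Rightarrow> (site \<Rightarrow> real) \<Rightarrow> site \<Rightarrow> site \<Rightarrow> int \<Rightarrow> real" where
  "vert_exit w J x y l = (\<Sum>j=1..l. J (x + (0, j))) + lpp w (x + (1, l)) y"

text \<open>Only meaningful for \<open>x \<le> y\<close>; the case \<open>y = x\<close> is an empty sum, hence \<open>0\<close>.\<close>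

definition lpp_bd ::
  "(site \<Rightarrow> real) \<Rightarrow> (site \<Rightarrow> real) \<Rightarrow> (site \<Rightarrow> real) \<Rightarrow> site \<Rightarrow> site \<Rightarrow> real" where
  "lpp_bd w I J x y =
     (if snd y = snd x then \<Sum>i=1..fst y - fst x. I (x + (i, 0))
      else if fst y = fst x then \<Sum>j=1..snd y - snd x. J (x + (0, j))
      else max (Max (horiz_exit w I x y ` {1..fst y - fst x}))
               (Max (vert_exit w J x y ` {1..snd y - snd x})))"

definition exit_set ::
  "(site \<Rightarrow> real) \<Rightarrow> (site \<Rightarrow> real) \<Rightarrow> (site \<Rightarrow> real) \<Rightarrow> site \<Rightarrow> site \<Rightarrow> int set" where
  "exit_set w I J x y =
     {k. 1 \<le> k \<and> k \<le> fst y - fst x \<and> horiz_exit w I x y k = lpp_bd w I J x y} \<union>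
     {- l | l. 1 \<le> l \<and> l \<le> snd y - snd x \<and> vert_exit w J x y l = lpp_bd w I J x y}"

definition exit_e1 ::
  "(site \<Rightarrow> real) \<Rightarrow> (site \<Rightarrow> real) \<Rightarrow> (site \<Rightarrow> real) \<Rightarrow> site \<Rightarrow> site \<Rightarrow> int" where
  "exit_e1 w I J x y = Max (exit_set w I J x y)"

definition exit_e2 ::
  "(site \<Rightarrow> real) \<Rightarrow> (site \<Rightarrow> real) \<Rightarrow> (site \<Rightarrow> real) \<Rightarrow> site \<Rightarrow> site \<Rightarrow> int" where
  "exit_e2 w I J x y = Min (exit_set w I J x y)"


text \<open>
  The processes \<open>I\<close> and \<open>J\<close> are indexed by a direction and a site; only directions in \<^const>\<open>ri_U\<close>
  matter.  \<open>boundary_field A\<close> is the family of all \<open>(\<omega>\<^sub>x, I\<^sup>\<xi>\<^sub>x, J\<^sup>\<xi>\<^sub>x)\<close> with \<open>x \<in> A\<close> as one random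
  element of a product space.
\<close>

type_synonym 'a field = "real \<times> real \<Rightarrow> site \<Rightarrow> 'a \<Rightarrow> real"

definition field_space :: "site set \<Rightarrow> (site \<times> (real \<times> real) \<Rightarrow> real \<times> real \<times> real) measure" where
  "field_space A = (\<Pi>\<^sub>M i\<in>A \<times> ri_U. borel)"

definition boundary_field ::
  "site set \<Rightarrow> (site \<Rightarrow> 'a \<Rightarrow> real) \<Rightarrow> 'a field \<Rightarrow> 'a field \<Rightarrow> 'a \<Rightarrow>
    (site \<times> (real \<times> real) \<Rightarrow> real \<times> real \<times> real)" where
  "boundary_field A \<omega> I J p = (\<lambda>(x, \<xi>)\<in>A \<times> ri_U. (\<omega> x p, I \<xi> x p, J \<xi> x p))"

definition boundary_law ::
  "'a measure \<Rightarrow> (site \<Rightarrow> 'a \<Rightarrow> real) \<Rightarrow> 'a field \<Rightarrow> 'a field \<Rightarrow>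
    (site \<times> (real \<times> real) \<Rightarrow> real \<times> real \<times> real) measure" where
  "boundary_law M \<omega> I J = distr M (field_space UNIV) (boundary_field UNIV \<omega> I J)"

definition stationary_boundary ::
  "'a measure \<Rightarrow> (site \<Rightarrow> 'a \<Rightarrow> real) \<Rightarrow> (real \<times> real \<Rightarrow> real) \<Rightarrow>
    'a field \<Rightarrow> 'a field \<Rightarrow> bool" where
  "stationary_boundary M \<omega> \<gamma> I J \<longleftrightarrow>
     (\<forall>\<xi>\<in>ri_U. \<forall>x. I \<xi> x \<in> borel_measurable M \<and> J \<xi> x \<in> borel_measurable M) \<and>
     (\<forall>z. boundary_law M (\<lambda>x. \<omega> (x + z)) (\<lambda>\<xi> x. I \<xi> (x + z)) (\<lambda>\<xi> x. J \<xi> (x + z)) =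
          boundary_law M \<omega> I J) \<and>
     (\<forall>A. let B = {x. \<forall>y\<in>A. \<not> x \<le> y} in
        prob_space.indep_set M
          (sets (vimage_algebra (space M) (boundary_field A \<omega> I J) (field_space A)))
          (sets (vimage_algebra (space M) (\<lambda>p. \<lambda>x\<in>B. \<omega> x p) (\<Pi>\<^sub>M x\<in>B. borel)))) \<and>
     (\<forall>\<xi>\<in>ri_U. \<forall>x. integrable M (I \<xi> x) \<and> integrable M (J \<xi> x) \<and>
        has_grad_plus \<gamma> \<xi> (prob_space.expectation M (I \<xi> x), prob_space.expectation M (J \<xi> x))) \<and>
     (AE p in M.
        (\<forall>x. \<forall>\<xi>\<in>ri_U. \<forall>\<zeta>\<in>ri_U. fst \<xi> \<le> fst \<zeta> \<longrightarrow>
           \<omega> x p = min (I \<xi> x p) (J \<xi> x p) \<and>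
           \<omega> x p \<le> I \<zeta> x p \<and> I \<zeta> x p \<le> I \<xi> x p \<and>
           \<omega> x p \<le> J \<xi> x p \<and> J \<xi> x p \<le> J \<zeta> x p) \<and>
        (\<forall>\<xi>\<in>ri_U. \<forall>x y z. x \<le> y \<and> y \<le> z \<longrightarrow>
           (let G = lpp_bd (\<lambda>v. \<omega> v p) (\<lambda>v. I \<xi> v p) (\<lambda>v. J \<xi> v p)
            in G x y + G y z = G x z)))"

text \<open>
  The weights \<open>I\<close> and \<open>J\<close> may use randomness beyond \<open>\<omega>\<close>, so the reflected weights are not functions
  of \<open>\<omega>\<close>.  They are random variables on the same space whose reflection, jointly with
  the reflection of the same \<open>\<omega>\<close>, has the law of \<open>(\<omega>, I, J)\<close>.  When \<open>I\<close> and \<open>J\<close> are functions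
  of \<open>\<omega>\<close>, this forces \<open>I'\<^sub>x(\<omega>) = I\<^sub>-\<^sub>x(\<omega>')\<close> almost surely with \<open>\<omega>'\<^sub>x = \<omega>\<^sub>-\<^sub>x\<close>, likewise for \<open>J'\<close>.
\<close>

definition reflected_boundary ::
  "'a measure \<Rightarrow> (site \<Rightarrow> 'a \<Rightarrow> real) \<Rightarrow> 'a field \<Rightarrow> 'a field \<Rightarrow> 'a field \<Rightarrow> 'a field \<Rightarrow> bool" where
  "reflected_boundary M \<omega> I J I' J' \<longleftrightarrow>
     (\<forall>\<xi>\<in>ri_U. \<forall>x. I' \<xi> x \<in> borel_measurable M \<and> J' \<xi> x \<in> borel_measurable M) \<and>
     boundary_law M (\<lambda>x. \<omega> (- x)) (\<lambda>\<xi> x. I' \<xi> (- x)) (\<lambda>\<xi> x. J' \<xi> (- x)) =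
     boundary_law M \<omega> I J"

text \<open>The walk \<open>S\<^sup>\<xi>\<^sup>,\<^sup>\<eta>\<close>; the second argument is the reflected vertical weight.\<close>

definition walk :: "'a field \<Rightarrow> 'a field \<Rightarrow> real \<times> real \<Rightarrow> real \<times> real \<Rightarrow> int \<Rightarrow> 'a \<Rightarrow> real" where
  "walk J J' \<xi> \<eta> n p =
     (if 0 \<le> n then \<Sum>j=1..n. J \<xi> (0, j) p - J' \<eta> (1, j - 1) p
      else - (\<Sum>j=n+1..0. J \<xi> (0, j) p - J' \<eta> (1, j - 1) p))"

end

theory Submission
  imports Defs "HOL-Real_Asymp.Real_Asymp"
begin

text \<open>
  Write \<open>G\<close> for last-passage times and look at the scale \<open>N\<close>.  A bi-infinite geodesic through the
  edge from \<open>0\<close> to \<open>e\<^sub>1\<close> meets the antidiagonals at distance \<open>N\<close> from the origin in a point \<open>o\<close> in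
  the south-west and a point \<open>d\<close> in the north-east.  If \<open>o\<close> and \<open>d\<close> are not almost opposite, a stationary
  passage time of intermediate direction, whose exit points lie on the expected side by the first
  hypothesis, forces the geodesic to one side of the origin.  If they are almost opposite,
  the increments of \<open>G(o, .)\<close> and \<open>G(., d)\<close> along the two columns next to the
  edge are squeezed between boundary weights of slightly tilted directions, and optimality of
  the crossing at height \<open>0\<close> turns into the event of the second hypothesis.

  Blocks have length of order \<open>N\<close> to the power \<open>1 - a\<^sub>0 / 2\<close>, the largest tilt the second hypothesis
  allows.  The number of blocks is of order \<open>N\<close> to the power \<open>a\<^sub>0 / 2\<close>, while in each of them
  the crossing has probability at most of order \<open>N\<close> to the power \<open>- a\<^sub>0\<close> plus \<open>N\<close> to the power
  \<open>- \<nu> (1/3 - a\<^sub>0/2)\<close>; the condition on the exponents makes the union bound decay, and Borel--Cantelli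
  along \<open>N = 2\<^sup>i\<close> concludes.

  It remains to exclude geodesics asymptotic to an axis.  As the direction tends to \<open>e\<^sub>1\<close>, the
  vertical boundary weights tend to infinity, whereas they would bound from below an increment of \<open>G\<close>
  that equals a single weight whenever the geodesic makes a vertical step.
\<close>

section \<open>Last-passage times\<close>

text \<open>The constants in both hypotheses depend on \<open>\<delta>\<close> and may degenerate
  near the axes, so the union bound controls only directions in a window
  \<open>[2 * D, 1 - 2 * D]\<close>. A soft argument without rates must therefore place every
  geodesic in some window; the window may depend on the realization and on the path, and a sequence
  of windows exhausting all directions suffices. The reflected weights are known only through their
  joint law with the reflected environment. Whatever is proved for the original weights and then
  applied to the reflected ones has to be a property of that law; the locale
  \<open>boundary_env\<close> collects such properties. As there are uncountably many directions,
  they are stated for fixed directions, and events involve at most sequences of them. The squeezing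
  of increments rests on one planar fact, \<open>lpp_increments_mono\<close>: moving a starting
  point up and left raises vertical increments and lowers horizontal ones. The bound
  \<open>a\<^sub>0 < 2 / 3\<close> makes blocks longer than the range \<open>N powr (2 / 3)\<close>
  of the walk, so tilted directions stay valid at all heights the walk visits.\<close>

lemma up_right_paths_le: "\<pi> \<in> up_right_paths x y \<Longrightarrow> x \<le> y"
proof (induction \<pi> arbitrary: y rule: rev_induct)
  case Nil
  then show ?case by (simp add: up_right_paths_def)
next
  case (snoc a \<rho>)
  show ?case
  proof (cases "\<rho> = []")
    case True
    then show ?thesis using snoc.prems by (auto simp: up_right_paths_def)
  next
    case False
    have "\<rho> \<in> up_right_paths x (last \<rho>)" and st: "up_right_step (last \<rho>) y"
      using snoc.prems False by (auto simp: up_right_paths_def successively_append_iff)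
    then have "x \<le> last \<rho>" using snoc.IH by blast
    moreover have "last \<rho> \<le> y"
      using st by (cases "last \<rho>"; cases y) (auto simp: up_right_step_def)
    ultimately show ?thesis by order
  qed
qed

text \<open>Splitting off the last site is the recursion behind finiteness of the path sets and
  behind the one-step recursions for \<open>lpp\<close>.\<close>

lemma up_right_paths_snoc:
  "up_right_paths x y = (if x = y then {[x]} else {}) \<union>
     (\<lambda>\<pi>. \<pi> @ [y]) ` (up_right_paths x (y - (1, 0)) \<union> up_right_paths x (y - (0, 1)))"
  (is "?L = ?R")
proof (intro equalityI subsetI)
  fix \<pi> assume \<pi>: "\<pi> \<in> ?L"
  then have "\<pi> = butlast \<pi> @ [y]"
    by (metis (mono_tags, lifting) append_butlast_last_id mem_Collect_eq up_right_paths_def)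
  then obtain \<rho> where \<rho>: "\<pi> = \<rho> @ [y]" by blast
  show "\<pi> \<in> ?R"
  proof (cases "\<rho> = []")
    case True
    then show ?thesis using \<pi> \<rho> by (auto simp: up_right_paths_def)
  next
    case False
    have "\<rho> \<in> up_right_paths x (last \<rho>)" and st: "up_right_step (last \<rho>) y"
      using \<pi> \<rho> False by (auto simp: up_right_paths_def successively_append_iff)
    moreover have "last \<rho> = y - (1, 0) \<or> last \<rho> = y - (0, 1)"
      using st by (auto simp: up_right_step_def algebra_simps)
    ultimately show ?thesis using \<rho> by auto
  qed
next
  fix \<pi> assume "\<pi> \<in> ?R"
  then show "\<pi> \<in> ?L"
    by (auto simp: up_right_paths_def successively_append_iff up_right_step_def split: if_splits)
qed

lemma up_right_paths_empty: "\<not> x \<le> y \<Longrightarrow> up_right_paths x y = {}"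
  using up_right_paths_le by blast

lemma up_right_paths_finite_nonempty:
  "x \<le> y \<Longrightarrow> finite (up_right_paths x y) \<and> up_right_paths x y \<noteq> {}"
proof (induction "nat (fst y - fst x + snd y - snd x)" arbitrary: y rule: less_induct)
  case less
  have *: "finite (up_right_paths x z)"
    if "z = y - (1, 0) \<or> z = y - (0, 1)" for z
  proof (cases "x \<le> z")
    case True
    then show ?thesis using less.hyps[of z] less.prems that
      by (cases x; cases y) auto
  qed (simp add: up_right_paths_empty)
  have ne: "up_right_paths x (y - (1, 0)) \<union> up_right_paths x (y - (0, 1)) \<noteq> {}" if "x \<noteq> y"
  proof -
    have "x \<le> y - (1, 0) \<or> x \<le> y - (0, 1)"
      using that less.prems by (cases x; cases y) auto
    then show ?thesis
      using less.hyps[of "y - (1, 0)"] less.hyps[of "y - (0, 1)"] less.prems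
      by (cases x; cases y) auto
  qed
  have "finite (up_right_paths x y)"
    by (subst up_right_paths_snoc) (simp add: *)
  moreover have "up_right_paths x y \<noteq> {}"
    by (subst up_right_paths_snoc) (use ne in auto)
  ultimately show ?case by blast
qed

lemma finite_up_right_paths: "finite (up_right_paths x y)"
  using up_right_paths_finite_nonempty up_right_paths_empty by (metis finite.emptyI)

lemma path_weight_simps [simp]:
  "path_weight w [] = 0" "path_weight w (v # \<pi>) = w v + path_weight w \<pi>"
  "path_weight w (\<pi> @ \<rho>) = path_weight w \<pi> + path_weight w \<rho>"
  by (auto simp: path_weight_def)

lemma path_weight_le_lpp: "\<pi> \<in> up_right_paths x y \<Longrightarrow> path_weight w \<pi> \<le> lpp w x y"
  unfolding lpp_def by (rule Max_ge) (auto simp: finite_up_right_paths)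

lemma lpp_attained:
  assumes "x \<le> y" obtains \<pi> where "\<pi> \<in> up_right_paths x y" "path_weight w \<pi> = lpp w x y"
proof -
  have "lpp w x y \<in> path_weight w ` up_right_paths x y"
    unfolding lpp_def by (rule Max_in) (use up_right_paths_finite_nonempty[OF assms] in auto)
  then show ?thesis using that by auto
qed

lemma lpp_refl [simp]: "lpp w x x = w x"
proof -
  have "up_right_paths x x = {[x]}"
    by (subst up_right_paths_snoc) (cases x, auto simp: up_right_paths_empty)
  then show ?thesis by (simp add: lpp_def)
qed

lemma lpp_step_le:
  assumes "x \<le> y" "up_right_step y z"
  shows "lpp w x y + w z \<le> lpp w x z"
proof -
  obtain \<pi> where \<pi>: "\<pi> \<in> up_right_paths x y" "path_weight w \<pi> = lpp w x y"
    using lpp_attained[OF assms(1)] by blast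
  have "\<pi> @ [z] \<in> up_right_paths x z"
    using \<pi> assms(2) by (auto simp: up_right_paths_def successively_append_iff)
  from path_weight_le_lpp[OF this, of w] show ?thesis using \<pi> by simp
qed

lemma lpp_step_cases:
  assumes "x \<le> y" "x \<noteq> y"
  obtains "x \<le> y - (1, 0)" "lpp w x y = lpp w x (y - (1, 0)) + w y"
  | "x \<le> y - (0, 1)" "lpp w x y = lpp w x (y - (0, 1)) + w y"
proof -
  obtain \<pi> where \<pi>: "\<pi> \<in> up_right_paths x y" "path_weight w \<pi> = lpp w x y"
    using lpp_attained[OF assms(1)] by blast
  then obtain \<rho> z where \<rho>: "\<pi> = \<rho> @ [y]" "\<rho> \<in> up_right_paths x z"
      "z = y - (1, 0) \<or> z = y - (0, 1)"
    using assms(2) up_right_paths_snoc[of x y] by (auto simp del: split_paired_All split_paired_Ex) (metis prod.collapse)+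
  have "x \<le> z" using \<rho> up_right_paths_le by blast
  moreover have "up_right_step z y" using \<rho>(3) by (auto simp: up_right_step_def)
  ultimately have "lpp w x y = lpp w x z + w y"
    using lpp_step_le[of x z y w] path_weight_le_lpp[OF \<rho>(2), of w] \<pi> \<rho>(1) by auto
  then show ?thesis using that \<rho>(3) \<open>x \<le> z\<close> by auto
qed

lemma lpp_rec:
  assumes "a < c" "b < d"
  shows "lpp w (a, b) (c, d) = w (c, d) + max (lpp w (a, b) (c - 1, d)) (lpp w (a, b) (c, d - 1))"
proof -
  have "lpp w (a, b) (c - 1, d) + w (c, d) \<le> lpp w (a, b) (c, d)"
    "lpp w (a, b) (c, d - 1) + w (c, d) \<le> lpp w (a, b) (c, d)"
    using assms by (auto intro!: lpp_step_le simp: up_right_step_def)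
  moreover have "lpp w (a, b) (c, d) = lpp w (a, b) (c - 1, d) + w (c, d) \<or>
     lpp w (a, b) (c, d) = lpp w (a, b) (c, d - 1) + w (c, d)"
    by (rule lpp_step_cases[of "(a, b)" "(c, d)" w]) (use assms in auto)
  ultimately show ?thesis by (auto simp: max_def)
qed

lemma lpp_row:
  assumes "a < c" shows "lpp w (a, b) (c, b) = w (c, b) + lpp w (a, b) (c - 1, b)"
  by (rule lpp_step_cases[of "(a, b)" "(c, b)" w]) (use assms in auto)

lemma lpp_column:
  assumes "b < d" shows "lpp w (a, b) (a, d) = w (a, d) + lpp w (a, b) (a, d - 1)"
  by (rule lpp_step_cases[of "(a, b)" "(a, d)" w]) (use assms in auto)

lemma lpp_concat:
  assumes "x \<le> y" "up_right_step y z" "z \<le> u"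
  shows "lpp w x y + lpp w z u \<le> lpp w x u"
proof -
  obtain \<pi> where \<pi>: "\<pi> \<in> up_right_paths x y" "path_weight w \<pi> = lpp w x y"
    using lpp_attained[OF assms(1)] by blast
  obtain \<rho> where \<rho>: "\<rho> \<in> up_right_paths z u" "path_weight w \<rho> = lpp w z u"
    using lpp_attained[OF assms(3)] by blast
  have "\<pi> @ \<rho> \<in> up_right_paths x u"
    using \<pi> \<rho> assms(2) by (auto simp: up_right_paths_def successively_append_iff)
  from path_weight_le_lpp[OF this, of w] show ?thesis using \<pi> \<rho> by simp
qed

lemma lpp_translate: "lpp (\<lambda>v. w (v + z)) x y = lpp w (x + z) (y + z)"
proof -
  have "up_right_paths (x + z) (y + z) = map (\<lambda>v. v + z) ` up_right_paths x y" (is "?L = ?R")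
  proof (intro equalityI subsetI)
    fix \<pi> assume \<pi>: "\<pi> \<in> ?L"
    have "map (\<lambda>v. v - z) \<pi> \<in> up_right_paths x y"
      using \<pi> by (auto simp: up_right_paths_def hd_map last_map successively_map up_right_step_def)
    moreover have "\<pi> = map (\<lambda>v. v + z) (map (\<lambda>v. v - z) \<pi>)" by (simp add: comp_def)
    ultimately show "\<pi> \<in> ?R" by blast
  next
    fix \<pi> assume "\<pi> \<in> ?R"
    then show "\<pi> \<in> ?L"
      by (auto simp: up_right_paths_def hd_map last_map successively_map up_right_step_def)
  qed
  then show ?thesis
    by (simp add: lpp_def path_weight_def image_image comp_def)
qed

lemma lpp_transpose: "lpp (\<lambda>v. w (prod.swap v)) (prod.swap x) (prod.swap y) = lpp w x y"
proof -
  have st: "up_right_step (prod.swap u) (prod.swap v) = up_right_step u v" for u v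
    by (cases u; cases v) (auto simp: up_right_step_def)
  have "up_right_paths (prod.swap x) (prod.swap y) = map prod.swap ` up_right_paths x y" (is "?L = ?R")
  proof (intro equalityI subsetI)
    fix \<pi> assume \<pi>: "\<pi> \<in> ?L"
    have "map prod.swap \<pi> \<in> up_right_paths x y"
      using \<pi> by (auto simp: up_right_paths_def hd_map last_map successively_map st)
    moreover have "\<pi> = map prod.swap (map prod.swap \<pi>)" by (simp add: comp_def)
    ultimately show "\<pi> \<in> ?R" by blast
  next
    fix \<pi> assume "\<pi> \<in> ?R"
    then show "\<pi> \<in> ?L"
      by (auto simp: up_right_paths_def hd_map last_map successively_map st)
  qed
  then show ?thesis
    by (simp add: lpp_def path_weight_def image_image comp_def)
qed

text \<open>Negating sites and reversing lists exchanges the two endpoints; the recursions and the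
  comparison for the other endpoint are obtained in this way.\<close>

lemma lpp_reflect: "lpp (\<lambda>v. w (- v)) (- y) (- x) = lpp w x y"
proof -
  have st: "up_right_step (- u) (- v) = up_right_step v u" for u v
    by (cases u; cases v) (auto simp: up_right_step_def)
  have "up_right_paths (- y) (- x) = (\<lambda>\<pi>. rev (map uminus \<pi>)) ` up_right_paths x y" (is "?L = ?R")
  proof (intro equalityI subsetI)
    fix \<pi> assume \<pi>: "\<pi> \<in> ?L"
    have "rev (map uminus \<pi>) \<in> up_right_paths x y"
      using \<pi> by (auto simp: up_right_paths_def hd_map last_map hd_rev last_rev successively_map st)
    moreover have "\<pi> = rev (map uminus (rev (map uminus \<pi>)))" by (simp add: rev_map comp_def)
    ultimately show "\<pi> \<in> ?R" by blast
  next
    fix \<pi> assume "\<pi> \<in> ?R"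
    then show "\<pi> \<in> ?L"
      by (auto simp: up_right_paths_def hd_map last_map hd_rev last_rev successively_map st)
  qed
  then show ?thesis
    by (simp add: lpp_def path_weight_def image_image comp_def rev_map[symmetric])
qed

lemma lpp_rec_start:
  assumes "a < c" "b < d"
  shows "lpp w (a, b) (c, d) = w (a, b) + max (lpp w (a + 1, b) (c, d)) (lpp w (a, b + 1) (c, d))"
  using lpp_rec[of "- c" "- a" "- d" "- b" "\<lambda>v. w (- v)"] assms
    lpp_reflect[of w "(c, d)" "(a, b)"] lpp_reflect[of w "(c, d)" "(a + 1, b)"]
    lpp_reflect[of w "(c, d)" "(a, b + 1)"] by simp

lemma lpp_row_start:
  assumes "a < c" shows "lpp w (a, b) (c, b) = w (a, b) + lpp w (a + 1, b) (c, b)"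
  using lpp_row[of "- c" "- a" "\<lambda>v. w (- v)" "- b"] assms
    lpp_reflect[of w "(c, b)" "(a, b)"] lpp_reflect[of w "(c, b)" "(a + 1, b)"] by simp

lemma lpp_column_start:
  assumes "b < d" shows "lpp w (a, b) (a, d) = w (a, b) + lpp w (a, b + 1) (a, d)"
  using lpp_column[of "- d" "- b" "\<lambda>v. w (- v)" "- a"] assms
    lpp_reflect[of w "(a, d)" "(a, b)"] lpp_reflect[of w "(a, d)" "(a, b + 1)"] by simp

text \<open>Both terms count the weight at \<open>y\<close>, hence the subtraction. Removing
  \<open>y\<close> from the second path reduces the claim to \<open>lpp_concat\<close>.\<close>

lemma lpp_concat_overlap:
  assumes "x \<le> y" "y \<le> z"
  shows "lpp w x y + lpp w y z - w y \<le> lpp w x z"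
proof (cases "y = z")
  case False
  obtain a b where y: "y = (a, b)" by (cases y)
  obtain c d where z: "z = (c, d)" by (cases z)
  have "a \<le> c" "b \<le> d" using assms y z by auto
  then consider "a < c" "b < d" | "a < c" "b = d" | "a = c" "b < d"
    using False y z by fastforce
  then obtain v where v: "v = (a + 1, b) \<or> v = (a, b + 1)" "v \<le> z" "lpp w y z = w y + lpp w v z"
  proof cases
    case 1
    then show ?thesis using that[of "(a + 1, b)"] that[of "(a, b + 1)"] lpp_rec_start[OF 1, of w] y z
      by (auto simp: max_def split: if_splits)
  next
    case 2
    then show ?thesis using that[of "(a + 1, b)"] lpp_row_start[OF 2(1), of w] y z by auto
  next
    case 3
    then show ?thesis using that[of "(a, b + 1)"] lpp_column_start[OF 3(2), of w] y z by auto
  qed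
  have "up_right_step y v" using v(1) y by (auto simp: up_right_step_def)
  from lpp_concat[OF assms(1) this v(2), of w] v(3) show ?thesis by simp
qed simp

section \<open>Comparison of increments for different endpoints\<close>

text \<open>The start \<open>(s1', s2')\<close> lies to the upper left of \<open>(s1, s2)\<close>.
  Across a unit square the vertical increment on the right side is \<open>w + max 0 (V - H)\<close>,
  with \<open>V\<close> the vertical increment on the left side and \<open>H\<close> the horizontal
  one at the bottom; the horizontal increment on top is \<open>w + max 0 (H - V)\<close>. Each
  inequality feeds the other, so both are proved in one induction from the corner
  \<open>(s1, s2')\<close>.\<close>

lemma lpp_increments_mono_aux:
  fixes s1 s2 s1' s2' :: int
  assumes "s1' \<le> s1" "s2 \<le> s2'"
  shows "\<lbrakk>s1 \<le> y1; s2' \<le> y2\<rbrakk> \<Longrightarrow>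
    (s2' < y2 \<longrightarrow> lpp w (s1, s2) (y1, y2) - lpp w (s1, s2) (y1, y2 - 1)
             \<le> lpp w (s1', s2') (y1, y2) - lpp w (s1', s2') (y1, y2 - 1)) \<and>
    (s1 < y1 \<longrightarrow> lpp w (s1', s2') (y1, y2) - lpp w (s1', s2') (y1 - 1, y2)
             \<le> lpp w (s1, s2) (y1, y2) - lpp w (s1, s2) (y1 - 1, y2))"
proof (induction "nat (y1 + y2 - s1 - s2')" arbitrary: y1 y2 rule: less_induct)
  case less
  consider "y1 = s1" "y2 = s2'" | "y1 = s1" "s2' < y2" | "s1 < y1" "y2 = s2'" | "s1 < y1" "s2' < y2"
    using less.prems by linarith
  then show ?case
  proof cases
    case 2
    \<comment> \<open>On this column the path from \<open>(s1, s2)\<close> is unique, so its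
      increment is the bare weight, the least possible value.\<close>
    have "lpp w (s1', s2') (y1, y2 - 1) + w (y1, y2) \<le> lpp w (s1', s2') (y1, y2)"
      using 2 assms by (intro lpp_step_le) (auto simp: up_right_step_def)
    then show ?thesis using 2 assms lpp_column[of s2 y2 w s1] by auto
  next
    case 3
    have "lpp w (s1, s2) (y1 - 1, y2) + w (y1, y2) \<le> lpp w (s1, s2) (y1, y2)"
      using 3 assms by (intro lpp_step_le) (auto simp: up_right_step_def)
    then show ?thesis using 3 assms lpp_row[of s1' y1 w s2'] by auto
  next
    case 4
    have "lpp w (s1, s2) (y1 - 1, y2) - lpp w (s1, s2) (y1 - 1, y2 - 1)
        \<le> lpp w (s1', s2') (y1 - 1, y2) - lpp w (s1', s2') (y1 - 1, y2 - 1)"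
      using less.hyps[of "y1 - 1" y2] 4 by auto
    moreover have "lpp w (s1', s2') (y1, y2 - 1) - lpp w (s1', s2') (y1 - 1, y2 - 1)
        \<le> lpp w (s1, s2) (y1, y2 - 1) - lpp w (s1, s2) (y1 - 1, y2 - 1)"
      using less.hyps[of y1 "y2 - 1"] 4 by auto
    ultimately show ?thesis
      using 4 assms lpp_rec[of s1 y1 s2 y2 w] lpp_rec[of s1' y1 s2' y2 w] by auto
  qed auto
qed

lemma lpp_increments_mono:
  fixes s1 s2 s1' s2' :: int
  assumes "s1' \<le> s1" "s2 \<le> s2'"
  shows "\<lbrakk>s1 \<le> y1; s2' < y2\<rbrakk> \<Longrightarrow> lpp w (s1, s2) (y1, y2) - lpp w (s1, s2) (y1, y2 - 1)
             \<le> lpp w (s1', s2') (y1, y2) - lpp w (s1', s2') (y1, y2 - 1)"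
    and "\<lbrakk>s1 < y1; s2' \<le> y2\<rbrakk> \<Longrightarrow> lpp w (s1', s2') (y1, y2) - lpp w (s1', s2') (y1 - 1, y2)
             \<le> lpp w (s1, s2) (y1, y2) - lpp w (s1, s2) (y1 - 1, y2)"
  using lpp_increments_mono_aux[OF assms, of y1 y2 w] by auto

lemma lpp_increments_mono_end:
  fixes c e c' e' :: int
  assumes "c \<le> c'" "e' \<le> e" "i < c" "j \<le> e'"
  shows "lpp w (i, j) (c', e') - lpp w (i + 1, j) (c', e') \<le> lpp w (i, j) (c, e) - lpp w (i + 1, j) (c, e)"
  using lpp_increments_mono(2)[of "- c'" "- c" "- e" "- e'" "- i" "- j" "\<lambda>v. w (- v)"] assms
    lpp_reflect[of w "(c', e')" "(i, j)"] lpp_reflect[of w "(c', e')" "(i + 1, j)"]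
    lpp_reflect[of w "(c, e)" "(i, j)"] lpp_reflect[of w "(c, e)" "(i + 1, j)"]
  by simp

text \<open>Exits are compared through these two maxima instead of exit sets: for end points off the
  axes, \<open>V_max \<le> H_max\<close> says that some optimal stationary path leaves horizontally,
  and ties need no case distinction.\<close>

definition H_max :: "(site \<Rightarrow> real) \<Rightarrow> (site \<Rightarrow> real) \<Rightarrow> site \<Rightarrow> site \<Rightarrow> real" where
  "H_max w I x y = Max (horiz_exit w I x y ` {1..fst y - fst x})"

definition V_max :: "(site \<Rightarrow> real) \<Rightarrow> (site \<Rightarrow> real) \<Rightarrow> site \<Rightarrow> site \<Rightarrow> real" where
  "V_max w J x y = Max (vert_exit w J x y ` {1..snd y - snd x})"

text \<open>The part of the almost sure properties that concerns one direction and one realization;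
  monotonicity in the direction is kept separate.\<close>

definition consistent_weights :: "(site \<Rightarrow> real) \<Rightarrow> (site \<Rightarrow> real) \<Rightarrow> (site \<Rightarrow> real) \<Rightarrow> bool" where
  "consistent_weights w I J \<longleftrightarrow> (\<forall>x. w x = min (I x) (J x)) \<and>
     (\<forall>x y z. x \<le> y \<and> y \<le> z \<longrightarrow> lpp_bd w I J x y + lpp_bd w I J y z = lpp_bd w I J x z)"

lemma lpp_bd_interior:
  "a < c \<Longrightarrow> b < d \<Longrightarrow> lpp_bd w I J (a, b) (c, d) = max (H_max w I (a, b) (c, d)) (V_max w J (a, b) (c, d))"
  by (simp add: lpp_bd_def H_max_def V_max_def)

lemma lpp_bd_row: "lpp_bd w I J (a, b) (c, b) = (\<Sum>i=1..c - a. I (a + i, b))"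
  by (simp add: lpp_bd_def)

lemma lpp_bd_column: "lpp_bd w I J (a, b) (a, d) = (\<Sum>i=1..d - b. J (a, b + i))"
  by (simp add: lpp_bd_def)

lemma lpp_bd_up: "lpp_bd w I J (a, b - 1) (a, b) = J (a, b)"
  by (simp add: lpp_bd_column)

lemma H_max_ge: "1 \<le> k \<Longrightarrow> k \<le> c - a \<Longrightarrow> horiz_exit w I (a, b) (c, d) k \<le> H_max w I (a, b) (c, d)"
  by (simp add: H_max_def)

lemma V_max_ge: "1 \<le> k \<Longrightarrow> k \<le> d - b \<Longrightarrow> vert_exit w J (a, b) (c, d) k \<le> V_max w J (a, b) (c, d)"
  by (simp add: V_max_def)

lemma H_max_attained:
  assumes "a < c"
  obtains k where "1 \<le> k" "k \<le> c - a" "H_max w I (a, b) (c, d) = horiz_exit w I (a, b) (c, d) k"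
proof -
  have "H_max w I (a, b) (c, d) \<in> horiz_exit w I (a, b) (c, d) ` {1..c - a}"
    unfolding H_max_def fst_conv by (rule Max_in) (use assms in auto)
  then show ?thesis using that by auto
qed

lemma V_max_attained:
  assumes "b < d"
  obtains k where "1 \<le> k" "k \<le> d - b" "V_max w J (a, b) (c, d) = vert_exit w J (a, b) (c, d) k"
proof -
  have "V_max w J (a, b) (c, d) \<in> vert_exit w J (a, b) (c, d) ` {1..d - b}"
    unfolding V_max_def snd_conv by (rule Max_in) (use assms in auto)
  then show ?thesis using that by auto
qed

text \<open>A horizontal exit continues from a site to the lower right of the one following a
  vertical exit, so it gains less when the end point is raised. Taking the best horizontal exit for
  the upper end point and the best vertical exit for the lower one makes both maxima bound in the
  right direction.\<close>

lemma H_max_minus_V_max_up: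
  assumes "a < c" "b < d"
  shows "H_max w I (a, b) (c, d + 1) - H_max w I (a, b) (c, d)
       \<le> V_max w J (a, b) (c, d + 1) - V_max w J (a, b) (c, d)"
proof -
  obtain k where k: "1 \<le> k" "k \<le> c - a" "H_max w I (a, b) (c, d + 1) = horiz_exit w I (a, b) (c, d + 1) k"
    using H_max_attained assms by blast
  obtain l where l: "1 \<le> l" "l \<le> d - b" "V_max w J (a, b) (c, d) = vert_exit w J (a, b) (c, d) l"
    using V_max_attained assms by blast
  have "horiz_exit w I (a, b) (c, d) k \<le> H_max w I (a, b) (c, d)"
    "vert_exit w J (a, b) (c, d + 1) l \<le> V_max w J (a, b) (c, d + 1)"
    using k l by (auto intro!: H_max_ge V_max_ge)
  moreover have "lpp w (a + k, b + 1) (c, d + 1) - lpp w (a + k, b + 1) (c, d)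
      \<le> lpp w (a + 1, b + l) (c, d + 1) - lpp w (a + 1, b + l) (c, d)"
    using lpp_increments_mono(1)[of "a + 1" "a + k" "b + 1" "b + l" c "d + 1" w] k l by auto
  ultimately show ?thesis using k(3) l(3) by (simp add: horiz_exit_def vert_exit_def)
qed

lemma V_max_minus_H_max_right:
  assumes "a < c" "b < d"
  shows "V_max w J (a, b) (c + 1, d) - V_max w J (a, b) (c, d)
       \<le> H_max w I (a, b) (c + 1, d) - H_max w I (a, b) (c, d)"
proof -
  obtain k where k: "1 \<le> k" "k \<le> c - a" "H_max w I (a, b) (c, d) = horiz_exit w I (a, b) (c, d) k"
    using H_max_attained assms by blast
  obtain l where l: "1 \<le> l" "l \<le> d - b" "V_max w J (a, b) (c + 1, d) = vert_exit w J (a, b) (c + 1, d) l"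
    using V_max_attained assms by blast
  have "horiz_exit w I (a, b) (c + 1, d) k \<le> H_max w I (a, b) (c + 1, d)"
    "vert_exit w J (a, b) (c, d) l \<le> V_max w J (a, b) (c, d)"
    using k l by (auto intro!: H_max_ge V_max_ge)
  moreover have "lpp w (a + 1, b + l) (c + 1, d) - lpp w (a + 1, b + l) (c, d)
      \<le> lpp w (a + k, b + 1) (c + 1, d) - lpp w (a + k, b + 1) (c, d)"
    using lpp_increments_mono(2)[of "a + 1" "a + k" "b + 1" "b + l" "c + 1" d w] k l by auto
  ultimately show ?thesis using k(3) l(3) by (simp add: horiz_exit_def vert_exit_def)
qed

text \<open>Since \<open>H_max - V_max\<close> is monotone in the height, exits have to be
  controlled at one extreme end point of a column only.\<close>

lemma H_exit_down:
  assumes "a < c" "b < d" "d \<le> d'" "V_max w J (a, b) (c, d') \<le> H_max w I (a, b) (c, d')"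
  shows "V_max w J (a, b) (c, d) \<le> H_max w I (a, b) (c, d)"
  using assms(3,4)
proof (induction d' rule: int_ge_induct)
  case (step i)
  then show ?case using H_max_minus_V_max_up[of a c b i w I J] assms(1,2) by linarith
qed

lemma V_exit_up:
  assumes "a < c" "b < d" "d \<le> d'" "H_max w I (a, b) (c, d) \<le> V_max w J (a, b) (c, d)"
  shows "H_max w I (a, b) (c, d') \<le> V_max w J (a, b) (c, d')"
  using assms(3)
proof (induction d' rule: int_ge_induct)
  case base then show ?case using assms by simp
next
  case (step i)
  then show ?case using H_max_minus_V_max_up[of a c b i w I J] assms(1,2) by linarith
qed

lemma V_exit_left:
  assumes "a < c" "b < d" "c \<le> c'" "H_max w I (a, b) (c', d) \<le> V_max w J (a, b) (c', d)"
  shows "H_max w I (a, b) (c, d) \<le> V_max w J (a, b) (c, d)"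
  using assms(3,4)
proof (induction c' rule: int_ge_induct)
  case (step i)
  then show ?case using V_max_minus_H_max_right[of a i b d w J I] assms(1,2) by linarith
qed

lemma consistent_add:
  "consistent_weights w I J \<Longrightarrow> x \<le> y \<Longrightarrow> y \<le> z \<Longrightarrow>
    lpp_bd w I J x z = lpp_bd w I J x y + lpp_bd w I J y z"
  unfolding consistent_weights_def by metis

lemma consistent_le:
  "consistent_weights w I J \<Longrightarrow> w x \<le> I x" "consistent_weights w I J \<Longrightarrow> w x \<le> J x"
  by (metis consistent_weights_def min.cobounded1, metis consistent_weights_def min.cobounded2)

text \<open>Both sides are the stationary passage time across a unit square, split along its two
  boundary routes.\<close>

lemma consistent_square:
  assumes "consistent_weights w I J"
  shows "I (a + 1, b) + J (a + 1, b + 1) = J (a, b + 1) + I (a + 1, b + 1)"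
  using consistent_add[OF assms, of "(a, b)" "(a + 1, b)" "(a + 1, b + 1)"]
    consistent_add[OF assms, of "(a, b)" "(a, b + 1)" "(a + 1, b + 1)"]
  by (simp add: lpp_bd_row lpp_bd_column)

text \<open>
  The boundary weights dominate or are dominated by point-to-point increments depending on the
  axis through which the stationary path leaves.  The starting point is shifted by one because
  an exit at \<open>x + k e\<^sub>1\<close> continues from \<open>x + k e\<^sub>1 + e\<^sub>2\<close>.
\<close>

lemma J_le_increment:
  assumes "consistent_weights w I J" "a < c" "b < d"
    and "V_max w J (a, b - 1) (c, d) \<le> H_max w I (a, b - 1) (c, d)"
  shows "J (c, d) \<le> lpp w (a, b) (c, d) - lpp w (a, b) (c, d - 1)"
proof -
  obtain k where k: "1 \<le> k" "k \<le> c - a"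
      "H_max w I (a, b - 1) (c, d) = horiz_exit w I (a, b - 1) (c, d) k"
    using H_max_attained assms by blast
  have "lpp_bd w I J (a, b - 1) (c, d) = horiz_exit w I (a, b - 1) (c, d) k"
    using assms k(3) by (simp add: lpp_bd_interior)
  moreover have "horiz_exit w I (a, b - 1) (c, d - 1) k \<le> lpp_bd w I J (a, b - 1) (c, d - 1)"
    using assms H_max_ge[OF k(1,2), of w I "b - 1" "d - 1"] by (simp add: lpp_bd_interior)
  moreover have "lpp_bd w I J (a, b - 1) (c, d) = lpp_bd w I J (a, b - 1) (c, d - 1) + J (c, d)"
    using consistent_add[OF assms(1), of "(a, b - 1)" "(c, d - 1)" "(c, d)"] assms
    by (simp add: lpp_bd_up)
  moreover have "lpp w (a + k, b) (c, d) - lpp w (a + k, b) (c, d - 1)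
      \<le> lpp w (a, b) (c, d) - lpp w (a, b) (c, d - 1)"
    using lpp_increments_mono(1)[of a "a + k" b b c d w] k assms by auto
  ultimately show ?thesis by (simp add: horiz_exit_def)
qed

text \<open>The exit is prescribed at the lower end point here: the optimal vertical exit for
  \<open>(c, d - 1)\<close> is merely a competitor for \<open>(c, d)\<close>, which bounds the
  increment \<open>J\<close> from below.\<close>

lemma increment_le_J:
  assumes "consistent_weights w I J" "a \<le> c" "b < d - 1"
    and "H_max w I (a - 1, b) (c, d - 1) \<le> V_max w J (a - 1, b) (c, d - 1)"
  shows "lpp w (a, b) (c, d) - lpp w (a, b) (c, d - 1) \<le> J (c, d)"
proof -
  obtain k where k: "1 \<le> k" "k \<le> d - 1 - b"
      "V_max w J (a - 1, b) (c, d - 1) = vert_exit w J (a - 1, b) (c, d - 1) k"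
    using V_max_attained assms(3) by blast
  have "lpp_bd w I J (a - 1, b) (c, d - 1) = vert_exit w J (a - 1, b) (c, d - 1) k"
    using assms k(3) by (simp add: lpp_bd_interior)
  moreover have "vert_exit w J (a - 1, b) (c, d) k \<le> lpp_bd w I J (a - 1, b) (c, d)"
    using assms k V_max_ge[of k d b w J "a - 1" c] by (simp add: lpp_bd_interior)
  moreover have "lpp_bd w I J (a - 1, b) (c, d) = lpp_bd w I J (a - 1, b) (c, d - 1) + J (c, d)"
    using consistent_add[OF assms(1), of "(a - 1, b)" "(c, d - 1)" "(c, d)"] assms
    by (simp add: lpp_bd_up)
  moreover have "lpp w (a, b) (c, d) - lpp w (a, b) (c, d - 1)
      \<le> lpp w (a, b + k) (c, d) - lpp w (a, b + k) (c, d - 1)"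
    using lpp_increments_mono(1)[of a a b "b + k" c d w] k assms by auto
  ultimately show ?thesis by (simp add: vert_exit_def)
qed

section \<open>Exchanging the coordinate axes\<close>

lemma horiz_exit_transpose:
  "horiz_exit (\<lambda>v. w (prod.swap v)) (\<lambda>v. J (prod.swap v)) (b, a) (d, c) k = vert_exit w J (a, b) (c, d) k"
  using lpp_transpose[of w "(a + 1, b + k)" "(c, d)"] by (simp add: horiz_exit_def vert_exit_def)

lemma vert_exit_transpose:
  "vert_exit (\<lambda>v. w (prod.swap v)) (\<lambda>v. I (prod.swap v)) (b, a) (d, c) k = horiz_exit w I (a, b) (c, d) k"
  using lpp_transpose[of w "(a + k, b + 1)" "(c, d)"] by (simp add: horiz_exit_def vert_exit_def)

lemma H_max_transpose:
  "H_max (\<lambda>v. w (prod.swap v)) (\<lambda>v. J (prod.swap v)) (b, a) (d, c) = V_max w J (a, b) (c, d)"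
  by (simp add: H_max_def V_max_def horiz_exit_transpose)

lemma V_max_transpose:
  "V_max (\<lambda>v. w (prod.swap v)) (\<lambda>v. I (prod.swap v)) (b, a) (d, c) = H_max w I (a, b) (c, d)"
  by (simp add: H_max_def V_max_def vert_exit_transpose)

lemma lpp_bd_transpose:
  "lpp_bd (\<lambda>v. w (prod.swap v)) (\<lambda>v. J (prod.swap v)) (\<lambda>v. I (prod.swap v)) (b, a) (d, c)
     = lpp_bd w I J (a, b) (c, d)"
  by (simp add: lpp_bd_def horiz_exit_transpose vert_exit_transpose max.commute)

lemma consistent_transpose:
  assumes "consistent_weights w I J"
  shows "consistent_weights (\<lambda>v. w (prod.swap v)) (\<lambda>v. J (prod.swap v)) (\<lambda>v. I (prod.swap v))"
  unfolding consistent_weights_def split_paired_All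
  using assms by (auto simp: lpp_bd_transpose min.commute consistent_weights_def)

lemma I_le_increment:
  assumes "consistent_weights w I J" "a < c" "b < d"
    and "H_max w I (a - 1, b) (c, d) \<le> V_max w J (a - 1, b) (c, d)"
  shows "I (c, d) \<le> lpp w (a, b) (c, d) - lpp w (a, b) (c - 1, d)"
  using J_le_increment[OF consistent_transpose[OF assms(1)], of b d a c] assms
    lpp_transpose[of w "(a, b)" "(c, d)"] lpp_transpose[of w "(a, b)" "(c - 1, d)"]
  by (simp add: H_max_transpose V_max_transpose)

lemma telescope_le:
  fixes f g :: "int \<Rightarrow> real"
  assumes "a \<le> b" "\<And>i. a < i \<Longrightarrow> i \<le> b \<Longrightarrow> f i - f (i - 1) \<le> g i - g (i - 1)"
  shows "f b - f a \<le> g b - g a"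
  using assms
proof (induction b rule: int_ge_induct)
  case (step i)
  then show ?case using step.prems[of "i + 1"] by force
qed simp

lemma int_sum_last: "1 \<le> (n::int) \<Longrightarrow> (\<Sum>i=1..n. f i) = (\<Sum>i=1..n - 1. f i) + (f n :: real)"
proof -
  assume "1 \<le> n"
  then have "{1..n} = insert n {1..n - 1}" by auto
  then show ?thesis by simp
qed

text \<open>Splits a geodesic at the last site of its first column, the form in which it can be
  compared with \<open>vert_exit\<close>, where that column carries \<open>J\<close>.\<close>

lemma lpp_leave_column:
  assumes "a < c" "b \<le> d"
  shows "\<exists>l\<ge>0. b + l \<le> d \<and> lpp w (a, b) (c, d) = (\<Sum>j=0..l. w (a, b + j)) + lpp w (a + 1, b + l) (c, d)"
  using assms(2)
proof (induction b rule: int_le_induct)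
  case base
  show ?case by (rule exI[of _ 0]) (use lpp_row_start[OF assms(1), of w d] in auto)
next
  case (step i)
  consider "lpp w (a, i - 1) (c, d) = w (a, i - 1) + lpp w (a + 1, i - 1) (c, d)"
    | "lpp w (a, i - 1) (c, d) = w (a, i - 1) + lpp w (a, i) (c, d)"
    using lpp_rec_start[of a c "i - 1" d w] assms(1) step.hyps by (auto simp: max_def split: if_splits)
  then show ?case
  proof cases
    case 1
    then show ?thesis using step.hyps by (intro exI[of _ 0]) auto
  next
    case 2
    obtain l where l: "l \<ge> 0" "i + l \<le> d"
      "lpp w (a, i) (c, d) = (\<Sum>j=0..l. w (a, i + j)) + lpp w (a + 1, i + l) (c, d)"
      using step.IH by blast
    have "(\<Sum>j=0..l. w (a, i + j)) = (\<Sum>j\<in>{1..l + 1}. w (a, i - 1 + j))"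
      by (rule sum.reindex_bij_witness[of _ "\<lambda>j. j - 1" "\<lambda>j. j + 1"]) auto
    moreover have "{0..l + 1} = insert 0 {1..l + 1}" using l by auto
    ultimately have "(\<Sum>j=0..l + 1. w (a, i - 1 + j)) = w (a, i - 1) + (\<Sum>j=0..l. w (a, i + j))"
      by simp
    then show ?thesis using 2 l by (intro exI[of _ "l + 1"]) auto
  qed
qed

text \<open>
  The stationary geodesic to \<open>(c, e)\<close> passes above \<open>(a, b)\<close> by \<open>Vo\<close> and strictly below the origin by
  \<open>Hu\<close>, so a point-to-point geodesic from \<open>(a, b)\<close> cannot reach the origin.  The inequality
  that expresses this is monotone in both endpoints, hence it also rules out a geodesic through the
  origin from any \<open>(a', b')\<close> further right to any \<open>(c', e')\<close> further right.
\<close>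

lemma right_deviation:
  assumes cons: "consistent_weights w I J"
    and o: "a \<le> 0" "b < - 1" and d: "0 < c"
    and Hu: "V_max w J (0, - 1) (c, e) < H_max w I (0, - 1) (c, e)"
    and Vo: "H_max w I (a - 1, b) (c, e) < V_max w J (a - 1, b) (c, e)"
    and o': "a \<le> a'" "a' \<le> 0" "b' \<le> b" and d': "c \<le> c'" "0 \<le> e'" "e' \<le> e"
  shows "lpp w (a', b') (0, 0) + lpp w (0, 0) (c', e') - w (0, 0) < lpp w (a', b') (c', e')"
proof (rule ccontr)
  assume contra: "\<not> ?thesis"
  let ?G = "lpp_bd w I J"
  \<comment> \<open>The optimal stationary path from \<open>(0, - 1)\<close> runs below the origin
    to \<open>(k, - 1)\<close> and then steps up to \<open>(k, 0)\<close>; this is the competing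
    route.\<close>
  obtain k where k: "1 \<le> k" "k \<le> c" "H_max w I (0, - 1) (c, e) = horiz_exit w I (0, - 1) (c, e) k"
    using H_max_attained[of 0 c w I "- 1" e] d by auto
  have bd_u: "?G (0, - 1) (c, e) = (\<Sum>i=1..k. I (i, - 1)) + lpp w (k, 0) (c, e)"
    using k(3) Hu d d' by (simp add: lpp_bd_interior horiz_exit_def)
  \<comment> \<open>A horizontal exit towards \<open>(k, - 1)\<close> could be prolonged along the
    optimal stationary path to \<open>(c, e)\<close>, giving an optimal horizontal exit there and
    contradicting \<open>Vo\<close>.\<close>
  have Vz: "H_max w I (a - 1, b) (k, - 1) < V_max w J (a - 1, b) (k, - 1)"
  proof (rule ccontr)
    assume n: "\<not> ?thesis"
    obtain m where m: "1 \<le> m" "m \<le> k - (a - 1)"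
        "H_max w I (a - 1, b) (k, - 1) = horiz_exit w I (a - 1, b) (k, - 1) m"
      using H_max_attained[of "a - 1" k w I b "- 1"] o k by auto
    have "?G (a - 1, b) (k, - 1) = horiz_exit w I (a - 1, b) (k, - 1) m"
      using n m(3) o k by (simp add: lpp_bd_interior)
    moreover have "horiz_exit w I (a - 1, b) (k, - 1) m + lpp w (k, 0) (c, e)
        \<le> horiz_exit w I (a - 1, b) (c, e) m"
      using lpp_concat[of "(a - 1 + m, b + 1)" "(k, - 1)" "(k, 0)" "(c, e)" w] m o k d d'
      by (simp add: horiz_exit_def up_right_step_def)
    moreover have "horiz_exit w I (a - 1, b) (c, e) m \<le> H_max w I (a - 1, b) (c, e)"
      using m k by (intro H_max_ge) auto
    moreover have "?G (a - 1, b) (k, - 1) = ?G (a - 1, b) (0, - 1) + (\<Sum>i=1..k. I (i, - 1))"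
      using consistent_add[OF cons, of "(a - 1, b)" "(0, - 1)" "(k, - 1)"] o k
      by (simp add: lpp_bd_row)
    moreover have "?G (a - 1, b) (c, e) = ?G (a - 1, b) (0, - 1) + ?G (0, - 1) (c, e)"
      using consistent_add[OF cons, of "(a - 1, b)" "(0, - 1)" "(c, e)"] o d d' by simp
    moreover have "?G (a - 1, b) (c, e) = max (H_max w I (a - 1, b) (c, e)) (V_max w J (a - 1, b) (c, e))"
      using o d d' by (simp add: lpp_bd_interior)
    ultimately show False using Vo bd_u by simp
  qed
  have V: "H_max w I (a - 1, b) (i, - 1) \<le> V_max w J (a - 1, b) (i, - 1)" if "0 \<le> i" "i \<le> k" for i
    using V_exit_left[of "a - 1" i b "- 1" k w I J] Vz that o by auto
  have Iz: "(\<Sum>i=1..k. I (i, - 1)) \<le> lpp w (a, b) (k, - 1) - lpp w (a, b) (0, - 1)"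
  proof -
    have "(\<Sum>i=1..k. I (i, - 1)) - (\<Sum>i=1..0. I (i, - 1))
        \<le> lpp w (a, b) (k, - 1) - lpp w (a, b) (0, - 1)"
    proof (rule telescope_le)
      fix i :: int assume i: "0 < i" "i \<le> k"
      show "(\<Sum>i=1..i. I (i, - 1)) - (\<Sum>i=1..i - 1. I (i, - 1))
          \<le> lpp w (a, b) (i, - 1) - lpp w (a, b) (i - 1, - 1)"
        using I_le_increment[OF cons, of a i b "- 1"] V[of i] i o int_sum_last[of i "\<lambda>i. I (i, - 1)"]
        by simp
    qed (use k in auto)
    then show ?thesis by simp
  qed
  have J0: "lpp w (a, b) (0, 0) - lpp w (a, b) (0, - 1) \<le> J (0, 0)"
    using increment_le_J[OF cons, of a 0 b 0] V[of 0] o k by simp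
  have add0: "?G (0, - 1) (c, e) = J (0, 0) + ?G (0, 0) (c, e)"
    using consistent_add[OF cons, of "(0, - 1)" "(0, 0)" "(c, e)"] d d' lpp_bd_up[of w I J 0 0] by simp
  have wJ: "w x \<le> J x" for x by (rule consistent_le(2)[OF cons])
  \<comment> \<open>A geodesic from the origin becomes a vertical exit from \<open>(0, - 1)\<close>
    when the weights on column \<open>0\<close> are replaced by the larger \<open>J\<close>; the
    replacement at the origin itself is recorded exactly.\<close>
  have lower: "J (0, 0) + lpp w (0, 0) (c, e) - w (0, 0) \<le> V_max w J (0, - 1) (c, e)"
  proof -
    obtain l where l: "l \<ge> 0" "l \<le> e"
      "lpp w (0, 0) (c, e) = (\<Sum>j=0..l. w (0, j)) + lpp w (1, l) (c, e)"
      using lpp_leave_column[of 0 c 0 e w] d d' by auto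
    have "(\<Sum>j=0..l. J (0, j)) = (\<Sum>j\<in>{1..l + 1}. J (0, - 1 + j))"
      by (rule sum.reindex_bij_witness[of _ "\<lambda>j. j - 1" "\<lambda>j. j + 1"]) auto
    then have "vert_exit w J (0, - 1) (c, e) (l + 1) = (\<Sum>j=0..l. J (0, j)) + lpp w (1, l) (c, e)"
      by (simp add: vert_exit_def)
    moreover have "vert_exit w J (0, - 1) (c, e) (l + 1) \<le> V_max w J (0, - 1) (c, e)"
      using l by (intro V_max_ge) auto
    moreover have "{0..l} = insert 0 {1..l}" using l by auto
    moreover have "(\<Sum>j=1..l. w (0, j)) \<le> (\<Sum>j=1..l. J (0, j))" by (intro sum_mono wJ)
    ultimately show ?thesis using l(3) by simp
  qed
  \<comment> \<open>The contradiction compares passing through the origin with the detour through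
    \<open>(k, - 1)\<close> and \<open>(k, 0)\<close>. The differences involved are monotone in the
    endpoints, which moves the comparison to the primed points.\<close>
  have "lpp w (a', b') (0, 0) - lpp w (a', b') (0, - 1) \<le> lpp w (a, b) (0, 0) - lpp w (a, b) (0, - 1)"
    using lpp_increments_mono(1)[of a a' b' b 0 0 w] o o' by simp
  moreover have "lpp w (a, b) (k, - 1) - lpp w (a, b) (0, - 1) \<le> lpp w (a', b') (k, - 1) - lpp w (a', b') (0, - 1)"
    by (rule telescope_le) (use lpp_increments_mono(2)[of a a' b' b _ "- 1" w] o o' k in auto)
  moreover have "lpp w (k, 0) (c, e) - lpp w (0, 0) (c, e) \<le> lpp w (k, 0) (c', e') - lpp w (0, 0) (c', e')"
  proof (rule telescope_le)
    fix i :: int assume "0 < i" "i \<le> k"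
    then show "lpp w (i, 0) (c, e) - lpp w (i - 1, 0) (c, e) \<le> lpp w (i, 0) (c', e') - lpp w (i - 1, 0) (c', e')"
      using lpp_increments_mono_end[of c c' e' e "i - 1" 0 w] k d' by simp
  qed (use k in auto)
  moreover have "lpp w (a', b') (k, - 1) + lpp w (k, 0) (c', e') \<le> lpp w (a', b') (c', e')"
    using o o' k d' by (intro lpp_concat) (auto simp: up_right_step_def)
  ultimately show False
    using contra bd_u Iz J0 add0 lower Hu lpp_bd_interior[of 0 c "- 1" e w I J] d d' by auto
qed

section \<open>Exit points of stationary passage times\<close>

lemma borel_measurable_lpp [measurable (raw)]:
  assumes "\<And>v. W v \<in> borel_measurable N"
  shows "(\<lambda>p. lpp (\<lambda>v. W v p) x y) \<in> borel_measurable N"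
proof -
  have "(\<lambda>p. path_weight (\<lambda>v. W v p) \<pi>) \<in> borel_measurable N" for \<pi>
    by (induction \<pi>) (auto intro: borel_measurable_add assms)
  then show ?thesis
    unfolding lpp_def by (intro borel_measurable_Max) (auto simp: finite_up_right_paths)
qed

lemma borel_measurable_horiz_exit:
  assumes [measurable]: "\<And>v. W v \<in> borel_measurable N" "\<And>v. I v \<in> borel_measurable N"
  shows "(\<lambda>p. horiz_exit (\<lambda>v. W v p) (\<lambda>v. I v p) x y k) \<in> borel_measurable N"
  unfolding horiz_exit_def by measurable

lemma borel_measurable_vert_exit:
  assumes [measurable]: "\<And>v. W v \<in> borel_measurable N" "\<And>v. J v \<in> borel_measurable N"
  shows "(\<lambda>p. vert_exit (\<lambda>v. W v p) (\<lambda>v. J v p) x y k) \<in> borel_measurable N"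
  unfolding vert_exit_def by measurable

lemma borel_measurable_H_max [measurable (raw)]:
  assumes "\<And>v. W v \<in> borel_measurable N" "\<And>v. I v \<in> borel_measurable N"
  shows "(\<lambda>p. H_max (\<lambda>v. W v p) (\<lambda>v. I v p) x y) \<in> borel_measurable N"
  unfolding H_max_def by (intro borel_measurable_Max borel_measurable_horiz_exit assms) auto

lemma borel_measurable_V_max [measurable (raw)]:
  assumes "\<And>v. W v \<in> borel_measurable N" "\<And>v. J v \<in> borel_measurable N"
  shows "(\<lambda>p. V_max (\<lambda>v. W v p) (\<lambda>v. J v p) x y) \<in> borel_measurable N"
  unfolding V_max_def by (intro borel_measurable_Max borel_measurable_vert_exit assms) auto

lemma borel_measurable_lpp_bd [measurable (raw)]:
  assumes [measurable]: "\<And>v. W v \<in> borel_measurable N" "\<And>v. I v \<in> borel_measurable N"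
    "\<And>v. J v \<in> borel_measurable N"
  shows "(\<lambda>p. lpp_bd (\<lambda>v. W v p) (\<lambda>v. I v p) (\<lambda>v. J v p) x y) \<in> borel_measurable N"
  unfolding lpp_bd_def H_max_def[symmetric] V_max_def[symmetric] by measurable

lemma pred_consistent [measurable (raw)]:
  assumes [measurable]: "\<And>v. W v \<in> borel_measurable N" "\<And>v. I v \<in> borel_measurable N"
    "\<And>v. J v \<in> borel_measurable N"
  shows "Measurable.pred N (\<lambda>p. consistent_weights (\<lambda>v. W v p) (\<lambda>v. I v p) (\<lambda>v. J v p))"
  unfolding consistent_weights_def by measurable

lemma exit_set_subset: "exit_set w I J x y \<subseteq> {- (snd y - snd x)..fst y - fst x}" if "x \<le> y"
  using that by (cases x; cases y) (auto simp: exit_set_def)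

lemma pred_mem_exit_set:
  assumes [measurable]: "\<And>v. W v \<in> borel_measurable N" "\<And>v. I v \<in> borel_measurable N"
    "\<And>v. J v \<in> borel_measurable N"
  shows "Measurable.pred N (\<lambda>p. k \<in> exit_set (\<lambda>v. W v p) (\<lambda>v. I v p) (\<lambda>v. J v p) x y)"
proof -
  have [measurable]: "(\<lambda>p. horiz_exit (\<lambda>v. W v p) (\<lambda>v. I v p) x y k) \<in> borel_measurable N"
    "(\<lambda>p. vert_exit (\<lambda>v. W v p) (\<lambda>v. J v p) x y k) \<in> borel_measurable N" for k
    by (auto intro: borel_measurable_horiz_exit borel_measurable_vert_exit assms)
  have "(k \<in> exit_set w I J x y) \<longleftrightarrow>
     (1 \<le> k \<and> k \<le> fst y - fst x \<and> horiz_exit w I x y k = lpp_bd w I J x y) \<or>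
     (1 \<le> - k \<and> - k \<le> snd y - snd x \<and> vert_exit w J x y (- k) = lpp_bd w I J x y)" for w I J
    by (auto simp: exit_set_def)
  then show ?thesis by simp measurable
qed

text \<open>For fixed endpoints the exit set takes finitely many values, so every predicate
  \<open>Q\<close> of it is measurable, including those that use \<open>Max\<close> and
  \<open>Min\<close>.\<close>

lemma pred_exit_set:
  assumes "\<And>v. W v \<in> borel_measurable N" "\<And>v. I v \<in> borel_measurable N"
    "\<And>v. J v \<in> borel_measurable N" "x \<le> y"
  shows "Measurable.pred N (\<lambda>p. Q (exit_set (\<lambda>v. W v p) (\<lambda>v. I v p) (\<lambda>v. J v p) x y))"
proof -
  define F where "F = {- (snd y - snd x)..fst y - fst x}"
  have fin: "finite F" "finite (Pow F)" by (auto simp: F_def)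
  have [measurable]: "Measurable.pred N (\<lambda>p. k \<in> exit_set (\<lambda>v. W v p) (\<lambda>v. I v p) (\<lambda>v. J v p) x y)" for k
    by (rule pred_mem_exit_set) (use assms in auto)
  have *: "Q S \<longleftrightarrow> (\<exists>T\<in>Pow F. Q T \<and> (\<forall>k\<in>F. k \<in> T \<longleftrightarrow> k \<in> S))" if "S \<subseteq> F" for S
  proof
    assume "\<exists>T\<in>Pow F. Q T \<and> (\<forall>k\<in>F. k \<in> T \<longleftrightarrow> k \<in> S)"
    then obtain T where T: "T \<subseteq> F" "Q T" "\<forall>k\<in>F. k \<in> T \<longleftrightarrow> k \<in> S" by auto
    then have "T = S" using that by blast
    then show "Q S" using T by simp
  qed (use that in auto)
  have "Measurable.pred N (\<lambda>p. \<exists>T\<in>Pow F. Q T \<and> (\<forall>k\<in>F. k \<in> T \<longleftrightarrow>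
      k \<in> exit_set (\<lambda>v. W v p) (\<lambda>v. I v p) (\<lambda>v. J v p) x y))"
    using fin by measurable
  moreover have "(\<lambda>p. Q (exit_set (\<lambda>v. W v p) (\<lambda>v. I v p) (\<lambda>v. J v p) x y)) = (\<lambda>p. \<exists>T\<in>Pow F. Q T \<and>
      (\<forall>k\<in>F. k \<in> T \<longleftrightarrow> k \<in> exit_set (\<lambda>v. W v p) (\<lambda>v. I v p) (\<lambda>v. J v p) x y))"
    by (intro ext *) (use exit_set_subset[OF assms(4)] in \<open>auto simp: F_def\<close>)
  ultimately show ?thesis by (simp only:)
qed

section \<open>Boundary fields with the same law\<close>

lemma measurable_boundary_field:
  assumes "\<And>x. \<omega> x \<in> borel_measurable M"
    "\<And>\<xi> x. \<xi> \<in> ri_U \<Longrightarrow> I \<xi> x \<in> borel_measurable M"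
    "\<And>\<xi> x. \<xi> \<in> ri_U \<Longrightarrow> J \<xi> x \<in> borel_measurable M"
  shows "boundary_field UNIV \<omega> I J \<in> measurable M (field_space UNIV)"
  unfolding boundary_field_def field_space_def
  by (rule measurable_restrict) (auto simp: split_beta intro!: borel_measurable_Pair assms)

lemma field_component_measurable:
  assumes "\<xi> \<in> ri_U"
  shows "(\<lambda>f. fst (f (x, \<xi>))) \<in> borel_measurable (field_space UNIV)"
    "(\<lambda>f. fst (snd (f (x, \<xi>)))) \<in> borel_measurable (field_space UNIV)"
    "(\<lambda>f. snd (snd (f (x, \<xi>)))) \<in> borel_measurable (field_space UNIV)"
proof -
  have [measurable]: "(\<lambda>f. f (x, \<xi>)) \<in> borel_measurable (field_space UNIV)"
    unfolding field_space_def by (rule measurable_component_singleton) (use assms in auto)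
  have [measurable]: "(fst :: real \<times> real \<times> real \<Rightarrow> real) \<in> borel_measurable borel"
    "(\<lambda>z :: real \<times> real \<times> real. fst (snd z)) \<in> borel_measurable borel"
    "(\<lambda>z :: real \<times> real \<times> real. snd (snd z)) \<in> borel_measurable borel"
    by (auto intro!: borel_measurable_continuous_onI continuous_intros)
  show "(\<lambda>f. fst (f (x, \<xi>))) \<in> borel_measurable (field_space UNIV)"
    "(\<lambda>f. fst (snd (f (x, \<xi>)))) \<in> borel_measurable (field_space UNIV)"
    "(\<lambda>f. snd (snd (f (x, \<xi>)))) \<in> borel_measurable (field_space UNIV)"
    by measurable
qed

text \<open>In the applications one field is a translate or the reflection of the other.\<close>

locale field_pair = prob_space M for M :: "'a measure" +
  fixes \<omega> \<omega>' :: "site \<Rightarrow> 'a \<Rightarrow> real" and I J I' J' :: "'a field"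
  assumes w_meas: "\<And>x. \<omega> x \<in> borel_measurable M" "\<And>x. \<omega>' x \<in> borel_measurable M"
    and I_meas: "\<And>\<xi> x. \<xi> \<in> ri_U \<Longrightarrow> I \<xi> x \<in> borel_measurable M"
      "\<And>\<xi> x. \<xi> \<in> ri_U \<Longrightarrow> I' \<xi> x \<in> borel_measurable M"
    and J_meas: "\<And>\<xi> x. \<xi> \<in> ri_U \<Longrightarrow> J \<xi> x \<in> borel_measurable M"
      "\<And>\<xi> x. \<xi> \<in> ri_U \<Longrightarrow> J' \<xi> x \<in> borel_measurable M"
    and law: "boundary_law M \<omega> I J = boundary_law M \<omega>' I' J'"
begin

lemma measurable_field:
  "boundary_field UNIV \<omega> I J \<in> measurable M (field_space UNIV)"
  "boundary_field UNIV \<omega>' I' J' \<in> measurable M (field_space UNIV)"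
  by (intro measurable_boundary_field w_meas I_meas J_meas; assumption)+

text \<open>The product \<sigma>-algebra over the uncountable set \<open>ri_U\<close> only sees
  countably many directions, hence events are formed along a sequence \<open>\<Xi>\<close>. The
  weight \<open>\<omega>\<close> occurs in every coordinate triple and is read off at
  \<open>\<Xi> 0\<close>.\<close>

lemma prob_eq:
  fixes \<Xi> :: "nat \<Rightarrow> real \<times> real"
  assumes \<Xi>: "\<And>m. \<Xi> m \<in> ri_U"
    and P: "Measurable.pred (field_space UNIV) (\<lambda>f. P (\<lambda>x. fst (f (x, \<Xi> 0)))
      (\<lambda>m x. fst (snd (f (x, \<Xi> m)))) (\<lambda>m x. snd (snd (f (x, \<Xi> m)))))"
  shows "prob {p \<in> space M. P (\<lambda>x. \<omega> x p) (\<lambda>m x. I (\<Xi> m) x p) (\<lambda>m x. J (\<Xi> m) x p)} =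
         prob {p \<in> space M. P (\<lambda>x. \<omega>' x p) (\<lambda>m x. I' (\<Xi> m) x p) (\<lambda>m x. J' (\<Xi> m) x p)}"
    and "{p \<in> space M. P (\<lambda>x. \<omega> x p) (\<lambda>m x. I (\<Xi> m) x p) (\<lambda>m x. J (\<Xi> m) x p)} \<in> events"
    and "{p \<in> space M. P (\<lambda>x. \<omega>' x p) (\<lambda>m x. I' (\<Xi> m) x p) (\<lambda>m x. J' (\<Xi> m) x p)} \<in> events"
proof -
  define S where "S = {f \<in> space (field_space UNIV). P (\<lambda>x. fst (f (x, \<Xi> 0)))
      (\<lambda>m x. fst (snd (f (x, \<Xi> m)))) (\<lambda>m x. snd (snd (f (x, \<Xi> m))))}"
  have S: "S \<in> sets (field_space UNIV)" unfolding S_def using P by measurable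
  have *: "{p \<in> space M. P (\<lambda>x. w x p) (\<lambda>m x. A (\<Xi> m) x p) (\<lambda>m x. B (\<Xi> m) x p)} =
      boundary_field UNIV w A B -` S \<inter> space M"
    if "boundary_field UNIV w A B \<in> measurable M (field_space UNIV)" for w A B
    using measurable_space[OF that] \<Xi> by (auto simp: S_def boundary_field_def)
  have **: "measure M (boundary_field UNIV w A B -` S \<inter> space M) = measure (boundary_law M w A B) S"
    if "boundary_field UNIV w A B \<in> measurable M (field_space UNIV)" for w A B
    using that S by (simp add: boundary_law_def measure_distr)
  note m1 = measurable_field(1) and m2 = measurable_field(2)
  show "prob {p \<in> space M. P (\<lambda>x. \<omega> x p) (\<lambda>m x. I (\<Xi> m) x p) (\<lambda>m x. J (\<Xi> m) x p)} =
         prob {p \<in> space M. P (\<lambda>x. \<omega>' x p) (\<lambda>m x. I' (\<Xi> m) x p) (\<lambda>m x. J' (\<Xi> m) x p)}"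
    by (simp only: *[OF m1] *[OF m2] **[OF m1] **[OF m2] law)
  show "{p \<in> space M. P (\<lambda>x. \<omega> x p) (\<lambda>m x. I (\<Xi> m) x p) (\<lambda>m x. J (\<Xi> m) x p)} \<in> events"
    unfolding *[OF m1] by (rule measurable_sets[OF m1 S])
  show "{p \<in> space M. P (\<lambda>x. \<omega>' x p) (\<lambda>m x. I' (\<Xi> m) x p) (\<lambda>m x. J' (\<Xi> m) x p)} \<in> events"
    unfolding *[OF m2] by (rule measurable_sets[OF m2 S])
qed

lemma AE_transfer:
  fixes \<Xi> :: "nat \<Rightarrow> real \<times> real"
  assumes \<Xi>: "\<And>m. \<Xi> m \<in> ri_U"
    and P: "Measurable.pred (field_space UNIV) (\<lambda>f. P (\<lambda>x. fst (f (x, \<Xi> 0)))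
      (\<lambda>m x. fst (snd (f (x, \<Xi> m)))) (\<lambda>m x. snd (snd (f (x, \<Xi> m)))))"
    and "AE p in M. P (\<lambda>x. \<omega> x p) (\<lambda>m x. I (\<Xi> m) x p) (\<lambda>m x. J (\<Xi> m) x p)"
  shows "AE p in M. P (\<lambda>x. \<omega>' x p) (\<lambda>m x. I' (\<Xi> m) x p) (\<lambda>m x. J' (\<Xi> m) x p)"
  using prob_Collect_eq_1[OF prob_eq(2)[OF \<Xi> P]] prob_Collect_eq_1[OF prob_eq(3)[OF \<Xi> P]]
    prob_eq(1)[OF \<Xi> P] assms(3) by simp

lemma component_distr_eq:
  assumes "\<xi> \<in> ri_U"
  shows "distr M borel (\<omega> x) = distr M borel (\<omega>' x)"
    "distr M borel (I \<xi> x) = distr M borel (I' \<xi> x)"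
    "distr M borel (J \<xi> x) = distr M borel (J' \<xi> x)"
proof -
  have *: "distr M borel (w x) = distr (boundary_law M w A B) borel (\<lambda>f. fst (f (x, \<xi>)))"
    "distr M borel (A \<xi> x) = distr (boundary_law M w A B) borel (\<lambda>f. fst (snd (f (x, \<xi>))))"
    "distr M borel (B \<xi> x) = distr (boundary_law M w A B) borel (\<lambda>f. snd (snd (f (x, \<xi>))))"
    if "boundary_field UNIV w A B \<in> measurable M (field_space UNIV)" for w A B
    using assms unfolding boundary_law_def
    by (simp_all add: distr_distr[OF _ that] field_component_measurable comp_def boundary_field_def)
  note m1 = measurable_field(1) and m2 = measurable_field(2)
  show "distr M borel (\<omega> x) = distr M borel (\<omega>' x)"
    by (rule box_equals[OF _ *(1)[OF m1, symmetric] *(1)[OF m2, symmetric]]) (simp only: law)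
  show "distr M borel (I \<xi> x) = distr M borel (I' \<xi> x)"
    by (rule box_equals[OF _ *(2)[OF m1, symmetric] *(2)[OF m2, symmetric]]) (simp only: law)
  show "distr M borel (J \<xi> x) = distr M borel (J' \<xi> x)"
    by (rule box_equals[OF _ *(3)[OF m1, symmetric] *(3)[OF m2, symmetric]]) (simp only: law)
qed

text \<open>A shift of sites is a measurable map \<open>T\<close> of the field space, so both
  shifted laws are images of the same measure.\<close>

lemma translate:
  "boundary_law M (\<lambda>x. \<omega> (x + z)) (\<lambda>\<xi> x. I \<xi> (x + z)) (\<lambda>\<xi> x. J \<xi> (x + z)) =
   boundary_law M (\<lambda>x. \<omega>' (x + z)) (\<lambda>\<xi> x. I' \<xi> (x + z)) (\<lambda>\<xi> x. J' \<xi> (x + z))"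
proof -
  define T :: "(site \<times> (real \<times> real) \<Rightarrow> real \<times> real \<times> real) \<Rightarrow> _"
    where "T f = (\<lambda>i\<in>UNIV \<times> ri_U. f (fst i + z, snd i))" for f
  have T: "T \<in> measurable (field_space UNIV) (field_space UNIV)"
    unfolding T_def[abs_def] field_space_def
    by (rule measurable_restrict) (auto intro!: measurable_component_singleton)
  have *: "boundary_law M (\<lambda>x. w (x + z)) (\<lambda>\<xi> x. A \<xi> (x + z)) (\<lambda>\<xi> x. B \<xi> (x + z)) =
      distr (boundary_law M w A B) (field_space UNIV) T"
    if "boundary_field UNIV w A B \<in> measurable M (field_space UNIV)" for w A B
    unfolding boundary_law_def distr_distr[OF T that]
    by (rule distr_cong) (auto simp: T_def boundary_field_def comp_def fun_eq_iff)
  note m1 = measurable_field(1) and m2 = measurable_field(2)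
  show ?thesis
    by (rule box_equals[OF _ *[OF m1, symmetric] *[OF m2, symmetric]]) (simp only: law)
qed

end

section \<open>Tail bounds for exits through the unexpected axis\<close>

definition direction :: "real \<Rightarrow> real \<times> real" where
  "direction t = (t, 1 - t)"

text \<open>The offset \<open>2\<close> keeps both sequences strictly inside \<open>ri_U\<close>
  from \<open>m = 0\<close> on.\<close>

abbreviation "e1_dir (m::nat) \<equiv> direction (1 - 1 / (real m + 2))"
abbreviation "e2_dir (m::nat) \<equiv> direction (1 / (real m + 2))"

lemma direction_in_ri_U [simp]: "direction t \<in> ri_U \<longleftrightarrow> 0 < t \<and> t < 1"
  by (auto simp: ri_U_def direction_def)

lemma fst_direction [simp]: "fst (direction t) = t"
  by (simp add: direction_def)

lemma int_sum_split:
  assumes "0 \<le> q" "0 \<le> (l :: int)"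
  shows "(\<Sum>j=1..q + l. f j) = (\<Sum>j=1..q. f j) + (\<Sum>j=1..l. (f (q + j) :: real))"
proof -
  have "{1..q + l} = {1..q} \<union> {q + 1..q + l}" using assms by auto
  moreover have "(\<Sum>j=q + 1..q + l. f j) = (\<Sum>j=1..l. f (q + j))"
    by (rule sum.reindex_bij_witness[of _ "\<lambda>j. q + j" "\<lambda>j. j - q"]) auto
  ultimately show ?thesis by (simp add: sum.union_disjoint)
qed

text \<open>
  By additivity of the stationary passage times, moving the starting point back by \<open>q\<close> along an axis
  moves every exit on that axis by \<open>q\<close>.  With \<open>q\<close> chosen such that the shifted rectangle is
  characteristic, an exit through the unexpected axis becomes a large exit point.
\<close>

lemma V_exit_shift:
  assumes cons: "consistent_weights w I J" and "a < c" "b < d" "0 \<le> q"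
    and V: "H_max w I (a, b) (c, d) \<le> V_max w J (a, b) (c, d)"
  shows "\<exists>k\<in>exit_set w I J (a, b - q) (c, d). k \<le> - (q + 1)"
proof -
  obtain l where l: "1 \<le> l" "l \<le> d - b" "V_max w J (a, b) (c, d) = vert_exit w J (a, b) (c, d) l"
    using V_max_attained assms by blast
  have "lpp_bd w I J (a, b - q) (c, d) = (\<Sum>j=1..q. J (a, b - q + j)) + vert_exit w J (a, b) (c, d) l"
    using consistent_add[OF cons, of "(a, b - q)" "(a, b)" "(c, d)"] assms l(3)
    by (simp add: lpp_bd_column lpp_bd_interior)
  also have "\<dots> = vert_exit w J (a, b - q) (c, d) (q + l)"
    using l assms by (simp add: vert_exit_def int_sum_split)
  finally have "- (q + l) \<in> exit_set w I J (a, b - q) (c, d)"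
    using l assms by (auto simp: exit_set_def intro!: exI[of _ "q + l"])
  then show ?thesis using l by (intro bexI[of _ "- (q + l)"]) auto
qed

lemma H_exit_shift:
  assumes cons: "consistent_weights w I J" and "a < c" "b < d" "0 \<le> q"
    and H: "V_max w J (a, b) (c, d) \<le> H_max w I (a, b) (c, d)"
  shows "\<exists>k\<in>exit_set w I J (a - q, b) (c, d). q + 1 \<le> k"
proof -
  obtain l where l: "1 \<le> l" "l \<le> c - a" "H_max w I (a, b) (c, d) = horiz_exit w I (a, b) (c, d) l"
    using H_max_attained assms by blast
  have "lpp_bd w I J (a - q, b) (c, d) = (\<Sum>j=1..q. I (a - q + j, b)) + horiz_exit w I (a, b) (c, d) l"
    using consistent_add[OF cons, of "(a - q, b)" "(a, b)" "(c, d)"] assms l(3)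
    by (simp add: lpp_bd_row lpp_bd_interior)
  also have "\<dots> = horiz_exit w I (a - q, b) (c, d) (q + l)"
    using l assms by (simp add: horiz_exit_def int_sum_split)
  finally have "q + l \<in> exit_set w I J (a - q, b) (c, d)"
    using l assms by (auto simp: exit_set_def)
  then show ?thesis using l by (intro bexI[of _ "q + l"]) auto
qed

lemma lpp_bd_translate:
  "horiz_exit (\<lambda>v. w (v + z)) (\<lambda>v. I (v + z)) x y k = horiz_exit w I (x + z) (y + z) k"
  "vert_exit (\<lambda>v. w (v + z)) (\<lambda>v. J (v + z)) x y k = vert_exit w J (x + z) (y + z) k"
  "lpp_bd (\<lambda>v. w (v + z)) (\<lambda>v. I (v + z)) (\<lambda>v. J (v + z)) x y = lpp_bd w I J (x + z) (y + z)"
proof -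
  show 1: "horiz_exit (\<lambda>v. w (v + z)) (\<lambda>v. I (v + z)) x y k = horiz_exit w I (x + z) (y + z) k" for k
    using lpp_translate[of w z "x + (k, 1)" y] by (simp add: horiz_exit_def ac_simps)
  show 2: "vert_exit (\<lambda>v. w (v + z)) (\<lambda>v. J (v + z)) x y k = vert_exit w J (x + z) (y + z) k" for k
    using lpp_translate[of w z "x + (1, k)" y] by (simp add: vert_exit_def ac_simps)
  show "lpp_bd (\<lambda>v. w (v + z)) (\<lambda>v. I (v + z)) (\<lambda>v. J (v + z)) x y = lpp_bd w I J (x + z) (y + z)"
    unfolding lpp_bd_def 1[abs_def] 2[abs_def] by (simp add: ac_simps)
qed

lemma exit_set_translate:
  "exit_set (\<lambda>v. w (v + z)) (\<lambda>v. I (v + z)) (\<lambda>v. J (v + z)) x y = exit_set w I J (x + z) (y + z)"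
  by (simp add: exit_set_def lpp_bd_translate)

text \<open>The total length after the shift is the integer part of \<open>m / t\<close>, so the new
  direction equals \<open>t\<close> up to rounding. The excess \<open>\<rho>\<close> of the original
  direction over \<open>t\<close> makes \<open>q + 1\<close> exceed \<open>\<rho> * (m + n)\<close>;
  dividing by the new length to the power \<open>2 / 3\<close> leaves
  \<open>\<rho> * (m + n) powr (1 / 3)\<close>, up to a power of \<open>\<delta>\<close>.\<close>

lemma characteristic_shift:
  fixes m n :: int and t \<rho> \<delta> N\<^sub>0 s\<^sub>0 :: real
  assumes \<delta>: "0 < \<delta>" "\<delta> < t" "t < 1 - \<delta>" and mn: "1 \<le> m" "1 \<le> n" and \<rho>: "0 < \<rho>"
    and dir: "(t + \<rho>) * (m + n) \<le> m"
    and T: "2 * N\<^sub>0 / \<delta> \<le> m + n" "2 / \<delta> \<le> m + n"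
  defines "q \<equiv> \<lfloor>m / t\<rfloor> - (m + n)"
  shows "0 \<le> q" "(of_int m, of_int (n + q)) \<in> S_cone (\<delta> / 2)" "N\<^sub>0 \<le> m" "N\<^sub>0 \<le> n + q"
    "\<bar>t - real_of_int m / real_of_int (m + (n + q))\<bar> \<le> 1 * real_of_int (m + (n + q)) powr (- 1 / 3)"
    "\<delta> powr (2 / 3) * (\<rho> * real_of_int (m + n) powr (1 / 3))
      \<le> real_of_int (q + 1) / real_of_int (m + (n + q)) powr (2 / 3)"
proof -
  define T where "T = real_of_int (m + n)"
  define T' where "T' = real_of_int (m + (n + q))"
  have T'f: "T' = \<lfloor>m / t\<rfloor>" by (simp add: T'_def q_def)
  have t: "0 < t" "t < 1" using \<delta> by auto
  have Tpos: "2 \<le> T" using mn by (simp add: T_def)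
  have T'1: "T' \<le> m / t" "m / t - 1 < T'" unfolding T'f by linarith+
  have qT: "q = T' - T" by (simp add: T'_def T_def)
  have "T + \<rho> * T / t \<le> m / t"
  proof -
    have "t * T + \<rho> * T \<le> m" using dir by (simp add: T_def algebra_simps)
    from divide_right_mono[OF this, of t] show ?thesis using t by (simp add: add_divide_distrib)
  qed
  moreover have "\<rho> * T \<le> \<rho> * T / t"
    using t \<rho> Tpos by (simp add: field_simps mult_left_le)
  ultimately have q1: "\<rho> * T < q + 1" using T'1 qT by linarith
  moreover have "0 < \<rho> * T" using \<rho> Tpos by simp
  ultimately show q0: "0 \<le> q" by linarith
  have TT': "T \<le> T'" using q0 qT by simp
  have tT': "t * T' \<le> m" "m < t * T' + t" using T'1 t by (auto simp: field_simps)
  have m\<delta>: "\<delta> * T' \<le> m" using tT'(1) \<delta> TT' Tpos mult_right_mono[of \<delta> t T'] by linarith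
  have nq: "real_of_int (n + q) = T' - m" by (simp add: T'_def)
  \<comment> \<open>Rounding costs less than \<open>1\<close>. The assumption
    \<open>2 / \<delta> \<le> m + n\<close> pays for it with half of \<open>\<delta>\<close>, hence
    the cone parameter \<open>\<delta> / 2\<close>.\<close>
  have n\<delta>: "\<delta> / 2 * T' \<le> T' - m"
  proof -
    have "\<delta> * T' \<le> (1 - t) * T'" using \<delta> TT' Tpos by (intro mult_right_mono) auto
    moreover have "1 \<le> \<delta> / 2 * T'"
    proof -
      have "1 \<le> \<delta> / 2 * T" using T(2) \<delta> by (simp add: T_def field_simps)
      also have "\<dots> \<le> \<delta> / 2 * T'" using TT' \<delta> by (intro mult_left_mono) auto
      finally show ?thesis .
    qed
    ultimately show ?thesis using tT' t by (simp add: algebra_simps)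
  qed
  have N: "N\<^sub>0 \<le> \<delta> / 2 * T'"
  proof -
    have "N\<^sub>0 \<le> \<delta> / 2 * T" using T(1) \<delta> by (simp add: T_def field_simps)
    also have "\<dots> \<le> \<delta> / 2 * T'" using TT' \<delta> by (intro mult_left_mono) auto
    finally show ?thesis .
  qed
  have \<delta>T': "0 < \<delta> * T'" using \<delta> TT' Tpos by simp
  show "N\<^sub>0 \<le> m" using N m\<delta> \<delta>T' by linarith
  show "N\<^sub>0 \<le> n + q" unfolding nq using N n\<delta> by linarith
  have "\<delta> / 2 * m \<le> \<delta> / 2 * T'" "\<delta> / 2 * (T' - m) \<le> \<delta> / 2 * T'"
    using n\<delta> \<delta>T' \<delta> mn by (intro mult_left_mono; linarith)+
  then show "(of_int m, of_int (n + q)) \<in> S_cone (\<delta> / 2)"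
    unfolding S_cone_def nq using n\<delta> m\<delta> \<delta>T' mn by auto
  have T'1': "1 \<le> T'" using TT' Tpos by simp
  have "\<bar>t - m / T'\<bar> \<le> 1 / T'"
  proof -
    have "\<bar>t - m / T'\<bar> = \<bar>m - t * T'\<bar> / T'" using T'1' by (simp add: field_simps abs_minus_commute)
    also have "\<dots> \<le> 1 / T'" using tT' t T'1' by (intro divide_right_mono) auto
    finally show ?thesis .
  qed
  also have "\<dots> = T' powr (- 1)" using T'1' by (simp add: powr_minus_divide)
  also have "\<dots> \<le> T' powr (- 1 / 3)" using T'1' by (intro powr_mono) auto
  finally show "\<bar>t - real_of_int m / real_of_int (m + (n + q))\<bar> \<le> 1 * real_of_int (m + (n + q)) powr (- 1 / 3)"
    by (simp add: T'_def)
  \<comment> \<open>The shift lengthens the rectangle at most by the factor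
    \<open>1 / \<delta>\<close>, because \<open>\<delta> * T' \<le> m \<le> T\<close>.\<close>
  have "T' \<le> T / \<delta>"
  proof -
    have "\<delta> * T' \<le> T" using m\<delta> mn by (simp add: T_def)
    then show ?thesis using \<delta> by (simp add: field_simps)
  qed
  then have "T' powr (2 / 3) \<le> (T / \<delta>) powr (2 / 3)" using T'1' by (intro powr_mono2) auto
  also have "\<dots> = T powr (2 / 3) / \<delta> powr (2 / 3)" using Tpos \<delta> by (simp add: powr_divide)
  finally have pw: "\<delta> powr (2 / 3) * T' powr (2 / 3) \<le> T powr (2 / 3)"
    using \<delta> by (simp add: field_simps)
  have "\<delta> powr (2 / 3) * (\<rho> * T powr (1 / 3)) * T' powr (2 / 3)
      = \<rho> * T powr (1 / 3) * (\<delta> powr (2 / 3) * T' powr (2 / 3))" by simp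
  also have "\<dots> \<le> \<rho> * T powr (1 / 3) * T powr (2 / 3)"
    using \<rho> by (intro mult_left_mono pw) auto
  also have "\<dots> = \<rho> * T" using Tpos by (simp add: powr_add[symmetric])
  also have "\<dots> \<le> q + 1" using q1 by simp
  finally show "\<delta> powr (2 / 3) * (\<rho> * real_of_int (m + n) powr (1 / 3))
      \<le> real_of_int (q + 1) / real_of_int (m + (n + q)) powr (2 / 3)"
    using T'1' by (simp add: T_def T'_def field_simps)
qed

text \<open>The first hypothesis is split into layers so that its probability, the only part that
  involves the weights, can be replaced by an equal one for another field of the same law.\<close>

definition far_exit_prob ::
  "'a measure \<Rightarrow> (site \<Rightarrow> 'a \<Rightarrow> real) \<Rightarrow> 'a field \<Rightarrow> 'a field \<Rightarrow> real \<times> real \<Rightarrow> int \<Rightarrow> int \<Rightarrow> real \<Rightarrow> real"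
  where "far_exit_prob M \<omega> I J \<xi> m n r = measure M {p \<in> space M.
    of_int (max
      \<bar>exit_e1 (\<lambda>v. \<omega> v p) (\<lambda>v. I \<xi> v p) (\<lambda>v. J \<xi> v p) (0, 0) (m, n)\<bar>
      \<bar>exit_e2 (\<lambda>v. \<omega> v p) (\<lambda>v. I \<xi> v p) (\<lambda>v. J \<xi> v p) (0, 0) (m, n)\<bar>) \<ge> r}"

definition exit_tail_at ::
  "'a measure \<Rightarrow> (site \<Rightarrow> 'a \<Rightarrow> real) \<Rightarrow> 'a field \<Rightarrow> 'a field \<Rightarrow> real \<Rightarrow> real \<Rightarrow> real \<Rightarrow> real \<Rightarrow> real \<Rightarrow> real \<Rightarrow> bool"
  where "exit_tail_at M \<omega> I J \<nu> \<delta> C\<^sub>0 \<kappa> N\<^sub>0 s\<^sub>0 \<longleftrightarrow>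
    (\<forall>(m::int) (n::int) (s::real) \<xi>.
      (real_of_int m, real_of_int n) \<in> S_cone \<delta> \<longrightarrow>
      real_of_int m \<ge> N\<^sub>0 \<longrightarrow> real_of_int n \<ge> N\<^sub>0 \<longrightarrow> s \<ge> s\<^sub>0 \<longrightarrow>
      \<xi> \<in> ri_U \<longrightarrow> fst \<xi> \<in> {\<delta><..<1 - \<delta>} \<longrightarrow>
      \<bar>fst \<xi> - of_int m / of_int (m + n)\<bar> \<le> \<kappa> * of_int (m + n) powr (- 1 / 3) \<longrightarrow>
      far_exit_prob M \<omega> I J \<xi> m n (s * of_int (m + n) powr (2 / 3)) \<le> C\<^sub>0 * s powr (- \<nu>))"

definition exit_tail :: "'a measure \<Rightarrow> (site \<Rightarrow> 'a \<Rightarrow> real) \<Rightarrow> 'a field \<Rightarrow> 'a field \<Rightarrow> real \<Rightarrow> bool" where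
  "exit_tail M \<omega> I J \<nu> \<longleftrightarrow> (\<exists>\<delta>\<^sub>0\<in>{0<..<1}. \<forall>\<delta>\<in>{0<..<\<delta>\<^sub>0}. \<exists>C\<^sub>0>0. \<forall>\<kappa>\<ge>0. \<exists>N\<^sub>0>0. \<exists>s\<^sub>0>0.
    exit_tail_at M \<omega> I J \<nu> \<delta> C\<^sub>0 \<kappa> N\<^sub>0 s\<^sub>0)"

text \<open>Beyond measurability, each assumption is determined by the joint law, so the reflected
  weights satisfy it too. Consistency and monotonicity are therefore stated for fixed directions,
  and limits of expectations at the axes stand in for the gradient of the limit shape.\<close>

locale boundary_env = prob_space M for M :: "'a measure" +
  fixes \<omega> :: "site \<Rightarrow> 'a \<Rightarrow> real" and I J :: "'a field" and \<nu> :: real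
  assumes w_meas [measurable]: "\<And>x. \<omega> x \<in> borel_measurable M"
    and I_meas: "\<And>\<xi> x. \<xi> \<in> ri_U \<Longrightarrow> I \<xi> x \<in> borel_measurable M"
    and J_meas: "\<And>\<xi> x. \<xi> \<in> ri_U \<Longrightarrow> J \<xi> x \<in> borel_measurable M"
    and consistent: "\<And>\<xi>. \<xi> \<in> ri_U \<Longrightarrow>
      AE p in M. consistent_weights (\<lambda>v. \<omega> v p) (\<lambda>v. I \<xi> v p) (\<lambda>v. J \<xi> v p)"
    and monotone: "\<And>\<xi> \<zeta>. \<xi> \<in> ri_U \<Longrightarrow> \<zeta> \<in> ri_U \<Longrightarrow> fst \<xi> \<le> fst \<zeta> \<Longrightarrow>
      AE p in M. \<forall>x. I \<zeta> x p \<le> I \<xi> x p \<and> J \<xi> x p \<le> J \<zeta> x p"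
    and translation: "\<And>z. boundary_law M (\<lambda>x. \<omega> (x + z)) (\<lambda>\<xi> x. I \<xi> (x + z)) (\<lambda>\<xi> x. J \<xi> (x + z)) =
      boundary_law M \<omega> I J"
    and tail: "exit_tail M \<omega> I J \<nu>" and nu_pos: "0 < \<nu>"
    and I_integrable: "\<And>\<xi> x. \<xi> \<in> ri_U \<Longrightarrow> integrable M (I \<xi> x)"
    and J_integrable: "\<And>\<xi> x. \<xi> \<in> ri_U \<Longrightarrow> integrable M (J \<xi> x)"
    and w_integrable: "\<And>x. integrable M (\<omega> x)"
    and I_expectation: "\<And>x. (\<lambda>m. expectation (I (direction (1 - 1 / (real m + 2))) x))
      \<longlonglongrightarrow> expectation (\<omega> x)"
    and J_expectation: "\<And>x. (\<lambda>m. expectation (J (direction (1 / (real m + 2))) x))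
      \<longlonglongrightarrow> expectation (\<omega> x)"
begin

abbreviation "G p \<equiv> lpp (\<lambda>v. \<omega> v p)"
abbreviation "H_at t p \<equiv> H_max (\<lambda>v. \<omega> v p) (\<lambda>v. I (direction t) v p)"
abbreviation "V_at t p \<equiv> V_max (\<lambda>v. \<omega> v p) (\<lambda>v. J (direction t) v p)"
abbreviation "H_prob t x y \<equiv> prob {p \<in> space M. V_at t p x y \<le> H_at t p x y}"
abbreviation "V_prob t x y \<equiv> prob {p \<in> space M. H_at t p x y \<le> V_at t p x y}"
abbreviation "consistent_at t p \<equiv>
  consistent_weights (\<lambda>v. \<omega> v p) (\<lambda>v. I (direction t) v p) (\<lambda>v. J (direction t) v p)"

lemma I_dir_meas [measurable]: "0 < t \<Longrightarrow> t < 1 \<Longrightarrow> I (direction t) x \<in> borel_measurable M"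
  and J_dir_meas [measurable]: "0 < t \<Longrightarrow> t < 1 \<Longrightarrow> J (direction t) x \<in> borel_measurable M"
  using I_meas J_meas by simp_all

lemma field_pair_translate:
  "field_pair M (\<lambda>x. \<omega> (x + z)) \<omega> (\<lambda>\<xi> x. I \<xi> (x + z)) (\<lambda>\<xi> x. J \<xi> (x + z)) I J"
  by unfold_locales (rule w_meas translation | erule I_meas J_meas)+

lemma exit_set_prob:
  assumes \<xi>: "\<xi> \<in> ri_U" and "(0, 0) \<le> u"
  shows "prob {p \<in> space M. Q (exit_set (\<lambda>v. \<omega> v p) (\<lambda>v. I \<xi> v p) (\<lambda>v. J \<xi> v p) x (x + u))} =
    prob {p \<in> space M. Q (exit_set (\<lambda>v. \<omega> v p) (\<lambda>v. I \<xi> v p) (\<lambda>v. J \<xi> v p) (0, 0) u)}"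
    and "{p \<in> space M. Q (exit_set (\<lambda>v. \<omega> v p) (\<lambda>v. I \<xi> v p) (\<lambda>v. J \<xi> v p) x (x + u))} \<in> events"
proof -
  interpret fp: field_pair M "\<lambda>v. \<omega> (v + x)" \<omega> "\<lambda>\<xi> v. I \<xi> (v + x)" "\<lambda>\<xi> v. J \<xi> (v + x)" I J
    by (rule field_pair_translate)
  have P: "Measurable.pred (field_space UNIV) (\<lambda>f. Q (exit_set (\<lambda>v. fst (f (v, \<xi>)))
      (\<lambda>v. fst (snd (f (v, \<xi>)))) (\<lambda>v. snd (snd (f (v, \<xi>)))) (0, 0) u))"
    by (rule pred_exit_set) (use field_component_measurable[OF \<xi>] assms(2) in auto)
  show "prob {p \<in> space M. Q (exit_set (\<lambda>v. \<omega> v p) (\<lambda>v. I \<xi> v p) (\<lambda>v. J \<xi> v p) x (x + u))} =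
    prob {p \<in> space M. Q (exit_set (\<lambda>v. \<omega> v p) (\<lambda>v. I \<xi> v p) (\<lambda>v. J \<xi> v p) (0, 0) u)}"
    using fp.prob_eq(1)[of "\<lambda>_. \<xi>" "\<lambda>w I J. Q (exit_set w (I 0) (J 0) (0, 0) u)", OF \<xi> P]
    by (simp add: exit_set_translate[of "\<lambda>v. \<omega> v _" x "\<lambda>v. I \<xi> v _" "\<lambda>v. J \<xi> v _"] zero_prod_def[symmetric] add.commute)
  show "{p \<in> space M. Q (exit_set (\<lambda>v. \<omega> v p) (\<lambda>v. I \<xi> v p) (\<lambda>v. J \<xi> v p) x (x + u))} \<in> events"
    using fp.prob_eq(2)[of "\<lambda>_. \<xi>" "\<lambda>w I J. Q (exit_set w (I 0) (J 0) (0, 0) u)", OF \<xi> P]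
    by (simp add: exit_set_translate[of "\<lambda>v. \<omega> v _" x "\<lambda>v. I \<xi> v _" "\<lambda>v. J \<xi> v _"] zero_prod_def[symmetric] add.commute)
qed

text \<open>Here \<open>\<rho>\<close> is the distance of the direction of the rectangle from
  \<open>t\<close>, and \<open>\<rho> * (m + n) powr (1 / 3)\<close> measures it in units of the
  natural fluctuation. The first clause concerns rectangles flatter than \<open>t\<close>, where a
  vertical exit is unlikely, the second one steeper rectangles.\<close>

definition exit_bounds :: "real \<Rightarrow> real \<Rightarrow> real \<Rightarrow> bool" where
  "exit_bounds \<delta> C R \<longleftrightarrow> 0 < C \<and> 0 < R \<and> (\<forall>(t::real) x (m::int) (n::int) (\<rho>::real).
     \<delta> < t \<longrightarrow> t < 1 - \<delta> \<longrightarrow> 1 \<le> m \<longrightarrow> 1 \<le> n \<longrightarrow> 0 < \<rho> \<longrightarrow> R \<le> real_of_int (m + n) \<longrightarrow>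
     R \<le> \<rho> * (m + n) powr (1 / 3) \<longrightarrow>
     ((t + \<rho>) * (m + n) \<le> m \<longrightarrow>
        V_prob t x (x + (m, n))
        \<le> C * (\<rho> * (m + n) powr (1 / 3)) powr - \<nu>) \<and>
     (m \<le> (t - \<rho>) * (m + n) \<longrightarrow>
        H_prob t x (x + (m, n))
        \<le> C * (\<rho> * (m + n) powr (1 / 3)) powr - \<nu>))"

text \<open>An exit of modulus at least \<open>q + 1\<close> makes the maximum or the minimum of the
  exit set that large in modulus. The quotient in \<open>bound\<close> is the parameter
  \<open>s\<close> of the tail hypothesis.\<close>

lemma exit_tail_bound:
  fixes C\<^sub>0 s :: real and m n q :: int
  assumes \<xi>: "\<xi> \<in> ri_U" and "0 \<le> m" "0 \<le> n" "0 < m + n" "0 \<le> q"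
    and bound: "far_exit_prob M \<omega> I J \<xi> m n ((q + 1) / (m + n) powr (2 / 3) * (m + n) powr (2 / 3)) \<le> b"
    and Q: "Q = (\<lambda>S. \<exists>k\<in>S. k \<le> - (q + 1)) \<or> Q = (\<lambda>S. \<exists>k\<in>S. q + 1 \<le> k)"
  shows "prob {p \<in> space M. Q (exit_set (\<lambda>v. \<omega> v p) (\<lambda>v. I \<xi> v p) (\<lambda>v. J \<xi> v p) x (x + (m, n)))} \<le> b"
proof -
  let ?S = "\<lambda>p. exit_set (\<lambda>v. \<omega> v p) (\<lambda>v. I \<xi> v p) (\<lambda>v. J \<xi> v p) (0, 0) (m, n)"
  have "prob {p \<in> space M. Q (exit_set (\<lambda>v. \<omega> v p) (\<lambda>v. I \<xi> v p) (\<lambda>v. J \<xi> v p) x (x + (m, n)))} =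
      prob {p \<in> space M. Q (?S p)}"
    using assms by (intro exit_set_prob) auto
  also have "\<dots> \<le> prob {p \<in> space M. real_of_int (q + 1) \<le> real_of_int (max \<bar>Max (?S p)\<bar> \<bar>Min (?S p)\<bar>)}"
  proof (rule finite_measure_mono)
    have zero_add: "(0, 0) + (m, n) = (m, n)" by simp
    have fin: "finite (?S p)" for p
      by (rule finite_subset[OF exit_set_subset]) (use assms in auto)
    show "{p \<in> space M. Q (?S p)} \<subseteq>
        {p \<in> space M. real_of_int (q + 1) \<le> real_of_int (max \<bar>Max (?S p)\<bar> \<bar>Min (?S p)\<bar>)}"
    proof safe
      fix p assume "Q (?S p)"
      then consider k where "k \<in> ?S p" "k \<le> - (q + 1)" | k where "k \<in> ?S p" "q + 1 \<le> k"
        using Q by blast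
      then show "real_of_int (q + 1) \<le> real_of_int (max \<bar>Max (?S p)\<bar> \<bar>Min (?S p)\<bar>)"
      proof cases
        case 1
        then have "Min (?S p) \<le> - (q + 1)" using Min_le[OF fin 1(1)] by linarith
        then show ?thesis by linarith
      next
        case 2
        then have "q + 1 \<le> Max (?S p)" using Max_ge[OF fin 2(1)] by linarith
        then show ?thesis by linarith
      qed
    qed
    show "{p \<in> space M. real_of_int (q + 1) \<le> real_of_int (max \<bar>Max (?S p)\<bar> \<bar>Min (?S p)\<bar>)} \<in> events"
      by (rule exit_set_prob(2)[OF \<xi>, of "(m, n)" "\<lambda>S. real_of_int (q + 1) \<le> real_of_int (max \<bar>Max S\<bar> \<bar>Min S\<bar>)"
          "(0, 0)", unfolded zero_add]) (use assms(2,3) in auto)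
  qed
  also have "\<dots> \<le> b"
    using bound assms(4) by (simp add: far_exit_prob_def exit_e1_def exit_e2_def)
  finally show ?thesis .
qed

lemma exit_bounds_exist:
  "\<exists>\<delta>\<^sub>0\<in>{0<..<1}. \<forall>\<delta>\<in>{0<..<\<delta>\<^sub>0}. \<exists>C R. exit_bounds \<delta> C R"
proof -
  obtain \<delta>\<^sub>0 where \<delta>\<^sub>0: "0 < \<delta>\<^sub>0" "\<delta>\<^sub>0 < 1" and tail0: "\<forall>\<delta>\<in>{0<..<\<delta>\<^sub>0}. \<exists>C\<^sub>0>0. \<forall>\<kappa>\<ge>0. \<exists>N\<^sub>0>0. \<exists>s\<^sub>0>0.
      exit_tail_at M \<omega> I J \<nu> \<delta> C\<^sub>0 \<kappa> N\<^sub>0 s\<^sub>0"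
    using tail unfolding exit_tail_def by auto
  have "\<exists>C R. exit_bounds \<delta> C R" if \<delta>: "0 < \<delta>" "\<delta> < \<delta>\<^sub>0" for \<delta>
  proof -
    \<comment> \<open>The hypothesis is used at \<open>\<delta> / 2\<close>, the cone parameter
      produced by \<open>characteristic_shift\<close>.\<close>
    obtain C\<^sub>0 where C\<^sub>0: "C\<^sub>0 > 0" and "\<forall>\<kappa>\<ge>0. \<exists>N\<^sub>0>0. \<exists>s\<^sub>0>0. exit_tail_at M \<omega> I J \<nu> (\<delta> / 2) C\<^sub>0 \<kappa> N\<^sub>0 s\<^sub>0"
      using tail0[rule_format, of "\<delta> / 2"] \<delta> by auto
    \<comment> \<open>The choice \<open>\<kappa> = 1\<close> suffices, since the shifted direction
      is off by rounding only.\<close>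
    then obtain N\<^sub>0 s\<^sub>0 where N\<^sub>0: "N\<^sub>0 > 0" and s\<^sub>0: "s\<^sub>0 > 0" and main0: "exit_tail_at M \<omega> I J \<nu> (\<delta> / 2) C\<^sub>0 1 N\<^sub>0 s\<^sub>0"
      using zero_le_one by blast
    note main = main0[unfolded exit_tail_at_def, rule_format]
    define d where "d = \<delta> powr (2 / 3)"
    have d: "0 < d" using \<delta> by (simp add: d_def)
    \<comment> \<open>The first two bounds are the length requirements of
      \<open>characteristic_shift\<close>; the third makes the normalized exit size at least
      \<open>s\<^sub>0\<close>.\<close>
    define R where "R = max (2 * N\<^sub>0 / \<delta>) (max (2 / \<delta>) (s\<^sub>0 / d))"
    define C where "C = C\<^sub>0 * d powr - \<nu>"
    have R: "0 < R" "2 * N\<^sub>0 / \<delta> \<le> R" "2 / \<delta> \<le> R" "s\<^sub>0 / d \<le> R"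
      using \<delta> by (auto simp: R_def less_max_iff_disj)
    have s_bound: "s\<^sub>0 \<le> s \<and> C\<^sub>0 * s powr - \<nu> \<le> C * z powr - \<nu>" if "R \<le> z" "d * z \<le> s" for z s
    proof -
      have "s\<^sub>0 \<le> d * R" using R(4) d by (simp add: field_simps)
      also have "\<dots> \<le> d * z" using that d by simp
      finally have "s\<^sub>0 \<le> d * z" .
      moreover have "s powr - \<nu> \<le> (d * z) powr - \<nu>"
        using that R(1) d nu_pos by (intro powr_mono2') auto
      ultimately show ?thesis
        using that C\<^sub>0 d R(1) by (auto simp: C_def powr_mult mult.assoc)
    qed
    have "exit_bounds \<delta> C R"
      unfolding exit_bounds_def
    proof (intro conjI allI impI)
      show "0 < C" "0 < R" using C\<^sub>0 d R by (auto simp: C_def)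
    next
      fix t \<rho> :: real and x and m n :: int
      assume t: "\<delta> < t" "t < 1 - \<delta>" and mn: "1 \<le> m" "1 \<le> n" and \<rho>: "0 < \<rho>" and T: "R \<le> m + n"
        and z: "R \<le> \<rho> * (m + n) powr (1 / 3)" and dir: "(t + \<rho>) * (m + n) \<le> m"
      \<comment> \<open>The start moves down by \<open>q\<close>, so that a vertical exit from
        \<open>x\<close> turns into one at distance at least \<open>q + 1\<close>.\<close>
      define q where "q = \<lfloor>m / t\<rfloor> - (m + n)"
      have T': "2 * N\<^sub>0 / \<delta> \<le> m + n" "2 / \<delta> \<le> m + n" using T R by auto
      note cs = characteristic_shift[OF \<delta>(1) t mn \<rho> dir T', folded q_def]
      define s where "s = (q + 1) / (m + (n + q)) powr (2 / 3)"
      have sb: "s\<^sub>0 \<le> s \<and> C\<^sub>0 * s powr - \<nu> \<le> C * (\<rho> * (m + n) powr (1 / 3)) powr - \<nu>"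
        by (rule s_bound[OF z]) (use cs(6) in \<open>simp add: s_def d_def\<close>)
      have ev: "{p \<in> space M. \<exists>k\<in>exit_set (\<lambda>v. \<omega> v p) (\<lambda>v. I (direction t) v p) (\<lambda>v. J (direction t) v p)
            (x - (0, q)) ((x - (0, q)) + (m, n + q)). k \<le> - (q + 1)} \<in> events"
        using t \<delta> mn cs(1) by (intro exit_set_prob(2)) auto
      have "V_prob t x (x + (m, n))
        \<le> prob {p \<in> space M. \<exists>k\<in>exit_set (\<lambda>v. \<omega> v p) (\<lambda>v. I (direction t) v p) (\<lambda>v. J (direction t) v p)
            (x - (0, q)) ((x - (0, q)) + (m, n + q)). k \<le> - (q + 1)}"
      proof (rule finite_measure_mono_AE[OF _ ev])
        have "AE p in M. consistent_at t p"
          using t \<delta> by (intro consistent) auto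
        then show "AE p in M. p \<in> {p \<in> space M. H_at t p x (x + (m, n))
             \<le> V_at t p x (x + (m, n))} \<longrightarrow>
          p \<in> {p \<in> space M. \<exists>k\<in>exit_set (\<lambda>v. \<omega> v p) (\<lambda>v. I (direction t) v p) (\<lambda>v. J (direction t) v p)
            (x - (0, q)) ((x - (0, q)) + (m, n + q)). k \<le> - (q + 1)}"
        proof eventually_elim
          case (elim p)
          then show ?case
            using V_exit_shift[OF elim, of "fst x" "fst x + m" "snd x" "snd x + n" q] mn cs(1)
            by (cases x) (auto simp: algebra_simps)
        qed
      qed
      also have "\<dots> \<le> C * (\<rho> * (m + n) powr (1 / 3)) powr - \<nu>"
      proof (rule exit_tail_bound)
        show "far_exit_prob M \<omega> I J (direction t) (m) (n + q) ((q + 1) / (m + (n + q)) powr (2 / 3) * (m + (n + q)) powr (2 / 3))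
          \<le> C * (\<rho> * (m + n) powr (1 / 3)) powr - \<nu>"
          unfolding s_def[symmetric]
          by (rule order.trans[OF main[OF cs(2-4) sb[THEN conjunct1]] sb[THEN conjunct2]])
            (use t \<delta> cs(5) in auto)
      qed (use t \<delta> mn cs(1) in auto)
      finally show "V_prob t x (x + (m, n))
        \<le> C * (\<rho> * (m + n) powr (1 / 3)) powr - \<nu>" .
    next
      fix t \<rho> :: real and x and m n :: int
      assume t: "\<delta> < t" "t < 1 - \<delta>" and mn: "1 \<le> m" "1 \<le> n" and \<rho>: "0 < \<rho>" and T: "R \<le> m + n"
        and z: "R \<le> \<rho> * (m + n) powr (1 / 3)" and dir: "m \<le> (t - \<rho>) * (m + n)"
      \<comment> \<open>The same shift with the axes exchanged: \<open>1 - t\<close> and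
        \<open>n\<close> take the places of \<open>t\<close> and \<open>m\<close>, and the start
        moves to the left.\<close>
      define q where "q = \<lfloor>n / (1 - t)\<rfloor> - (n + m)"
      have T': "2 * N\<^sub>0 / \<delta> \<le> n + m" "2 / \<delta> \<le> n + m" using T R by auto
      have t': "\<delta> < 1 - t" "1 - t < 1 - \<delta>" using t by auto
      have dir': "(1 - t + \<rho>) * (n + m) \<le> n" using dir by (simp add: algebra_simps)
      note cs = characteristic_shift[OF \<delta>(1) t' mn(2,1) \<rho> dir' T', folded q_def]
      have e: "n + (m + q) = (m + q) + n" "real_of_int (n + m) = m + n" by simp_all
      define s where "s = (q + 1) / ((m + q) + n) powr (2 / 3)"
      have sb: "s\<^sub>0 \<le> s \<and> C\<^sub>0 * s powr - \<nu> \<le> C * (\<rho> * (m + n) powr (1 / 3)) powr - \<nu>"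
        by (rule s_bound[OF z]) (use cs(6) in \<open>simp add: s_def d_def ac_simps\<close>)
      have pos: "0 < (m + q) + n" using mn cs(1) by linarith
      have ev: "{p \<in> space M. \<exists>k\<in>exit_set (\<lambda>v. \<omega> v p) (\<lambda>v. I (direction t) v p) (\<lambda>v. J (direction t) v p)
            (x - (q, 0)) ((x - (q, 0)) + (m + q, n)). q + 1 \<le> k} \<in> events"
        using t \<delta> mn cs(1) by (intro exit_set_prob(2)) auto
      have "H_prob t x (x + (m, n))
        \<le> prob {p \<in> space M. \<exists>k\<in>exit_set (\<lambda>v. \<omega> v p) (\<lambda>v. I (direction t) v p) (\<lambda>v. J (direction t) v p)
            (x - (q, 0)) ((x - (q, 0)) + (m + q, n)). q + 1 \<le> k}"
      proof (rule finite_measure_mono_AE[OF _ ev])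
        have "AE p in M. consistent_at t p"
          using t \<delta> by (intro consistent) auto
        then show "AE p in M. p \<in> {p \<in> space M. V_at t p x (x + (m, n))
             \<le> H_at t p x (x + (m, n))} \<longrightarrow>
          p \<in> {p \<in> space M. \<exists>k\<in>exit_set (\<lambda>v. \<omega> v p) (\<lambda>v. I (direction t) v p) (\<lambda>v. J (direction t) v p)
            (x - (q, 0)) ((x - (q, 0)) + (m + q, n)). q + 1 \<le> k}"
        proof eventually_elim
          case (elim p)
          then show ?case
            using H_exit_shift[OF elim, of "fst x" "fst x + m" "snd x" "snd x + n" q] mn cs(1)
            by (cases x) (auto simp: algebra_simps)
        qed
      qed
      also have "\<dots> \<le> C * (\<rho> * (m + n) powr (1 / 3)) powr - \<nu>"
      proof (rule exit_tail_bound)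
        have cone: "(real_of_int (m + q), real_of_int n) \<in> S_cone (\<delta> / 2)"
          using cs(2) by (auto simp: S_cone_def)
        have "n / (n + (m + q)) = 1 - (m + q) / (m + q + n)"
          using pos by (simp add: field_simps del: of_int_add)
        then have char: "\<bar>t - (m + q) / (m + q + n)\<bar> \<le> 1 * (m + q + n) powr (- 1 / 3)"
          using cs(5) unfolding e by (simp add: abs_minus_commute)
        show "far_exit_prob M \<omega> I J (direction t) (m + q) (n) ((q + 1) / (m + q + n) powr (2 / 3) * (m + q + n) powr (2 / 3))
          \<le> C * (\<rho> * (m + n) powr (1 / 3)) powr - \<nu>"
          unfolding s_def[symmetric]
          by (rule order.trans[OF main[OF cone cs(4,3) sb[THEN conjunct1]] sb[THEN conjunct2]])
            (use t \<delta> char in auto)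
      qed (use t \<delta> mn cs(1) in auto)
      finally show "H_prob t x (x + (m, n))
        \<le> C * (\<rho> * (m + n) powr (1 / 3)) powr - \<nu>" .
    qed
    then show ?thesis by blast
  qed
  then show ?thesis using \<delta>\<^sub>0 by (intro bexI[of _ \<delta>\<^sub>0]) auto
qed

end

section \<open>Geodesics are not asymptotic to an axis\<close>

context prob_space
begin

text \<open>The limiting distribution has no atom at \<open>0\<close>, while a fixed window shrinks
  to \<open>0\<close> after division by a scale tending to infinity.\<close>

lemma weak_conv_std_normal_escape:
  assumes rv: "\<And>n. X n \<in> borel_measurable M"
    and wc: "weak_conv_m (\<lambda>n. distr M borel (\<lambda>p. X n p / s n)) std_normal_distribution"
    and s: "filterlim s at_top sequentially"
  shows "(\<lambda>n. prob {p \<in> space M. \<bar>X n p\<bar> \<le> c}) \<longlonglongrightarrow> 0"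
proof -
  interpret N: real_distribution std_normal_distribution by (rule real_dist_normal_dist)
  let ?F = "cdf std_normal_distribution"
  have cont: "isCont ?F x" for x
  proof -
    have "emeasure std_normal_distribution {x} = (\<integral>\<^sup>+ y. ennreal (std_normal_density y) * indicator {x} y \<partial>lborel)"
      by (subst emeasure_density) auto
    also have "\<dots> = 0"
      by (subst nn_integral_0_iff_AE) (auto intro!: eventually_mono[OF AE_lborel_singleton[of x]])
    finally have "emeasure std_normal_distribution {x} = 0" .
    then show ?thesis by (simp add: N.isCont_cdf measure_def)
  qed
  have conv: "(\<lambda>n. cdf (distr M borel (\<lambda>p. X n p / s n)) x) \<longlonglongrightarrow> ?F x" for x
    using wc cont by (auto simp: weak_conv_m_def weak_conv_def)
  show ?thesis
  proof (rule order_tendstoI)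
    fix e :: real assume "0 < e"
    \<comment> \<open>Differences of distribution functions measure half-open intervals, so
      \<open>{- d..d}\<close> is enlarged on the left to \<open>{- (2 * d)<..d}\<close>.\<close>
    have "((\<lambda>d. ?F d - ?F (- (2 * d))) \<longlongrightarrow> ?F 0 - ?F (- (2 * 0))) (at_right 0)"
      by (intro tendsto_intros isCont_tendsto_compose[OF cont])
    then have "eventually (\<lambda>d. ?F d - ?F (- (2 * d)) < e) (at_right 0)"
      using \<open>0 < e\<close> by (intro order_tendstoD(2)[of _ 0]) auto
    then have "eventually (\<lambda>d. ?F d - ?F (- (2 * d)) < e \<and> 0 < d) (at_right 0)"
      by (simp add: eventually_conj eventually_at_right_less)
    then obtain d where d: "0 < d" "?F d - ?F (- (2 * d)) < e"
      using eventually_happens[of _ "at_right (0::real)"] by (metis (no_types, lifting) trivial_limit_at_right_real)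
    have "(\<lambda>n. cdf (distr M borel (\<lambda>p. X n p / s n)) d - cdf (distr M borel (\<lambda>p. X n p / s n)) (- (2 * d)))
        \<longlonglongrightarrow> ?F d - ?F (- (2 * d))"
      by (intro tendsto_diff conv)
    then have "eventually (\<lambda>n. cdf (distr M borel (\<lambda>p. X n p / s n)) d
        - cdf (distr M borel (\<lambda>p. X n p / s n)) (- (2 * d)) < e) sequentially"
      using d by (intro order_tendstoD(2))
    moreover have "eventually (\<lambda>n. max 1 (\<bar>c\<bar> / d) \<le> s n) sequentially"
      using s unfolding filterlim_at_top by blast
    ultimately show "eventually (\<lambda>n. prob {p \<in> space M. \<bar>X n p\<bar> \<le> c} < e) sequentially"
    proof eventually_elim
      case (elim n)
      note [measurable] = rv[of n]
      interpret D: real_distribution "distr M borel (\<lambda>p. X n p / s n)"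
        by (rule real_distribution_distr) simp
      have sn: "0 < s n" "\<bar>c\<bar> \<le> d * s n" using elim(2) d by (auto simp: field_simps)
      have "{p \<in> space M. \<bar>X n p\<bar> \<le> c} \<subseteq> {p \<in> space M. X n p / s n \<in> {- (2 * d)<..d}}"
      proof safe
        fix p assume "\<bar>X n p\<bar> \<le> c"
        then have "X n p \<le> d * s n" "- (d * s n) \<le> X n p" using sn(2) by linarith+
        moreover have "0 < d * s n" using d(1) sn(1) by simp
        ultimately have "X n p \<le> d * s n" "- (2 * d) * s n < X n p" by linarith+
        then show "X n p / s n \<in> {- (2 * d)<..d}"
          using sn(1) by (simp add: pos_divide_le_eq pos_less_divide_eq)
      qed
      then have "prob {p \<in> space M. \<bar>X n p\<bar> \<le> c} \<le> prob {p \<in> space M. X n p / s n \<in> {- (2 * d)<..d}}"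
        by (intro finite_measure_mono) auto
      also have "\<dots> = measure (distr M borel (\<lambda>p. X n p / s n)) {- (2 * d)<..d}"
        by (subst measure_distr) (auto intro!: arg_cong[where f = prob])
      also have "\<dots> = cdf (distr M borel (\<lambda>p. X n p / s n)) d - cdf (distr M borel (\<lambda>p. X n p / s n)) (- (2 * d))"
        using d by (subst D.cdf_diff_eq) auto
      finally show ?case using elim(1) by simp
    qed
  qed (auto intro: always_eventually less_le_trans[OF _ measure_nonneg])
qed

lemma indep_pair:
  assumes "indep_vars (\<lambda>_. borel) \<omega> UNIV" "u \<noteq> v"
  shows "indep_var borel (\<omega> u :: 'a \<Rightarrow> real) borel (\<omega> v)"
proof -
  have "indep_var (PiM {u} (\<lambda>_. borel)) (\<lambda>p. restrict (\<lambda>i. \<omega> i p) {u})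
      (PiM {v} (\<lambda>_. borel)) (\<lambda>p. restrict (\<lambda>i. \<omega> i p) {v})"
    using assms by (intro indep_var_restrict) auto
  from indep_var_compose[OF this, of "\<lambda>f. f u" borel "\<lambda>f. f v" borel]
  show ?thesis by (simp add: comp_def measurable_component_singleton)
qed

text \<open>The summands are independent, centred because the weights have equal laws, and their
  variance is twice that of a weight; the central limit theorem then gives the escape. Injectivity
  and disjoint ranges ensure that no site is used twice.\<close>

lemma walk_escape:
  fixes \<omega> :: "'b \<Rightarrow> 'a \<Rightarrow> real" and u v :: "nat \<Rightarrow> 'b"
  assumes ind: "indep_vars (\<lambda>_. borel) \<omega> UNIV"
    and ident: "\<And>x y. distr M borel (\<omega> x) = distr M borel (\<omega> y)"
    and sq: "\<And>x. integrable M (\<lambda>p. (\<omega> x p)\<^sup>2)"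
    and var: "\<And>x. variance (\<omega> x) > 0"
    and inj: "inj u" "inj v" "range u \<inter> range v = {}"
  shows "(\<lambda>k. prob {p \<in> space M. \<bar>\<Sum>i<k. \<omega> (u i) p - \<omega> (v i) p\<bar> \<le> c}) \<longlonglongrightarrow> 0"
proof -
  have rv [measurable]: "\<omega> x \<in> borel_measurable M" for x
    using ind by (auto simp: indep_vars_def)
  have int: "integrable M (\<omega> x)" for x
    by (rule square_integrable_imp_integrable[OF rv sq])
  define X where "X i p = \<omega> (u i) p - \<omega> (v i) p" for i p
  have [measurable]: "X i \<in> borel_measurable M" for i unfolding X_def[abs_def] by measurable
  have uv: "u i \<noteq> v i" for i using inj(3) by auto
  have ind2: "indep_var borel (\<omega> (u i)) borel (\<omega> (v i))" for i by (rule indep_pair[OF ind uv])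
  have intp: "integrable M (\<lambda>p. \<omega> (u i) p * \<omega> (v i) p)" for i
    by (rule indep_var_integrable[OF ind2 int int])
  have mean: "expectation (\<omega> x) = expectation (\<omega> y)"
    and mean2: "expectation (\<lambda>p. (\<omega> x p)\<^sup>2) = expectation (\<lambda>p. (\<omega> y p)\<^sup>2)" for x y
  proof -
    have "expectation (\<omega> z) = (\<integral>r. r \<partial>distr M borel (\<omega> z))"
      "expectation (\<lambda>p. (\<omega> z p)\<^sup>2) = (\<integral>r. r\<^sup>2 \<partial>distr M borel (\<omega> z))" for z
      by (simp_all add: integral_distr)
    then show "expectation (\<omega> x) = expectation (\<omega> y)"
      "expectation (\<lambda>p. (\<omega> x p)\<^sup>2) = expectation (\<lambda>p. (\<omega> y p)\<^sup>2)"
      using ident[of x y] by simp_all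
  qed
  have X0: "expectation (X i) = 0" for i
    unfolding X_def[abs_def] using int mean[of "u i" "v i"] by simp
  have Xsq_eq: "(\<lambda>p. (X i p)\<^sup>2) = (\<lambda>p. (\<omega> (u i) p)\<^sup>2 + (\<omega> (v i) p)\<^sup>2 - 2 * (\<omega> (u i) p * \<omega> (v i) p))" for i
    by (simp add: X_def power2_eq_square algebra_simps fun_eq_iff)
  have Xsq: "integrable M (\<lambda>p. (X i p)\<^sup>2)" for i
    unfolding Xsq_eq using sq intp by simp
  define \<sigma> where "\<sigma> = sqrt (2 * variance (\<omega> (u 0)))"
  have \<sigma>: "\<sigma> > 0" "\<sigma>\<^sup>2 = 2 * variance (\<omega> (u 0))" using var[of "u 0"] by (auto simp: \<sigma>_def)
  have Xvar: "variance (X i) = \<sigma>\<^sup>2" for i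
  proof -
    have "variance (X i) = expectation (\<lambda>p. (X i p)\<^sup>2)" by (simp add: X0)
    also have "\<dots> = expectation (\<lambda>p. (\<omega> (u i) p)\<^sup>2) + expectation (\<lambda>p. (\<omega> (v i) p)\<^sup>2)
        - 2 * (expectation (\<omega> (u i)) * expectation (\<omega> (v i)))"
      unfolding Xsq_eq using sq intp indep_var_lebesgue_integral[OF ind2 int int] by simp
    also have "\<dots> = 2 * (expectation (\<lambda>p. (\<omega> (u 0) p)\<^sup>2) - (expectation (\<omega> (u 0)))\<^sup>2)"
      using mean[of "u i" "u 0"] mean[of "v i" "u 0"] mean2[of "u i" "u 0"] mean2[of "v i" "u 0"]
      by (simp add: power2_eq_square)
    also have "\<dots> = \<sigma>\<^sup>2" using variance_eq[OF int sq] \<sigma>(2) by simp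
    finally show ?thesis .
  qed
  have Xdistr: "distr M borel (X i) = distr M borel (X 0)" for i
  proof -
    have "distr M borel (X j) = distr (distr M borel (\<omega> (u j)) \<Otimes>\<^sub>M distr M borel (\<omega> (v j))) borel (\<lambda>z. fst z - snd z)" for j
    proof -
      have "distr M borel (\<omega> (u j)) \<Otimes>\<^sub>M distr M borel (\<omega> (v j)) = distr M (borel \<Otimes>\<^sub>M borel) (\<lambda>p. (\<omega> (u j) p, \<omega> (v j) p))"
        using ind2[of j] unfolding indep_var_distribution_eq by simp
      then show ?thesis by (simp add: distr_distr comp_def X_def[abs_def])
    qed
    then show ?thesis using ident[of "u i" "u 0"] ident[of "v i" "v 0"] by simp
  qed
  have Xind: "indep_vars (\<lambda>_. borel) X UNIV"
  proof -
    have "disjoint_family (\<lambda>j. {u j, v j})"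
      unfolding disjoint_family_on_def
    proof (intro ballI impI)
      fix m n :: nat assume "m \<noteq> n"
      moreover have "u n \<noteq> v m" "u m \<noteq> v n" using inj(3) by (metis IntI emptyE rangeI)+
      ultimately show "{u m, v m} \<inter> {u n, v n} = {}"
        using inj(1,2) by (auto dest: injD)
    qed
    then have "indep_vars (\<lambda>j. PiM {u j, v j} (\<lambda>_. borel)) (\<lambda>j p. restrict (\<lambda>i. \<omega> i p) {u j, v j}) UNIV"
      by (intro indep_vars_restrict[OF ind]) auto
    then have "indep_vars (\<lambda>_. borel) (\<lambda>j p. (\<lambda>f. f (u j) - f (v j)) (restrict (\<lambda>i. \<omega> i p) {u j, v j})) UNIV"
      by (rule indep_vars_compose2) (auto intro!: borel_measurable_diff measurable_component_singleton)
    then show ?thesis by (simp add: X_def[abs_def])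
  qed
  have "weak_conv_m (\<lambda>n. distr M borel (\<lambda>x. (\<Sum>i<n. X i x) / sqrt (real n * \<sigma>\<^sup>2))) std_normal_distribution"
    by (rule central_limit_theorem_zero_mean[OF Xind X0 \<sigma>(1) Xsq Xvar Xdistr])
  moreover have "filterlim (\<lambda>n. sqrt (real n * \<sigma>\<^sup>2)) at_top sequentially"
    using \<sigma>(1) by real_asymp
  ultimately have "(\<lambda>k. prob {p \<in> space M. \<bar>\<Sum>i<k. X i p\<bar> \<le> c}) \<longlonglongrightarrow> 0"
    by (intro weak_conv_std_normal_escape) auto
  then show ?thesis by (simp add: X_def)
qed

text \<open>
  If the vertical increments \<open>J\<close> had a finite limit, then, since the limit of the horizontal
  ones is the weight itself, that limit would move along a row by a centred random walk; a
  stationary sequence is tight while the walk is not.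
\<close>

lemma increments_blow_up:
  fixes W :: "site \<Rightarrow> 'a \<Rightarrow> real" and I J :: "nat \<Rightarrow> site \<Rightarrow> 'a \<Rightarrow> real"
  assumes [measurable]: "\<And>x. W x \<in> borel_measurable M" "\<And>m x. J m x \<in> borel_measurable M"
    and lim: "AE p in M. \<forall>x. (\<lambda>m. I m x p) \<longlonglongrightarrow> W x p"
    and square: "AE p in M. \<forall>m a b. I m (a + 1, b) p + J m (a + 1, b + 1) p = J m (a, b + 1) p + I m (a + 1, b + 1) p"
    and below: "AE p in M. \<forall>m x. W x p \<le> J m x p"
    and trans: "\<And>K x y. prob {p \<in> space M. - K \<le> W x p \<and> (\<forall>m. J m x p \<le> K)} =
      prob {p \<in> space M. - K \<le> W y p \<and> (\<forall>m. J m y p \<le> K)}"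
    and escape: "\<And>a b c. (\<lambda>k. prob {p \<in> space M. \<bar>\<Sum>i<k. W (a + 1 + int i, b + 1) p - W (a + 1 + int i, b) p\<bar> \<le> c})
      \<longlonglongrightarrow> 0"
  shows "AE p in M. \<forall>x K. \<exists>m. K < J m x p"
proof -
  have "AE p in M. \<forall>K. \<exists>m. K < J m (a, b + 1) p" for a b
  proof -
    \<comment> \<open>The lower bound on \<open>W\<close> makes the bound on \<open>J\<close>
      two-sided, because \<open>W \<le> J\<close>. The union \<open>F\<close> over \<open>K\<close>
      is the event that the \<open>J m\<close> stay bounded at \<open>(a, b + 1)\<close>.\<close>
    define D where "D x K = {p \<in> space M. - real K \<le> W x p \<and> (\<forall>m. J m x p \<le> real K)}" for x K
    have D [measurable]: "D x K \<in> events" for x K unfolding D_def by measurable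
    define F where "F = (\<Union>K. D (a, b + 1) K)"
    have F [measurable]: "F \<in> events" unfolding F_def by auto
    have F_lim: "(\<lambda>K. prob (D (a, b + 1) K)) \<longlonglongrightarrow> prob F"
      unfolding F_def
    proof (rule finite_Lim_measure_incseq)
      show "incseq (D (a, b + 1))"
        by (auto simp: incseq_def D_def) (meson of_nat_le_iff order.trans neg_le_iff_le)+
    qed auto
    \<comment> \<open>Summing the unit-square identity along the row expresses the change of
      \<open>J\<close> through differences of \<open>I\<close> between two adjacent rows, whose
      limits are weights.\<close>
    have key: "AE p in M. \<forall>k. (\<lambda>m. J m (a + int k, b + 1) p - J m (a, b + 1) p)
        \<longlonglongrightarrow> (\<Sum>i<k. W (a + 1 + int i, b + 1) p - W (a + 1 + int i, b) p)"
      using lim square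
    proof eventually_elim
      case (elim p)
      have "J m (a + int k, b + 1) p - J m (a, b + 1) p = (\<Sum>i<k. I m (a + 1 + int i, b + 1) p - I m (a + 1 + int i, b) p)" for m k
      proof (induction k)
        case (Suc k)
        have "I m (a + int k + 1, b) p + J m (a + int k + 1, b + 1) p = J m (a + int k, b + 1) p + I m (a + int k + 1, b + 1) p"
          using elim(2) by blast
        then show ?case using Suc by (simp add: algebra_simps)
      qed simp
      moreover have "(\<lambda>m. \<Sum>i<k. I m (a + 1 + int i, b + 1) p - I m (a + 1 + int i, b) p)
          \<longlonglongrightarrow> (\<Sum>i<k. W (a + 1 + int i, b + 1) p - W (a + 1 + int i, b) p)" for k
        using elim(1) by (intro tendsto_sum tendsto_diff) auto
      ultimately show ?case by simp
    qed
    \<comment> \<open>Inclusion-exclusion for the same event at two sites at distance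
      \<open>k\<close>: the probabilities agree, both events lie in \<open>F\<close> up to null
      sets, and jointly they confine the walk to modulus \<open>2 * K\<close>, which has vanishing
      probability as \<open>k\<close> grows.\<close>
    have bound: "2 * prob (D (a, b + 1) K) \<le> prob F" for K
    proof -
      define S where "S k = {p \<in> space M. \<bar>\<Sum>i<k. W (a + 1 + int i, b + 1) p - W (a + 1 + int i, b) p\<bar> \<le> 2 * real K}" for k
      have S [measurable]: "S k \<in> events" for k unfolding S_def by measurable
      have "2 * prob (D (a, b + 1) K) - prob F \<le> prob (S k)" for k
      proof -
        let ?A = "D (a, b + 1) K" and ?B = "D (a + int k, b + 1) K"
        have "prob ?B = prob ?A" unfolding D_def by (rule trans)
        moreover have "prob (?A \<union> ?B) \<le> prob F"
        proof (rule finite_measure_mono_AE[OF _ F])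
          show "AE p in M. p \<in> ?A \<union> ?B \<longrightarrow> p \<in> F"
            using key AE_space
          proof eventually_elim
            case (elim p)
            show ?case
            proof
              assume "p \<in> ?A \<union> ?B"
              then show "p \<in> F"
              proof
                assume B: "p \<in> ?B"
                obtain L where L: "\<And>m. \<bar>J m (a + int k, b + 1) p - J m (a, b + 1) p\<bar> \<le> L"
                  using Bseq_def[of "\<lambda>m. J m (a + int k, b + 1) p - J m (a, b + 1) p"]
                    convergent_imp_Bseq[OF convergentI[OF elim(1)[rule_format, of k]]] by auto
                obtain K' :: nat where K': "real K + L \<le> K'" "- W (a, b + 1) p \<le> K'"
                  by (metis max.bounded_iff real_arch_simple)
                have "J m (a, b + 1) p \<le> K'" for m
                proof -
                  have "J m (a + int k, b + 1) p \<le> real K" using B by (simp add: D_def)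
                  then show ?thesis using L[of m] K'(1) by linarith
                qed
                then have "p \<in> D (a, b + 1) K'"
                  using elim(2) K'(2) by (auto simp: D_def)
                then show "p \<in> F" by (auto simp: F_def)
              qed (auto simp: F_def)
            qed
          qed
        qed
        moreover have "prob (?A \<inter> ?B) \<le> prob (S k)"
        proof (rule finite_measure_mono_AE[OF _ S])
          show "AE p in M. p \<in> ?A \<inter> ?B \<longrightarrow> p \<in> S k"
            using key below AE_space
          proof eventually_elim
            case (elim p)
            show ?case
            proof
              assume p: "p \<in> ?A \<inter> ?B"
              have b: "\<bar>J m (a + int k, b + 1) p - J m (a, b + 1) p\<bar> \<le> 2 * real K" for m
              proof -
                have "W (a + int k, b + 1) p \<le> J m (a + int k, b + 1) p" "W (a, b + 1) p \<le> J m (a, b + 1) p"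
                  using elim(2) by auto
                moreover have "- real K \<le> W (a + int k, b + 1) p" "- real K \<le> W (a, b + 1) p"
                  "J m (a + int k, b + 1) p \<le> real K" "J m (a, b + 1) p \<le> real K"
                  using p by (auto simp: D_def)
                ultimately show ?thesis by linarith
              qed
              have "\<bar>\<Sum>i<k. W (a + 1 + int i, b + 1) p - W (a + 1 + int i, b) p\<bar> \<le> 2 * real K"
                by (rule LIMSEQ_le_const2[OF tendsto_rabs[OF elim(1)[rule_format, of k]]]) (use b in auto)
              then show "p \<in> S k" using elim(3) by (simp add: S_def)
            qed
          qed
        qed
        moreover have "prob (?A \<union> ?B) + prob (?A \<inter> ?B) = prob ?A + prob ?B"
          using measure_Un3[of ?A M ?B] by (simp add: fmeasurable_eq_sets)
        ultimately show ?thesis by linarith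
      qed
      moreover have "(\<lambda>k. prob (S k)) \<longlonglongrightarrow> 0" unfolding S_def by (rule escape)
      ultimately show ?thesis by (meson LIMSEQ_le_const diff_le_0_iff_le)
    qed
    \<comment> \<open>Letting \<open>K\<close> grow in \<open>bound\<close> gives this inequality,
      which forces \<open>F\<close> to be a null event.\<close>
    have "2 * prob F \<le> prob F"
      by (rule LIMSEQ_le_const2[OF tendsto_mult[OF tendsto_const F_lim]]) (use bound in auto)
    then have "prob F = 0" using measure_nonneg[of M F] by linarith
    then have "AE p in M. p \<notin> F" by (intro AE_not_in) (auto simp: emeasure_eq_measure)
    then show ?thesis using AE_space
    proof eventually_elim
      case (elim p)
      show ?case
      proof (rule ccontr)
        assume "\<not> ?thesis"
        then obtain K where K: "\<And>m. J m (a, b + 1) p \<le> K" by (auto simp: not_less)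
        obtain K' :: nat where "K \<le> K'" "- W (a, b + 1) p \<le> K'"
          by (metis max.bounded_iff real_arch_simple)
        then have "p \<in> D (a, b + 1) K'" using K elim(2) by (auto simp: D_def intro: order.trans)
        then show False using elim(1) by (auto simp: F_def)
      qed
    qed
  qed
  then have "AE p in M. \<forall>K. \<exists>m. K < J m x p" for x
    by (cases x) (metis diff_add_cancel)
  then show ?thesis by (simp add: AE_all_countable)
qed

end

text \<open>Markov's inequality excludes that the gap stays above \<open>1 / Suc n\<close> for every
  \<open>m\<close>; monotonicity upgrades one small gap to convergence.\<close>

lemma (in prob_space) decreasing_limit:
  fixes f :: "nat \<Rightarrow> 'a \<Rightarrow> real"
  assumes int: "\<And>m. integrable M (f m)" "integrable M g"
    and ge: "\<And>m. AE p in M. g p \<le> f m p" and dec: "\<And>m. AE p in M. f (Suc m) p \<le> f m p"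
    and exp: "(\<lambda>m. expectation (f m)) \<longlonglongrightarrow> expectation g"
  shows "AE p in M. (\<lambda>m. f m p) \<longlonglongrightarrow> g p"
proof -
  have meas: "f m \<in> borel_measurable M" "g \<in> borel_measurable M" for m using int by auto
  have "AE p in M. \<exists>m. f m p - g p < 1 / real (Suc n)" for n
  proof -
    define S where "S = {p \<in> space M. \<forall>m. 1 / real (Suc n) \<le> f m p - g p}"
    have S: "S \<in> events" unfolding S_def using meas by measurable
    have "prob S \<le> (expectation (f m) - expectation g) / (1 / real (Suc n))" for m
    proof -
      have "prob S \<le> prob {p \<in> space M. f m p - g p \<ge> 1 / real (Suc n)}"
        using meas by (intro finite_measure_mono) (auto simp: S_def)
      also have "\<dots> \<le> (\<integral>p. f m p - g p \<partial>M) / (1 / real (Suc n))"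
        using int ge[of m] by (intro integral_Markov_inequality_measure[where A = "{}"]) auto
      finally show ?thesis using int by simp
    qed
    moreover have "(\<lambda>m. (expectation (f m) - expectation g) / (1 / real (Suc n)))
        \<longlonglongrightarrow> (expectation g - expectation g) / (1 / real (Suc n))"
      by (intro tendsto_intros exp) simp
    ultimately have "prob S \<le> (expectation g - expectation g) / (1 / real (Suc n))"
      by (meson LIMSEQ_le_const)
    then have "prob S = 0" using measure_nonneg[of M S] by auto
    then have "AE p in M. p \<notin> S" using S by (intro AE_not_in) (auto simp: emeasure_eq_measure)
    then show ?thesis using AE_space by eventually_elim (auto simp: S_def not_le)
  qed
  then have small: "AE p in M. \<forall>n. \<exists>m. f m p - g p < 1 / real (Suc n)" by (simp add: AE_all_countable)
  have "AE p in M. \<forall>m. g p \<le> f m p \<and> f (Suc m) p \<le> f m p"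
    using ge dec by (simp add: AE_all_countable)
  with small show ?thesis
  proof eventually_elim
    case (elim p)
    have anti: "decseq (\<lambda>m. f m p)" using elim(2) by (simp add: decseq_Suc_iff)
    show ?case
    proof (rule LIMSEQ_I)
      fix r :: real assume "0 < r"
      then obtain n where n: "1 / real (Suc n) < r" using nat_approx_posE by auto
      obtain m where m: "f m p - g p < 1 / real (Suc n)" using elim(1) by blast
      have "norm (f k p - g p) < r" if "m \<le> k" for k
        using decseqD[OF anti that] elim(2)[rule_format, of k] m n by auto
      then show "\<exists>no. \<forall>k\<ge>no. norm (f k p - g p) < r" by blast
    qed
  qed
qed

lemma summable_dyadic:
  assumes "0 < (e :: real)"
  shows "summable (\<lambda>i::nat. (2 ^ i) powr - e)"
proof -
  have "(2 ^ i) powr - e = (2 powr - e) ^ i" for i :: nat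
    by (simp add: powr_realpow[symmetric] powr_powr mult.commute)
  moreover have "2 powr - e < 1" using assms by (simp add: powr_less_one)
  ultimately show ?thesis by (simp add: summable_geometric)
qed

locale iid_env = boundary_env +
  assumes indep: "indep_vars (\<lambda>_. borel) \<omega> UNIV"
    and ident: "\<And>x y. distr M borel (\<omega> x) = distr M borel (\<omega> y)"
    and square_int: "\<And>x. integrable M (\<lambda>p. (\<omega> x p)\<^sup>2)"
    and nondegenerate: "\<And>x. variance (\<omega> x) > 0"
begin

lemma near_e1: "0 < 1 - 1 / (real m + 2)" "1 - 1 / (real m + 2) < 1"
  and near_e2: "0 < 1 / (real m + 2)" "1 / (real m + 2) < 1"
  by (auto simp: field_simps)

text \<open>The weight \<open>\<omega>\<close> is a lower bound for the horizontal weights and their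
  expectations converge to its expectation, so no gap can survive.\<close>

lemma I_limit: "AE p in M. \<forall>x. (\<lambda>m. I (e1_dir m) x p) \<longlonglongrightarrow> \<omega> x p"
proof -
  have "AE p in M. (\<lambda>m. I (e1_dir m) x p) \<longlonglongrightarrow> \<omega> x p" for x
  proof (rule decreasing_limit)
    fix m
    show "integrable M (I (e1_dir m) x)"
      using near_e1 by (intro I_integrable) auto
    have "AE p in M. consistent_at (1 - 1 / (real m + 2)) p"
      using near_e1 by (intro consistent) auto
    then show "AE p in M. \<omega> x p \<le> I (e1_dir m) x p"
      by eventually_elim (rule consistent_le(1))
    have "AE p in M. \<forall>x. I (e1_dir (Suc m)) x p \<le> I (e1_dir m) x p
        \<and> J (e1_dir m) x p \<le> J (e1_dir (Suc m)) x p"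
      using near_e1[of m] near_e1[of "Suc m"] by (intro monotone) (auto simp: frac_le)
    then show "AE p in M. I (e1_dir (Suc m)) x p \<le> I (e1_dir m) x p"
      by eventually_elim blast
  qed (use w_integrable I_expectation in auto)
  then show ?thesis by (simp add: AE_all_countable)
qed

lemma J_limit: "AE p in M. \<forall>x. (\<lambda>m. J (e2_dir m) x p) \<longlonglongrightarrow> \<omega> x p"
proof -
  have "AE p in M. (\<lambda>m. J (e2_dir m) x p) \<longlonglongrightarrow> \<omega> x p" for x
  proof (rule decreasing_limit)
    fix m
    show "integrable M (J (e2_dir m) x)"
      using near_e2 by (intro J_integrable) auto
    have "AE p in M. consistent_at (1 / (real m + 2)) p"
      using near_e2 by (intro consistent) auto
    then show "AE p in M. \<omega> x p \<le> J (e2_dir m) x p"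
      by eventually_elim (rule consistent_le(2))
    have "AE p in M. \<forall>x. I (e2_dir m) x p \<le> I (e2_dir (Suc m)) x p
        \<and> J (e2_dir (Suc m)) x p \<le> J (e2_dir m) x p"
      using near_e2[of m] near_e2[of "Suc m"] by (intro monotone) (auto simp: frac_le)
    then show "AE p in M. J (e2_dir (Suc m)) x p \<le> J (e2_dir m) x p"
      by eventually_elim blast
  qed (use w_integrable J_expectation in auto)
  then show ?thesis by (simp add: AE_all_countable)
qed

text \<open>The selector \<open>AB\<close> picks the horizontal or the vertical weights, so that one
  argument serves both axes.\<close>

lemma bounded_prob_translate:
  assumes \<Xi>: "\<And>m. \<Xi> m \<in> ri_U" and AB: "AB = (\<lambda>(A :: nat \<Rightarrow> site \<Rightarrow> real, B). A) \<or> AB = (\<lambda>(A, B). B)"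
  shows "prob {p \<in> space M. - K \<le> \<omega> x p \<and> (\<forall>m::nat. AB (\<lambda>m x. I (\<Xi> m) x p, \<lambda>m x. J (\<Xi> m) x p) m x \<le> K)} =
    prob {p \<in> space M. - K \<le> \<omega> y p \<and> (\<forall>m. AB (\<lambda>m x. I (\<Xi> m) x p, \<lambda>m x. J (\<Xi> m) x p) m y \<le> K)}"
proof -
  have key: "prob {p \<in> space M. - K \<le> \<omega> z p \<and> (\<forall>m. AB (\<lambda>m x. I (\<Xi> m) x p, \<lambda>m x. J (\<Xi> m) x p) m z \<le> K)} =
    prob {p \<in> space M. - K \<le> \<omega> 0 p \<and> (\<forall>m. AB (\<lambda>m x. I (\<Xi> m) x p, \<lambda>m x. J (\<Xi> m) x p) m 0 \<le> K)}" for z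
  proof -
    interpret fp: field_pair M "\<lambda>v. \<omega> (v + z)" \<omega> "\<lambda>\<xi> v. I \<xi> (v + z)" "\<lambda>\<xi> v. J \<xi> (v + z)" I J
      by (rule field_pair_translate)
    have P: "Measurable.pred (field_space UNIV) (\<lambda>f. - K \<le> fst (f (0, \<Xi> 0)) \<and>
        (\<forall>m. AB (\<lambda>m x. fst (snd (f (x, \<Xi> m))), \<lambda>m x. snd (snd (f (x, \<Xi> m)))) m 0 \<le> K))"
    proof -
      note [measurable] = field_component_measurable[OF \<Xi>]
      show ?thesis using AB by (elim disjE) simp_all
    qed
    have "(\<lambda>m x. I (\<Xi> m) (x + z) p, \<lambda>m x. J (\<Xi> m) (x + z) p) = (A, B) \<Longrightarrow>
      AB (A, B) m 0 = AB (\<lambda>m x. I (\<Xi> m) x p, \<lambda>m x. J (\<Xi> m) x p) m z" for A B p m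
      using AB by auto
    then show ?thesis
      using fp.prob_eq(1)[of \<Xi> "\<lambda>w I J. - K \<le> w 0 \<and> (\<forall>m. AB (I, J) m 0 \<le> K)", OF \<Xi> P] by simp
  qed
  show ?thesis by (rule trans[OF key[of x] key[of y, symmetric]])
qed

lemma J_blow_up: "AE p in M. \<forall>x K. \<exists>m. K < J (e1_dir m) x p"
proof (rule increments_blow_up[where W = \<omega> and I = "\<lambda>m. I (e1_dir m)"])
  have cons: "AE p in M. \<forall>m::nat. consistent_at (1 - 1 / (real m + 2)) p"
    using near_e1 by (auto simp: AE_all_countable intro!: consistent)
  show "\<omega> x \<in> borel_measurable M" "J (e1_dir m) x \<in> borel_measurable M" for x m
    using near_e1 by (auto intro: J_meas)
  show "AE p in M. \<forall>x. (\<lambda>m. I (e1_dir m) x p) \<longlonglongrightarrow> \<omega> x p"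
    by (rule I_limit)
  show "AE p in M. \<forall>m a b. I (e1_dir m) (a + 1, b) p + J (e1_dir m) (a + 1, b + 1) p
      = J (e1_dir m) (a, b + 1) p + I (e1_dir m) (a + 1, b + 1) p"
    using cons by eventually_elim (intro allI, rule consistent_square, blast)
  show "AE p in M. \<forall>m x. \<omega> x p \<le> J (e1_dir m) x p"
    using cons by eventually_elim (intro allI, rule consistent_le(2), blast)
  show "prob {p \<in> space M. - K \<le> \<omega> x p \<and> (\<forall>m. J (e1_dir m) x p \<le> K)} =
      prob {p \<in> space M. - K \<le> \<omega> y p \<and> (\<forall>m. J (e1_dir m) y p \<le> K)}" for K x y
    using bounded_prob_translate[of "e1_dir" "\<lambda>(A, B). B" K x y] near_e1 by simp
  show "(\<lambda>k. prob {p \<in> space M. \<bar>\<Sum>i<k. \<omega> (a + 1 + int i, b + 1) p - \<omega> (a + 1 + int i, b) p\<bar> \<le> c})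
      \<longlonglongrightarrow> 0" for a b c
    by (rule walk_escape[OF indep ident square_int nondegenerate]) (auto simp: inj_def)
qed

text \<open>After transposing sites, \<open>J\<close> along \<open>e2_dir\<close> takes the
  horizontal and \<open>I\<close> the vertical role in \<open>increments_blow_up\<close>.\<close>

lemma I_blow_up: "AE p in M. \<forall>x K. \<exists>m. K < I (e2_dir m) x p"
proof -
  have "AE p in M. \<forall>x K. \<exists>m. K < I (e2_dir m) (prod.swap x) p"
  proof (rule increments_blow_up[where W = "\<lambda>x. \<omega> (prod.swap x)"
        and I = "\<lambda>m x. J (e2_dir m) (prod.swap x)"])
    have cons: "AE p in M. \<forall>m::nat. consistent_at (1 / (real m + 2)) p"
      using near_e2 by (auto simp: AE_all_countable intro!: consistent)
    show "\<omega> (prod.swap x) \<in> borel_measurable M" "I (e2_dir m) (prod.swap x) \<in> borel_measurable M" for x m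
      using near_e2 by (auto intro: I_meas)
    show "AE p in M. \<forall>x. (\<lambda>m. J (e2_dir m) (prod.swap x) p) \<longlonglongrightarrow> \<omega> (prod.swap x) p"
      using J_limit by eventually_elim blast
    show "AE p in M. \<forall>m a b. J (e2_dir m) (prod.swap (a + 1, b)) p
          + I (e2_dir m) (prod.swap (a + 1, b + 1)) p
        = I (e2_dir m) (prod.swap (a, b + 1)) p + J (e2_dir m) (prod.swap (a + 1, b + 1)) p"
      using cons
    proof eventually_elim
      case (elim p)
      show ?case
      proof (intro allI)
        fix m a b
        show "J (e2_dir m) (prod.swap (a + 1, b)) p
          + I (e2_dir m) (prod.swap (a + 1, b + 1)) p
        = I (e2_dir m) (prod.swap (a, b + 1)) p + J (e2_dir m) (prod.swap (a + 1, b + 1)) p"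
          using consistent_square[OF elim[rule_format, of m], of b a] by simp
      qed
    qed
    show "AE p in M. \<forall>m x. \<omega> (prod.swap x) p \<le> I (e2_dir m) (prod.swap x) p"
      using cons by eventually_elim (intro allI, rule consistent_le(1), blast)
    show "prob {p \<in> space M. - K \<le> \<omega> (prod.swap x) p \<and> (\<forall>m. I (e2_dir m) (prod.swap x) p \<le> K)} =
        prob {p \<in> space M. - K \<le> \<omega> (prod.swap y) p \<and> (\<forall>m. I (e2_dir m) (prod.swap y) p \<le> K)}" for K x y
      using bounded_prob_translate[of "e2_dir" "\<lambda>(A, B). A" K "prod.swap x" "prod.swap y"] near_e2
      by simp
    show "(\<lambda>k. prob {p \<in> space M. \<bar>\<Sum>i<k. \<omega> (prod.swap (a + 1 + int i, b + 1)) p - \<omega> (prod.swap (a + 1 + int i, b)) p\<bar> \<le> c})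
        \<longlonglongrightarrow> 0" for a b c
      by (rule walk_escape[OF indep ident square_int nondegenerate]) (auto simp: inj_def)
  qed
  then show ?thesis by eventually_elim (metis swap_swap)
qed

end

lemma mult_le_abs:
  fixes c s :: real
  assumes "\<bar>c\<bar> \<le> 1"
  shows "c * s \<le> 1 * \<bar>s\<bar>"
proof -
  have "c * s \<le> \<bar>c\<bar> * \<bar>s\<bar>" by (metis abs_ge_self abs_mult)
  also have "\<dots> \<le> 1 * \<bar>s\<bar>" using assms by (intro mult_right_mono) auto
  finally show ?thesis .
qed

lemma dyadic_floor_bounds:
  fixes \<tau> cc :: real
  assumes "0 < \<tau>" "\<tau> \<le> 1 / 2"
  shows "eventually (\<lambda>i::nat. cc \<le> \<tau> / 8 * 2 ^ i) sequentially"
    "\<And>i::nat. (1 - \<tau> / 2) * 2 ^ i - 1 \<le> real_of_int \<lfloor>(1 - \<tau> / 2) * 2 ^ i\<rfloor>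
      \<and> real_of_int \<lfloor>(1 - \<tau> / 2) * 2 ^ i\<rfloor> \<le> (1 - \<tau> / 2) * 2 ^ i"
proof -
  show "eventually (\<lambda>i::nat. cc \<le> \<tau> / 8 * 2 ^ i) sequentially"
    using assms by real_asymp
qed linarith

section \<open>Increments seen from starting points close to an axis\<close>

context boundary_env
begin

text \<open>With a fixed angular gap the tail bound is a negative power of the length, which is
  summable along \<open>2 ^ i\<close>, and Borel-Cantelli applies.\<close>

lemma exit_eventually:
  fixes t \<rho> :: real and m n :: "nat \<Rightarrow> int" and z :: "nat \<Rightarrow> site"
  assumes eb: "exit_bounds \<delta> C R" and t: "\<delta> < t" "t < 1 - \<delta>" "0 < t" "t < 1" and \<rho>: "0 < \<rho>"
    and ev: "eventually (\<lambda>i. 1 \<le> m i \<and> 1 \<le> n i \<and> 2 ^ i / 2 \<le> real_of_int (m i + n i)) sequentially"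
  shows "eventually (\<lambda>i. (t + \<rho>) * (m i + n i) \<le> m i) sequentially \<Longrightarrow>
      AE p in M. eventually (\<lambda>i. V_at t p (z i) (z i + (m i, n i))
        < H_at t p (z i) (z i + (m i, n i))) sequentially"
    and "eventually (\<lambda>i. m i \<le> (t - \<rho>) * (m i + n i)) sequentially \<Longrightarrow>
      AE p in M. eventually (\<lambda>i. H_at t p (z i) (z i + (m i, n i))
        < V_at t p (z i) (z i + (m i, n i))) sequentially"
proof -
  have C: "0 < C" using eb by (simp add: exit_bounds_def)
  \<comment> \<open>The factor \<open>(1 / 2) powr (1 / 3)\<close> comes from the lower bound
    \<open>2 ^ i / 2\<close> on the length.\<close>
  define D where "D = C * (\<rho> * (1 / 2) powr (1 / 3)) powr - \<nu>"
  note [measurable] = I_dir_meas[OF t(3,4)] J_dir_meas[OF t(3,4)]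
  have R: "eventually (\<lambda>i::nat. R \<le> 2 ^ i / 2) sequentially" by real_asymp
  have R2: "eventually (\<lambda>i::nat. R \<le> \<rho> * (2 ^ i / 2) powr (1 / 3)) sequentially" using \<rho> by real_asymp
  have ev2: "eventually (\<lambda>i. 1 \<le> m i \<and> 1 \<le> n i \<and> R \<le> m i + n i \<and> R \<le> \<rho> * (m i + n i) powr (1 / 3)
      \<and> C * (\<rho> * (m i + n i) powr (1 / 3)) powr - \<nu> \<le> D * (2 ^ i) powr - (\<nu> / 3)) sequentially"
    using ev R R2
  proof eventually_elim
    case (elim i)
    have p: "(2 ^ i / 2) powr (1 / 3) \<le> real_of_int (m i + n i) powr (1 / 3)"
      using elim(1) by (intro powr_mono2) auto
    then have "\<rho> * (2 ^ i / 2) powr (1 / 3) \<le> \<rho> * real_of_int (m i + n i) powr (1 / 3)"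
      using \<rho> by (intro mult_left_mono) auto
    moreover from this have "(\<rho> * (m i + n i) powr (1 / 3)) powr - \<nu> \<le> (\<rho> * (2 ^ i / 2) powr (1 / 3)) powr - \<nu>"
      using \<rho> nu_pos by (intro powr_mono2') auto
    moreover have "(\<rho> * (2 ^ i / 2) powr (1 / 3)) powr - \<nu>
        = (\<rho> * (1 / 2) powr (1 / 3)) powr - \<nu> * (2 ^ i) powr - (\<nu> / 3)"
    proof -
      have "(2 ^ i / 2) powr (1 / 3) = (1 / 2) powr (1 / 3) * (2 ^ i) powr (1 / 3 :: real)"
        by (subst powr_mult[symmetric]) auto
      then have "(\<rho> * (2 ^ i / 2) powr (1 / 3)) powr - \<nu>
          = ((\<rho> * (1 / 2) powr (1 / 3)) * (2 ^ i) powr (1 / 3)) powr - \<nu>" by (simp add: mult.assoc)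
      also have "\<dots> = (\<rho> * (1 / 2) powr (1 / 3)) powr - \<nu> * ((2 ^ i) powr (1 / 3)) powr - \<nu>"
        using \<rho> by (simp add: powr_mult)
      also have "((2 ^ i) powr (1 / 3)) powr - \<nu> = (2 ^ i) powr - (\<nu> / 3)"
        by (simp add: powr_powr)
      finally show ?thesis .
    qed
    ultimately show ?case using elim C by (auto simp: D_def mult.assoc intro!: mult_left_mono)
  qed
  have BC: "AE p in M. eventually (\<lambda>i. p \<notin> B i) sequentially"
    if B: "\<And>i. B i \<in> events"
      and le: "eventually (\<lambda>i. prob (B i) \<le> C * (\<rho> * (m i + n i) powr (1 / 3)) powr - \<nu>) sequentially" for B
  proof -
    have "summable (\<lambda>i. D * (2 ^ i) powr - (\<nu> / 3))"
      using nu_pos by (intro summable_mult summable_dyadic) auto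
    moreover have "eventually (\<lambda>i. norm (prob (B i)) \<le> D * (2 ^ i) powr - (\<nu> / 3)) sequentially"
      using ev2 le by eventually_elim auto
    ultimately have "summable (\<lambda>i. prob (B i))" by (rule summable_comparison_test_ev[rotated])
    then have "AE p in M. eventually (\<lambda>i. p \<in> space M - B i) sequentially"
      using B by (intro borel_cantelli_AE1) (auto simp: less_top[symmetric])
    then show ?thesis by eventually_elim (auto elim: eventually_mono)
  qed
  {
    assume dir: "eventually (\<lambda>i. (t + \<rho>) * (m i + n i) \<le> m i) sequentially"
    have "AE p in M. eventually (\<lambda>i. p \<notin> {p \<in> space M. H_at t p (z i) (z i + (m i, n i))
        \<le> V_at t p (z i) (z i + (m i, n i))}) sequentially"
    proof (rule BC)
      show "eventually (\<lambda>i. V_prob t (z i) (z i + (m i, n i))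
        \<le> C * (\<rho> * (m i + n i) powr (1 / 3)) powr - \<nu>) sequentially"
        using ev2 dir
        by eventually_elim (use eb t \<rho> in \<open>unfold exit_bounds_def, blast\<close>)
    qed measurable
    then show "AE p in M. eventually (\<lambda>i. V_at t p (z i) (z i + (m i, n i))
        < H_at t p (z i) (z i + (m i, n i))) sequentially"
      using AE_space by eventually_elim (auto simp: not_le elim: eventually_mono)
  }
  {
    assume dir: "eventually (\<lambda>i. m i \<le> (t - \<rho>) * (m i + n i)) sequentially"
    have "AE p in M. eventually (\<lambda>i. p \<notin> {p \<in> space M. V_at t p (z i) (z i + (m i, n i))
        \<le> H_at t p (z i) (z i + (m i, n i))}) sequentially"
    proof (rule BC)
      show "eventually (\<lambda>i. H_prob t (z i) (z i + (m i, n i))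
        \<le> C * (\<rho> * (m i + n i) powr (1 / 3)) powr - \<nu>) sequentially"
        using ev2 dir
        by eventually_elim (use eb t \<rho> in \<open>unfold exit_bounds_def, blast\<close>)
    qed measurable
    then show "AE p in M. eventually (\<lambda>i. H_at t p (z i) (z i + (m i, n i))
        < V_at t p (z i) (z i + (m i, n i))) sequentially"
      using AE_space by eventually_elim (auto simp: not_le elim: eventually_mono)
  }
qed

lemma exit_bounds_near_axis:
  assumes "0 < \<tau>" "\<tau> \<le> 1 / 2"
  obtains \<delta> C R where "exit_bounds \<delta> C R" "0 < \<delta>" "\<delta> < \<tau>"
proof -
  obtain \<delta>\<^sub>0 where \<delta>\<^sub>0: "0 < \<delta>\<^sub>0" "\<forall>\<delta>\<in>{0<..<\<delta>\<^sub>0}. \<exists>C R. exit_bounds \<delta> C R"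
    using exit_bounds_exist by auto
  define \<delta> where "\<delta> = min (\<delta>\<^sub>0 / 2) (\<tau> / 2)"
  have "0 < \<delta>" "\<delta> < \<delta>\<^sub>0" "\<delta> < \<tau>" using assms \<delta>\<^sub>0 by (auto simp: \<delta>_def min_def)
  then obtain C R where "exit_bounds \<delta> C R" using \<delta>\<^sub>0(2) by (meson greaterThanLessThan_iff)
  then show ?thesis using that \<open>0 < \<delta>\<close> \<open>\<delta> < \<tau>\<close> by blast
qed

text \<open>One starting point is enough, with the integer part of
  \<open>(1 - \<tau> / 2) * 2 ^ i\<close> as horizontal displacement: the other admissible ones lie
  to its upper left and have larger vertical increments.\<close>

lemma J_le_increment_near_e1:
  assumes \<tau>: "0 < \<tau>" "\<tau> \<le> 1 / 2"
  shows "AE p in M. eventually (\<lambda>i. \<forall>a. (1 - \<tau> / 2) * 2 ^ i \<le> real_of_int a \<longrightarrow>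
      (x1 - a, x2 - (2 ^ i - a)) \<le> (y1, y2 - 1) \<longrightarrow>
      J (direction (1 - \<tau>)) (y1, y2) p \<le> G p (x1 - a, x2 - (2 ^ i - a)) (y1, y2)
        - G p (x1 - a, x2 - (2 ^ i - a)) (y1, y2 - 1)) sequentially"
proof -
  obtain \<delta> C R where eb: "exit_bounds \<delta> C R" "0 < \<delta>" "\<delta> < \<tau>" using exit_bounds_near_axis[OF \<tau>] .
  define A where "A i = \<lfloor>(1 - \<tau> / 2) * 2 ^ i\<rfloor>" for i :: nat
  define m where "m i = y1 - x1 + A i" for i
  define n where "n i = y2 - x2 + 2 ^ i - A i + 1" for i
  \<comment> \<open>One unit below the starting point, as \<open>J_le_increment\<close>
    requires.\<close>
  define z where "z i = (x1 - A i, x2 - 2 ^ i + A i - 1)" for i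
  define cc where "cc = \<bar>real_of_int (y1 - x1)\<bar> + \<bar>real_of_int (y2 - x2)\<bar> + 5"
  have big: "eventually (\<lambda>i::nat. cc \<le> \<tau> / 8 * 2 ^ i) sequentially"
    using dyadic_floor_bounds(1)[OF \<tau>] .
  have A: "(1 - \<tau> / 2) * 2 ^ i - 1 \<le> A i" "A i \<le> (1 - \<tau> / 2) * 2 ^ i" for i
    using dyadic_floor_bounds(2)[OF \<tau>, of i] by (auto simp: A_def)
  have XA: "A i \<le> 2 ^ i - \<tau> / 2 * 2 ^ i" "2 ^ i - \<tau> / 2 * 2 ^ i - 1 \<le> A i" for i
    using A[of i] by (auto simp: algebra_simps)
  have X\<tau>: "\<tau> / 2 * 2 ^ i \<le> 1 / 4 * 2 ^ i" for i :: nat using \<tau> by (intro mult_right_mono) auto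
  have rm: "real_of_int (m i) = y1 - x1 + A i" "real_of_int (n i) = y2 - x2 + 2 ^ i - A i + 1"
      "real_of_int (m i + n i) = 2 ^ i + (y1 - x1 + y2 - x2 + 1)" for i
    by (auto simp: m_def n_def)
  have cc: "\<bar>real_of_int (y1 - x1)\<bar> \<le> cc - 3" "\<bar>real_of_int (y2 - x2)\<bar> \<le> cc - 3"
      "\<bar>real_of_int (y1 - x1 + y2 - x2 + 1)\<bar> \<le> cc - 3" "3 \<le> cc"
    unfolding cc_def by linarith+
  \<comment> \<open>Directions from these points are about \<open>1 - \<tau> / 2\<close> and exceed
    \<open>1 - \<tau>\<close> by \<open>\<tau> / 2\<close>. Of this, \<open>\<tau> / 8\<close>
    becomes the gap \<open>\<rho>\<close>, and the rest absorbs rounding and the fixed endpoints,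
    both bounded through \<open>cc\<close>.\<close>
  have E: "eventually (\<lambda>i. 1 \<le> m i \<and> 1 \<le> n i \<and> 2 ^ i / 2 \<le> real_of_int (m i + n i)
      \<and> x1 - A i < y1 \<and> x2 - (2 ^ i - A i) < y2 \<and> ((1 - \<tau>) + \<tau> / 8) * (m i + n i) \<le> m i) sequentially"
    using big
  proof eventually_elim
    case (elim i)
    have "1 \<le> real_of_int (m i)" "1 \<le> real_of_int (n i)" "2 ^ i / 2 \<le> real_of_int (m i + n i)"
      "real_of_int (x1 - A i) < y1" "real_of_int (x2 - (2 ^ i - A i)) < y2"
      unfolding rm using cc XA[of i] X\<tau>[of i] elim by (simp_all; linarith)+
    moreover have "((1 - \<tau>) + \<tau> / 8) * (m i + n i) \<le> m i"
    proof -
      have "((1 - \<tau>) + \<tau> / 8) * (m i + n i)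
          = 2 ^ i - 7 * (\<tau> / 8 * 2 ^ i) + (1 - 7 * \<tau> / 8) * (y1 - x1 + y2 - x2 + 1)"
        unfolding rm by (simp add: algebra_simps add_divide_distrib)
      also have "(1 - 7 * \<tau> / 8) * (y1 - x1 + y2 - x2 + 1) \<le> 1 * \<bar>real_of_int (y1 - x1 + y2 - x2 + 1)\<bar>"
        using \<tau> by (intro mult_le_abs) auto
      finally show ?thesis unfolding rm(1) using cc XA[of i] elim by simp
    qed
    ultimately show ?case by linarith
  qed
  have ev: "AE p in M. eventually (\<lambda>i. V_at (1 - \<tau>) p (z i) (z i + (m i, n i))
        < H_at (1 - \<tau>) p (z i) (z i + (m i, n i))) sequentially"
    by (rule exit_eventually(1)[OF eb(1), where \<rho> = "\<tau> / 8"])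
      (use \<tau> eb E in \<open>auto elim: eventually_mono\<close>)
  have zmn: "z i + (m i, n i) = (y1, y2)" for i by (simp add: z_def m_def n_def)
  have "AE p in M. consistent_at (1 - \<tau>) p"
    using \<tau> by (intro consistent) auto
  with ev show ?thesis
  proof eventually_elim
    case (elim p)
    from elim(1) E show ?case
    proof eventually_elim
      case h: (elim i)
      show ?case
      proof (intro allI impI)
        fix a assume a: "(1 - \<tau> / 2) * 2 ^ i \<le> real_of_int a" and le: "(x1 - a, x2 - (2 ^ i - a)) \<le> (y1, y2 - 1)"
        have Aa: "A i \<le> a" using a A(2)[of i] by linarith
        have "J (direction (1 - \<tau>)) (y1, y2) p \<le> G p (x1 - A i, x2 - 2 ^ i + A i) (y1, y2)
            - G p (x1 - A i, x2 - 2 ^ i + A i) (y1, y2 - 1)"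
          using h unfolding zmn
          by (intro J_le_increment[OF elim(2)]) (auto simp: z_def)
        also have "\<dots> \<le> G p (x1 - a, x2 - (2 ^ i - a)) (y1, y2)
            - G p (x1 - a, x2 - (2 ^ i - a)) (y1, y2 - 1)"
          using Aa h le by (intro lpp_increments_mono(1)) auto
        finally show "J (direction (1 - \<tau>)) (y1, y2) p \<le> G p (x1 - a, x2 - (2 ^ i - a)) (y1, y2)
            - G p (x1 - a, x2 - (2 ^ i - a)) (y1, y2 - 1)" .
      qed
    qed
  qed
qed

text \<open>The counterpart at the other axis: a vertical exit in direction \<open>\<tau>\<close>
  bounds \<open>I\<close>, and the starting point moves left by one unit instead of down.\<close>

lemma I_le_increment_near_e2:
  assumes \<tau>: "0 < \<tau>" "\<tau> \<le> 1 / 2"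
  shows "AE p in M. eventually (\<lambda>i. \<forall>b. (1 - \<tau> / 2) * 2 ^ i \<le> real_of_int b \<longrightarrow>
      (x1 - (2 ^ i - b), x2 - b) \<le> (y1 - 1, y2) \<longrightarrow>
      I (direction \<tau>) (y1, y2) p \<le> G p (x1 - (2 ^ i - b), x2 - b) (y1, y2)
        - G p (x1 - (2 ^ i - b), x2 - b) (y1 - 1, y2)) sequentially"
proof -
  obtain \<delta> C R where eb: "exit_bounds \<delta> C R" "0 < \<delta>" "\<delta> < \<tau>" using exit_bounds_near_axis[OF \<tau>] .
  define A where "A i = \<lfloor>(1 - \<tau> / 2) * 2 ^ i\<rfloor>" for i :: nat
  define n where "n i = y2 - x2 + A i" for i
  define m where "m i = y1 - x1 + 2 ^ i - A i + 1" for i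
  define z where "z i = (x1 - 2 ^ i + A i - 1, x2 - A i)" for i
  define cc where "cc = \<bar>real_of_int (y1 - x1)\<bar> + \<bar>real_of_int (y2 - x2)\<bar> + 5"
  have big: "eventually (\<lambda>i::nat. cc \<le> \<tau> / 8 * 2 ^ i) sequentially"
    using dyadic_floor_bounds(1)[OF \<tau>] .
  have A: "(1 - \<tau> / 2) * 2 ^ i - 1 \<le> A i" "A i \<le> (1 - \<tau> / 2) * 2 ^ i" for i
    using dyadic_floor_bounds(2)[OF \<tau>, of i] by (auto simp: A_def)
  have XA: "A i \<le> 2 ^ i - \<tau> / 2 * 2 ^ i" "2 ^ i - \<tau> / 2 * 2 ^ i - 1 \<le> A i" for i
    using A[of i] by (auto simp: algebra_simps)
  have X\<tau>: "\<tau> / 2 * 2 ^ i \<le> 1 / 4 * 2 ^ i" for i :: nat using \<tau> by (intro mult_right_mono) auto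
  have rm: "real_of_int (n i) = y2 - x2 + A i" "real_of_int (m i) = y1 - x1 + 2 ^ i - A i + 1"
      "real_of_int (m i + n i) = 2 ^ i + (y1 - x1 + y2 - x2 + 1)" for i
    by (auto simp: m_def n_def)
  have cc: "\<bar>real_of_int (y1 - x1)\<bar> \<le> cc - 3" "\<bar>real_of_int (y2 - x2)\<bar> \<le> cc - 3"
      "\<bar>real_of_int (y1 - x1 + y2 - x2 + 1)\<bar> \<le> cc - 3" "3 \<le> cc"
    unfolding cc_def by linarith+
  have E: "eventually (\<lambda>i. 1 \<le> m i \<and> 1 \<le> n i \<and> 2 ^ i / 2 \<le> real_of_int (m i + n i)
      \<and> x1 - (2 ^ i - A i) < y1 \<and> x2 - A i < y2 \<and> m i \<le> (\<tau> - \<tau> / 8) * (m i + n i)) sequentially"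
    using big
  proof eventually_elim
    case (elim i)
    have "1 \<le> real_of_int (m i)" "1 \<le> real_of_int (n i)" "2 ^ i / 2 \<le> real_of_int (m i + n i)"
      "real_of_int (x1 - (2 ^ i - A i)) < y1" "real_of_int (x2 - A i) < y2"
      unfolding rm using cc XA[of i] X\<tau>[of i] elim by (simp_all; linarith)+
    moreover have "m i \<le> (\<tau> - \<tau> / 8) * (m i + n i)"
    proof -
      define P where "P = 7 * \<tau> / 8 * (- real_of_int (y1 - x1 + y2 - x2 + 1))"
      have eq: "(\<tau> - \<tau> / 8) * (m i + n i) = 7 * (\<tau> / 8 * 2 ^ i) - P"
        unfolding rm P_def by (simp add: algebra_simps add_divide_distrib)
      have "P \<le> 1 * \<bar>real_of_int (y1 - x1 + y2 - x2 + 1)\<bar>" unfolding P_def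
        by (rule order.trans[OF mult_le_abs], use \<tau> in simp, simp only: abs_minus_cancel)
      then have "P \<le> cc - 3" using cc(3) by simp
      moreover have "real_of_int (m i) = real_of_int (y1 - x1) + 2 ^ i - real_of_int (A i) + 1"
        by (simp add: m_def)
      moreover have "real_of_int (y1 - x1) \<le> cc - 3" using cc(1) by simp
      moreover have "2 ^ i - 4 * (\<tau> / 8 * 2 ^ i) - 1 \<le> real_of_int (A i)" using XA(2)[of i] by simp
      ultimately show ?thesis unfolding eq using elim cc(4) by simp
    qed
    ultimately show ?case by linarith
  qed
  have ev: "AE p in M. eventually (\<lambda>i. H_at \<tau> p (z i) (z i + (m i, n i))
        < V_at \<tau> p (z i) (z i + (m i, n i))) sequentially"
    by (rule exit_eventually(2)[OF eb(1), where \<rho> = "\<tau> / 8"])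
      (use \<tau> eb E in \<open>auto elim: eventually_mono\<close>)
  have zmn: "z i + (m i, n i) = (y1, y2)" for i by (simp add: z_def m_def n_def)
  have "AE p in M. consistent_at \<tau> p"
    using \<tau> by (intro consistent) auto
  with ev show ?thesis
  proof eventually_elim
    case (elim p)
    from elim(1) E show ?case
    proof eventually_elim
      case h: (elim i)
      show ?case
      proof (intro allI impI)
        fix b assume b: "(1 - \<tau> / 2) * 2 ^ i \<le> real_of_int b" and le: "(x1 - (2 ^ i - b), x2 - b) \<le> (y1 - 1, y2)"
        have Ab: "A i \<le> b" using b A(2)[of i] by linarith
        have "I (direction \<tau>) (y1, y2) p \<le> G p (x1 - 2 ^ i + A i, x2 - A i) (y1, y2)
            - G p (x1 - 2 ^ i + A i, x2 - A i) (y1 - 1, y2)"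
          using h unfolding zmn
          by (intro I_le_increment[OF elim(2)]) (auto simp: z_def)
        also have "\<dots> \<le> G p (x1 - (2 ^ i - b), x2 - b) (y1, y2)
            - G p (x1 - (2 ^ i - b), x2 - b) (y1 - 1, y2)"
          using Ab h le by (intro lpp_increments_mono(2)) auto
        finally show "I (direction \<tau>) (y1, y2) p \<le> G p (x1 - (2 ^ i - b), x2 - b) (y1, y2)
            - G p (x1 - (2 ^ i - b), x2 - b) (y1 - 1, y2)" .
      qed
    qed
  qed
qed

end

context iid_env
begin

text \<open>A geodesic stepping up into \<open>(y1, y2)\<close> has increment equal to the weight
  there. For starting points too close to the horizontal axis, this increment would dominate
  \<open>J\<close> in a direction where \<open>J\<close> already exceeds the weight.\<close>

lemma not_asymptotic_to_e1:
  "AE p in M. \<forall>x1 x2 y1 y2 (a :: nat \<Rightarrow> int).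
     eventually (\<lambda>i. (x1 - a i, x2 - (2 ^ i - a i)) \<le> (y1, y2 - 1) \<and>
       G p (x1 - a i, x2 - (2 ^ i - a i)) (y1, y2)
       = G p (x1 - a i, x2 - (2 ^ i - a i)) (y1, y2 - 1) + \<omega> (y1, y2) p) sequentially \<longrightarrow>
     (\<exists>\<epsilon>>0. eventually (\<lambda>i. \<epsilon> * 2 ^ i \<le> real_of_int (2 ^ i - a i)) sequentially)"
proof -
  have "AE p in M. \<forall>(m::nat) x1 x2 y1 y2. eventually (\<lambda>i. \<forall>a. (1 - (1 / (real m + 2)) / 2) * 2 ^ i \<le> real_of_int a \<longrightarrow>
      (x1 - a, x2 - (2 ^ i - a)) \<le> (y1, y2 - 1) \<longrightarrow>
      J (e1_dir m) (y1, y2) p \<le> G p (x1 - a, x2 - (2 ^ i - a)) (y1, y2)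
        - G p (x1 - a, x2 - (2 ^ i - a)) (y1, y2 - 1)) sequentially"
    unfolding AE_all_countable by (intro allI J_le_increment_near_e1) (auto simp: field_simps)
  with J_blow_up show ?thesis
  proof eventually_elim
    case (elim p)
    show ?case
    proof (intro allI impI)
      fix x1 x2 y1 y2 and a :: "nat \<Rightarrow> int"
      assume ev: "eventually (\<lambda>i. (x1 - a i, x2 - (2 ^ i - a i)) \<le> (y1, y2 - 1) \<and>
       G p (x1 - a i, x2 - (2 ^ i - a i)) (y1, y2)
       = G p (x1 - a i, x2 - (2 ^ i - a i)) (y1, y2 - 1) + \<omega> (y1, y2) p) sequentially"
      obtain m where m: "\<omega> (y1, y2) p < J (e1_dir m) (y1, y2) p"
        using elim(1) by blast
      have "eventually (\<lambda>i. (1 / (real m + 2)) / 2 * 2 ^ i \<le> real_of_int (2 ^ i - a i)) sequentially"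
        using elim(2)[rule_format, of m x1 x2 y1 y2] ev
      proof eventually_elim
        case h: (elim i)
        show ?case
        proof (rule ccontr)
          assume "\<not> ?thesis"
          then have "(1 - (1 / (real m + 2)) / 2) * 2 ^ i \<le> real_of_int (a i)" by (simp add: algebra_simps)
          then show False using h(1)[rule_format, of "a i"] h(2) m by auto
        qed
      qed
      then show "\<exists>\<epsilon>>0. eventually (\<lambda>i. \<epsilon> * 2 ^ i \<le> real_of_int (2 ^ i - a i)) sequentially"
        by (intro exI[of _ "(1 / (real m + 2)) / 2"]) auto
    qed
  qed
qed

lemma not_asymptotic_to_e2:
  "AE p in M. \<forall>x1 x2 y1 y2 (b :: nat \<Rightarrow> int).
     eventually (\<lambda>i. (x1 - (2 ^ i - b i), x2 - b i) \<le> (y1 - 1, y2) \<and>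
       G p (x1 - (2 ^ i - b i), x2 - b i) (y1, y2)
       = G p (x1 - (2 ^ i - b i), x2 - b i) (y1 - 1, y2) + \<omega> (y1, y2) p) sequentially \<longrightarrow>
     (\<exists>\<epsilon>>0. eventually (\<lambda>i. \<epsilon> * 2 ^ i \<le> real_of_int (2 ^ i - b i)) sequentially)"
proof -
  have "AE p in M. \<forall>(m::nat) x1 x2 y1 y2. eventually (\<lambda>i. \<forall>b. (1 - (1 / (real m + 2)) / 2) * 2 ^ i \<le> real_of_int b \<longrightarrow>
      (x1 - (2 ^ i - b), x2 - b) \<le> (y1 - 1, y2) \<longrightarrow>
      I (e2_dir m) (y1, y2) p \<le> G p (x1 - (2 ^ i - b), x2 - b) (y1, y2)
        - G p (x1 - (2 ^ i - b), x2 - b) (y1 - 1, y2)) sequentially"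
    unfolding AE_all_countable by (intro allI I_le_increment_near_e2) (auto simp: field_simps)
  with I_blow_up show ?thesis
  proof eventually_elim
    case (elim p)
    show ?case
    proof (intro allI impI)
      fix x1 x2 y1 y2 and b :: "nat \<Rightarrow> int"
      assume ev: "eventually (\<lambda>i. (x1 - (2 ^ i - b i), x2 - b i) \<le> (y1 - 1, y2) \<and>
       G p (x1 - (2 ^ i - b i), x2 - b i) (y1, y2)
       = G p (x1 - (2 ^ i - b i), x2 - b i) (y1 - 1, y2) + \<omega> (y1, y2) p) sequentially"
      obtain m where m: "\<omega> (y1, y2) p < I (e2_dir m) (y1, y2) p"
        using elim(1) by blast
      have "eventually (\<lambda>i. (1 / (real m + 2)) / 2 * 2 ^ i \<le> real_of_int (2 ^ i - b i)) sequentially"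
        using elim(2)[rule_format, of m x1 x2 y1 y2] ev
      proof eventually_elim
        case h: (elim i)
        show ?case
        proof (rule ccontr)
          assume "\<not> ?thesis"
          then have "(1 - (1 / (real m + 2)) / 2) * 2 ^ i \<le> real_of_int (b i)" by (simp add: algebra_simps)
          then show False using h(1)[rule_format, of "b i"] h(2) m by auto
        qed
      qed
      then show "\<exists>\<epsilon>>0. eventually (\<lambda>i. \<epsilon> * 2 ^ i \<le> real_of_int (2 ^ i - b i)) sequentially"
        by (intro exI[of _ "(1 / (real m + 2)) / 2"]) auto
    qed
  qed
qed

end

section \<open>Crossing an edge at a given scale\<close>

text \<open>The parameter is the horizontal displacement from the origin; exactly opposite points
  have equal parameters.\<close>

definition south_west :: "nat \<Rightarrow> int \<Rightarrow> site" where
  "south_west N a = (- a, - (int N - a))"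

definition north_east :: "nat \<Rightarrow> int \<Rightarrow> site" where
  "north_east N b = (b, int N - b)"

text \<open>The equality says that a geodesic passes through the origin, whose weight would
  otherwise be counted twice. The gap \<open>5 * L\<close> leaves room for an intermediate direction
  at the distance of a full block from the relevant ones.\<close>

definition deviates :: "(site \<Rightarrow> real) \<Rightarrow> nat \<Rightarrow> int \<Rightarrow> real \<Rightarrow> bool" where
  "deviates w N L \<delta> \<longleftrightarrow> (\<exists>a b. \<delta> * N \<le> a \<and> a + 5 * L \<le> b \<and> b \<le> (1 - \<delta>) * N \<and>
     lpp w (south_west N a) (north_east N b) =
     lpp w (south_west N a) (0, 0) + lpp w (0, 0) (north_east N b) - w (0, 0))"

text \<open>
  Up to constants, \<open>crit N L\<close> is the ratio of the directional window \<open>L / N\<close> of a block to the natural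
  directional fluctuation \<open>N\<close> to the power \<open>- 1/3\<close>.
\<close>

definition crit :: "nat \<Rightarrow> int \<Rightarrow> real" where
  "crit N L = L / (2 * real N) * (real N / 2) powr (1 / 3)"

section \<open>Endpoints that are far from opposite\<close>

context boundary_env
begin

text \<open>Half a block, \<open>L / (2 * N)\<close>, serves as the angular gap
  \<open>\<rho>\<close>; the callers have a full block and spend the other half on rounding and on
  shifts of endpoints.\<close>

lemma exit_bounds_crit:
  fixes t \<delta> :: real and m n L :: int and N :: nat
  assumes eb: "exit_bounds \<delta> C R" and t: "\<delta> < t" "t < 1 - \<delta>" and mn: "1 \<le> m" "1 \<le> n"
    and N: "N / 2 \<le> real_of_int (m + n)" "R \<le> N / 2" "0 < N" and L: "0 < L" "R \<le> crit N L"
  shows "(t + L / (2 * real N)) * (m + n) \<le> m \<Longrightarrow>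
        V_prob t x (x + (m, n)) \<le> C * crit N L powr - \<nu>"
    and "m \<le> (t - L / (2 * real N)) * (m + n) \<Longrightarrow>
        H_prob t x (x + (m, n)) \<le> C * crit N L powr - \<nu>"
proof -
  define \<rho> where "\<rho> = real_of_int L / (2 * real N)"
  have \<rho>: "0 < \<rho>" using N L by (simp add: \<rho>_def)
  have R: "0 < R" "0 < C" using eb by (auto simp: exit_bounds_def)
  have "(real N / 2) powr (1 / 3) \<le> real_of_int (m + n) powr (1 / 3)"
    using N by (intro powr_mono2) auto
  then have le: "crit N L \<le> \<rho> * real_of_int (m + n) powr (1 / 3)"
    unfolding crit_def \<rho>_def[symmetric] using \<rho> by (intro mult_left_mono) auto
  then have "(\<rho> * real_of_int (m + n) powr (1 / 3)) powr - \<nu> \<le> crit N L powr - \<nu>"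
    using R L nu_pos by (intro powr_mono2') auto
  then have b: "C * (\<rho> * real_of_int (m + n) powr (1 / 3)) powr - \<nu> \<le> C * crit N L powr - \<nu>"
    using R by (intro mult_left_mono) auto
  have c: "R \<le> real_of_int (m + n)" "R \<le> \<rho> * real_of_int (m + n) powr (1 / 3)"
    using N le L by auto
  show "(t + L / (2 * real N)) * (m + n) \<le> m \<Longrightarrow>
        V_prob t x (x + (m, n)) \<le> C * crit N L powr - \<nu>"
    using eb t mn \<rho> c unfolding exit_bounds_def \<rho>_def[symmetric] by (blast intro: order.trans[OF _ b])
  show "m \<le> (t - L / (2 * real N)) * (m + n) \<Longrightarrow>
        H_prob t x (x + (m, n)) \<le> C * crit N L powr - \<nu>"
    using eb t mn \<rho> c unfolding exit_bounds_def \<rho>_def[symmetric] by (blast intro: order.trans[OF _ b])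
qed

lemma deviation_block:
  fixes t L :: int and N :: nat and \<delta> :: real
  assumes eb: "exit_bounds \<delta> C R" and \<delta>: "0 < \<delta>" and t: "0 \<le> t" "\<delta> * N < (t + 4) * L" "(t + 5) * L \<le> (1 - \<delta>) * N"
    and N: "R \<le> N / 2" and L: "4 \<le> L" "R \<le> crit N L"
  obtains B where "B \<in> events" "prob B \<le> 2 * (C * crit N L powr - \<nu>)"
    "AE p in M. p \<notin> B \<longrightarrow> (\<forall>a b. 0 \<le> a \<longrightarrow> a \<le> (t + 1) * L \<longrightarrow> (t + 5) * L \<le> b \<longrightarrow> b \<le> int N \<longrightarrow>
       G p (south_west N a) (north_east N b) \<noteq>
       G p (south_west N a) (0, 0) + G p (0, 0) (north_east N b) - \<omega> (0, 0) p)"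
proof -
  \<comment> \<open>With \<open>f = (t + 1) * L\<close> and \<open>c = (t + 5) * L\<close>, the
    direction from the origin to \<open>(c, e)\<close> is \<open>(f + 4 * L) / N\<close>, while from
    the south-west point it is about \<open>(f + 2 * L) / N\<close>. The value
    \<open>(f + 3 * L) / N\<close> chosen here is one block away from both.\<close>
  define \<xi> where "\<xi> = real_of_int ((t + 4) * L) / N"
  define c where "c = (t + 5) * L"
  define e where "e = int N - c"
  define f where "f = (t + 1) * L"
  have cf: "c = f + 4 * L" "real_of_int ((t + 4) * L) = c - L" by (auto simp: c_def f_def algebra_simps)
  have f0: "1 \<le> f" using t L by (simp add: f_def) (metis add_increasing2 int_one_le_iff_zero_less mult_pos_pos zero_less_one order.strict_trans2 zero_less_numeral add_pos_nonneg add.commute)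
  have Npos: "0 < real N"
  proof -
    have "0 < R" using eb by (simp add: exit_bounds_def)
    then show ?thesis using N by linarith
  qed
  have cN: "real_of_int c < N"
  proof -
    have "real_of_int c \<le> (1 - \<delta>) * N" using t(3) by (simp add: c_def)
    also have "\<dots> < N" using \<delta> Npos by (simp add: algebra_simps)
    finally show ?thesis .
  qed
  then have cN': "c < int N" by linarith
  have \<xi>N: "\<xi> * N = c - L" using Npos cf by (simp add: \<xi>_def)
  have \<xi>: "\<delta> < \<xi>" "\<xi> < 1 - \<delta>"
  proof -
    show "\<delta> < \<xi>" using t(2) Npos by (simp add: \<xi>_def pos_less_divide_eq)
    have "real_of_int ((t + 4) * L) < (1 - \<delta>) * N" using t(3) L unfolding cf(2) c_def by simp
    then show "\<xi> < 1 - \<delta>" using Npos by (simp add: \<xi>_def pos_divide_less_eq)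
  qed
  define h where "h = real_of_int L / (2 * real N)"
  have hN: "h * N = L / 2" using Npos by (simp add: h_def)
  \<comment> \<open>The starting points used below are displaced by one unit, which changes lengths
    by one; these bounds keep the resulting error small compared with \<open>L\<close>.\<close>
  have h: "0 < h" "h \<le> 1" "h \<le> \<xi>"
  proof -
    show "0 < h" using L Npos by (simp add: h_def)
    have "L \<le> N" using cN' cf f0 L by linarith
    then show "h \<le> 1" using Npos L by (simp add: h_def)
    have "h * N \<le> \<xi> * N" unfolding hN \<xi>N using cf f0 L by simp
    then show "h \<le> \<xi>" using Npos by simp
  qed
  note [measurable] = I_dir_meas[of \<xi>] J_dir_meas[of \<xi>]
  have \<xi>01: "0 < \<xi>" "\<xi> < 1" using \<xi> \<delta> by auto
  \<comment> \<open>\<open>B1\<close> and \<open>B2\<close> are the events on which the assumptions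
    \<open>Hu\<close> and \<open>Vo\<close> of \<open>right_deviation\<close> fail.\<close>
  define B1 where "B1 = {p \<in> space M. H_at \<xi> p (0, - 1) ((0, - 1) + (c, e + 1))
     \<le> V_at \<xi> p (0, - 1) ((0, - 1) + (c, e + 1))}"
  define B2 where "B2 = {p \<in> space M. V_at \<xi> p (- f - 1, - (int N - f)) ((- f - 1, - (int N - f)) + (c + f + 1, e + (int N - f)))
     \<le> H_at \<xi> p (- f - 1, - (int N - f)) ((- f - 1, - (int N - f)) + (c + f + 1, e + (int N - f)))}"
  have [measurable]: "B1 \<in> events" "B2 \<in> events" using \<xi>01 unfolding B1_def B2_def by measurable
  have p1: "prob B1 \<le> C * crit N L powr - \<nu>"
    unfolding B1_def
  proof (rule exit_bounds_crit(1)[OF eb \<xi>])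
    have s: "real_of_int (c + (e + 1)) = N + 1" by (simp add: e_def)
    have "(\<xi> + h) * (N + 1) = \<xi> * N + h * N + (\<xi> + h)" by (simp add: algebra_simps)
    also have "\<dots> \<le> c" unfolding \<xi>N hN using h \<xi>01 L by simp
    finally show "(\<xi> + L / (2 * real N)) * (c + (e + 1)) \<le> c" unfolding s h_def by simp
  qed (use f0 cf L cN' N Npos in \<open>auto simp: e_def\<close>)
  have p2: "prob B2 \<le> C * crit N L powr - \<nu>"
    unfolding B2_def
  proof (rule exit_bounds_crit(2)[OF eb \<xi>])
    have s: "real_of_int (c + f + 1 + (e + (int N - f))) = 2 * N + 1" by (simp add: e_def)
    have "(\<xi> - h) * (2 * N + 1) = 2 * (\<xi> * N) - 2 * (h * N) + (\<xi> - h)" by (simp add: algebra_simps)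
    also have "\<dots> \<ge> c + f + 1" unfolding \<xi>N hN using h cf L by simp
    finally show "c + f + 1 \<le> (\<xi> - L / (2 * real N)) * (c + f + 1 + (e + (int N - f)))" unfolding s h_def by simp
  qed (use f0 cf L cN' N Npos in \<open>auto simp: e_def\<close>)
  have "AE p in M. consistent_at \<xi> p"
    using \<xi>01 by (intro consistent) auto
  then have "AE p in M. p \<notin> B1 \<union> B2 \<longrightarrow> (\<forall>a b. 0 \<le> a \<longrightarrow> a \<le> (t + 1) * L \<longrightarrow> (t + 5) * L \<le> b \<longrightarrow> b \<le> int N \<longrightarrow>
       G p (south_west N a) (north_east N b) \<noteq>
       G p (south_west N a) (0, 0) + G p (0, 0) (north_east N b) - \<omega> (0, 0) p)"
    using AE_space
  proof eventually_elim
    case (elim p)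
    show ?case
    proof (intro impI allI)
      fix a b assume p: "p \<notin> B1 \<union> B2" and a: "0 \<le> a" "a \<le> (t + 1) * L" and b: "(t + 5) * L \<le> b" "b \<le> int N"
      have "G p (- a, - (int N - a)) (0, 0) + G p (0, 0) (b, int N - b) - \<omega> (0, 0) p
          < G p (- a, - (int N - a)) (b, int N - b)"
      proof (rule right_deviation[OF elim(1)])
        have z: "(0, - 1) + (c, e + 1) = (c, e)"
          "(- f - 1, - (int N - f)) + (c + f + 1, e + (int N - f)) = (c, e)" by simp_all
        show "V_at \<xi> p (0, - 1) (c, e)
            < H_at \<xi> p (0, - 1) (c, e)"
          using p elim(2) unfolding B1_def z by (simp add: not_le)
        show "H_at \<xi> p (- f - 1, - (int N - f)) (c, e)
            < V_at \<xi> p (- f - 1, - (int N - f)) (c, e)"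
          using p elim(2) unfolding B2_def z by (simp add: not_le)
      qed (use a b f0 cf L cN' in \<open>auto simp: c_def[symmetric] f_def[symmetric] e_def\<close>)
      then show "G p (south_west N a) (north_east N b) \<noteq>
       G p (south_west N a) (0, 0) + G p (0, 0) (north_east N b) - \<omega> (0, 0) p"
        by (simp add: south_west_def north_east_def)
    qed
  qed
  moreover have "prob (B1 \<union> B2) \<le> 2 * (C * crit N L powr - \<nu>)"
    using p1 p2 measure_Un_le[of B1 M B2] by simp
  ultimately show ?thesis using that[of "B1 \<union> B2"] by auto
qed

lemma pred_deviates:
  assumes [measurable]: "\<And>v. W v \<in> borel_measurable Z"
  shows "Measurable.pred Z (\<lambda>p. deviates (\<lambda>v. W v p) N L \<delta>)"
  unfolding deviates_def by measurable

lemma card_blocks: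
  fixes L :: int and N :: nat
  assumes "0 < L" "T \<subseteq> {0..int N div L}"
  shows "finite T" "real (card T) \<le> N / L + 1"
proof -
  show "finite T" using assms(2) finite_subset by blast
  have "card T \<le> card {0..int N div L}" using assms(2) by (intro card_mono) auto
  then have "real (card T) \<le> real_of_int (int N div L) + 1"
    using assms(1) pos_imp_zdiv_nonneg_iff[of L "int N"] by simp
  also have "real_of_int (int N div L) \<le> real_of_int (int N) / real_of_int L"
    by (rule real_of_int_div4)
  finally show "real (card T) \<le> N / L + 1" by simp
qed

text \<open>The block estimate holds for all \<open>b\<close> beyond the gap at once, so the union
  runs over the block of \<open>a\<close> only.\<close>

lemma deviation_prob:
  fixes L :: int and N :: nat and \<delta> :: real
  assumes eb: "exit_bounds \<delta> C R" and \<delta>: "0 < \<delta>" and N: "R \<le> N / 2" and L: "4 \<le> L" "R \<le> crit N L"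
  shows "prob {p \<in> space M. deviates (\<lambda>v. \<omega> v p) N L \<delta>} \<le> (N / L + 1) * (2 * (C * crit N L powr - \<nu>))"
proof -
  define T where "T = {t \<in> {0..int N div L}. \<delta> * N < (t + 4) * L \<and> (t + 5) * L \<le> (1 - \<delta>) * real N}"
  define good where "good B t \<longleftrightarrow> B \<in> events \<and> prob B \<le> 2 * (C * crit N L powr - \<nu>) \<and>
    (AE p in M. p \<notin> B \<longrightarrow> (\<forall>a b. 0 \<le> a \<longrightarrow> a \<le> (t + 1) * L \<longrightarrow> (t + 5) * L \<le> b \<longrightarrow> b \<le> int N \<longrightarrow>
       G p (south_west N a) (north_east N b) \<noteq>
       G p (south_west N a) (0, 0) + G p (0, 0) (north_east N b) - \<omega> (0, 0) p))" for B t
  have "\<exists>B. good B t" if "t \<in> T" for t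
  proof -
    from that have t: "0 \<le> t" "\<delta> * N < (t + 4) * L" "(t + 5) * L \<le> (1 - \<delta>) * real N" by (auto simp: T_def)
    show ?thesis by (rule deviation_block[OF eb \<delta> t N L]) (auto simp: good_def)
  qed
  then obtain B where B: "\<And>t. t \<in> T \<Longrightarrow> good (B t) t" by metis
  have "T \<subseteq> {0..int N div L}" by (auto simp: T_def)
  then have T: "finite T" "real (card T) \<le> N / L + 1"
    using card_blocks[of L T N] L(1) by simp_all
  have ev: "(\<Union>t\<in>T. B t) \<in> events" using T B by (auto simp: good_def)
  have "prob {p \<in> space M. deviates (\<lambda>v. \<omega> v p) N L \<delta>} \<le> prob (\<Union>t\<in>T. B t)"
  proof (rule finite_measure_mono_AE[OF _ ev])
    have "AE p in M. \<forall>t\<in>T. p \<notin> B t \<longrightarrow> (\<forall>a b. 0 \<le> a \<longrightarrow> a \<le> (t + 1) * L \<longrightarrow> (t + 5) * L \<le> b \<longrightarrow> b \<le> int N \<longrightarrow>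
       G p (south_west N a) (north_east N b) \<noteq>
       G p (south_west N a) (0, 0) + G p (0, 0) (north_east N b) - \<omega> (0, 0) p)"
      using B T by (intro AE_finite_allI) (auto simp: good_def)
    then show "AE p in M. p \<in> {p \<in> space M. deviates (\<lambda>v. \<omega> v p) N L \<delta>} \<longrightarrow> p \<in> (\<Union>t\<in>T. B t)"
    proof eventually_elim
      case (elim p)
      show ?case
      proof
        assume "p \<in> {p \<in> space M. deviates (\<lambda>v. \<omega> v p) N L \<delta>}"
        then obtain a b where ab: "\<delta> * N \<le> a" "a + 5 * L \<le> b" "b \<le> (1 - \<delta>) * real N"
          and eq: "G p (south_west N a) (north_east N b) =
            G p (south_west N a) (0, 0) + G p (0, 0) (north_east N b) - \<omega> (0, 0) p"
          by (auto simp: deviates_def)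
        define t where "t = a div L"
        have tL: "t * L \<le> a" "a < (t + 1) * L"
          using L by (auto simp: t_def algebra_simps) (smt (verit) minus_mod_eq_mult_div pos_mod_sign pos_mod_bound mult.commute)+
        have "0 \<le> \<delta> * real N" "(1 - \<delta>) * real N \<le> 1 * real N"
          using \<delta> by (simp, intro mult_right_mono) auto
        then have a0: "0 \<le> a" and bN: "b \<le> int N" using ab by linarith+
        have b5: "(t + 5) * L \<le> b" using tL ab by (simp add: algebra_simps)
        have "t \<in> T"
          unfolding T_def
        proof (intro CollectI conjI)
          have "0 \<le> t" using a0 L by (simp add: t_def pos_imp_zdiv_nonneg_iff)
          moreover have "t \<le> int N div L" unfolding t_def using ab(2) bN L by (intro zdiv_mono1) auto
          ultimately show "t \<in> {0..int N div L}" by simp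
          have "a < (t + 4) * L" using tL(2) L by (simp add: algebra_simps)
          then have "real_of_int a < real_of_int ((t + 4) * L)" by (simp only: of_int_less_iff)
          then show "\<delta> * N < (t + 4) * L" using ab(1) by linarith
          show "(t + 5) * L \<le> (1 - \<delta>) * real N" using b5 ab(3) by linarith
        qed
        moreover have "p \<in> B t"
          using elim[rule_format, OF \<open>t \<in> T\<close>] a0 tL b5 bN eq by (metis less_imp_le)
        ultimately show "p \<in> (\<Union>t\<in>T. B t)" by blast
      qed
    qed
  qed
  also have "\<dots> \<le> (\<Sum>t\<in>T. prob (B t))"
    using T B by (intro measure_UNION_le) (auto simp: good_def)
  also have "\<dots> \<le> real (card T) * (2 * (C * crit N L powr - \<nu>))"
    using B by (intro sum_bounded_above) (auto simp: good_def)
  also have "\<dots> \<le> (N / L + 1) * (2 * (C * crit N L powr - \<nu>))"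
    using T(2) eb by (intro mult_right_mono) (auto simp: exit_bounds_def)
  finally show ?thesis .
qed

section \<open>Nearly opposite endpoints and the random walk\<close>

text \<open>The two extreme starting points of the window, each one block away from a bounding
  direction, control all others by comparison of increments. The end points are moved by up to
  \<open>K + 1\<close> in height, which \<open>2 * K + 4 \<le> L\<close> keeps within the half block
  in reserve. Column \<open>- 1\<close> occurs because it is the reflection of column
  \<open>1\<close>.\<close>

lemma near_block:
  fixes s L K c :: int and N :: nat and \<delta> :: real
  assumes eb: "exit_bounds \<delta> C R" and \<delta>: "0 < \<delta>"
    and s: "\<delta> < (s - 1) * L / N" "(s + 8) * L / N < 1 - \<delta>"
    and N: "R \<le> N / 2" and L: "R \<le> crit N L" and K: "0 \<le> K" "2 * K + 4 \<le> L" and c: "c = 0 \<or> c = - 1"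
  obtains B where "B \<in> events" "prob B \<le> 2 * (C * crit N L powr - \<nu>)"
    "AE p in M. p \<notin> B \<longrightarrow> (\<forall>a j. s * L \<le> a \<longrightarrow> a \<le> (s + 7) * L \<longrightarrow> - K \<le> j \<longrightarrow> j \<le> K \<longrightarrow>
       J (direction ((s - 1) * L / N)) (c, j) p
         \<le> G p (south_west N a) (c, j) - G p (south_west N a) (c, j - 1) \<and>
       G p (south_west N a) (c, j) - G p (south_west N a) (c, j - 1)
         \<le> J (direction ((s + 8) * L / N)) (c, j) p)"
proof -
  define lo where "lo = (s - 1) * L / real N"
  define hi where "hi = (s + 8) * L / real N"
  define q where "q = s * L"
  have q7: "(s + 7) * L = q + 7 * L" by (simp add: q_def algebra_simps)
  have Npos: "0 < real N"
  proof -
    have "0 < R" using eb by (simp add: exit_bounds_def)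
    then show ?thesis using N by linarith
  qed
  have "lo * N = real_of_int ((s - 1) * L)" "hi * N = real_of_int ((s + 8) * L)"
    using Npos by (simp_all add: lo_def hi_def)
  then have loN: "lo * N = q - L" and hiN: "hi * N = q + 8 * L"
    by (simp_all add: q_def algebra_simps)
  have lohi: "\<delta> < lo" "hi < 1 - \<delta>" using s by (simp_all add: lo_def hi_def)
  have Lpos: "4 \<le> L" using K by simp
  define h where "h = real_of_int L / (2 * real N)"
  have hN: "h * N = L / 2" using Npos by (simp add: h_def)
  have lohi': "lo + 18 * h = hi" "0 < h"
    using Npos Lpos by (simp_all add: lo_def hi_def h_def field_simps)
  have qL: "L < q"
  proof -
    have "0 < lo * N" using lohi \<delta> Npos by simp
    then show ?thesis unfolding loN by simp
  qed
  have qN: "q + 8 * L < int N"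
  proof -
    have "hi * real N < 1 * real N" using lohi \<delta> Npos by (intro mult_strict_right_mono) auto
    then show ?thesis unfolding hiN by linarith
  qed
  note [measurable] = I_dir_meas J_dir_meas
  have lo01: "0 < lo" "lo < 1" "\<delta> < lo" "lo < 1 - \<delta>" and hi01: "0 < hi" "hi < 1" "\<delta> < hi" "hi < 1 - \<delta>"
    using lohi lohi' \<delta> by auto
  define B1 where "B1 = {p \<in> space M. H_at lo p (- q, - (int N - q) - 1) ((- q, - (int N - q) - 1) + (q + c, int N - q + 1 + K))
     \<le> V_at lo p (- q, - (int N - q) - 1) ((- q, - (int N - q) - 1) + (q + c, int N - q + 1 + K))}"
  define f where "f = q + 7 * L"
  define B2 where "B2 = {p \<in> space M. V_at hi p (- f - 1, - (int N - f)) ((- f - 1, - (int N - f)) + (c + f + 1, int N - f - K - 1))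
     \<le> H_at hi p (- f - 1, - (int N - f)) ((- f - 1, - (int N - f)) + (c + f + 1, int N - f - K - 1))}"
  have [measurable]: "B1 \<in> events" "B2 \<in> events" using lo01 hi01 unfolding B1_def B2_def by measurable
  have p1: "prob B1 \<le> C * crit N L powr - \<nu>"
    unfolding B1_def
  proof (rule exit_bounds_crit(1)[OF eb lo01(3,4)])
    have e: "real_of_int (q + c + (int N - q + 1 + K)) = N + (c + 1 + K)" by simp
    have "(lo + h) * (c + 1 + K) \<le> 1 * real_of_int (c + 1 + K)"
      using lohi lohi' lo01 hi01 c K by (intro mult_right_mono) auto
    then have "(lo + h) * (N + (c + 1 + K)) \<le> (q - L) + L / 2 + (c + 1 + K)"
      using loN hN by (simp add: algebra_simps)
    also have "\<dots> \<le> q + c" using K by simp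
    finally show "(lo + L / (2 * real N)) * (q + c + (int N - q + 1 + K)) \<le> q + c" unfolding e h_def by simp
  qed (use qL qN Lpos K c N L Npos in auto)
  have p2: "prob B2 \<le> C * crit N L powr - \<nu>"
    unfolding B2_def
  proof (rule exit_bounds_crit(2)[OF eb hi01(3,4)])
    have e: "real_of_int (c + f + 1 + (int N - f - K - 1)) = N - (K - c)" by simp
    have "(hi - h) * (K - c) \<le> 1 * real_of_int (K - c)"
      using lohi lohi' lo01 hi01 c K by (intro mult_right_mono) auto
    then have "(q + 8 * L) - L / 2 - (K - c) \<le> (hi - h) * (N - (K - c))"
      using hiN hN by (simp add: algebra_simps)
    moreover have "c + f + 1 \<le> (q + 8 * L) - L / 2 - (K - c)" using K by (simp add: f_def)
    ultimately show "c + f + 1 \<le> (hi - L / (2 * real N)) * (c + f + 1 + (int N - f - K - 1))" unfolding e h_def by simp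
  qed (use qL qN Lpos K c N L Npos in \<open>auto simp: f_def\<close>)
  have "AE p in M. consistent_at lo p"
    "AE p in M. consistent_at hi p"
    using lo01 hi01 by (auto intro!: consistent)
  then have "AE p in M. p \<notin> B1 \<union> B2 \<longrightarrow> (\<forall>a j. s * L \<le> a \<longrightarrow> a \<le> (s + 7) * L \<longrightarrow> - K \<le> j \<longrightarrow> j \<le> K \<longrightarrow>
       J (direction lo) (c, j) p
         \<le> G p (south_west N a) (c, j) - G p (south_west N a) (c, j - 1) \<and>
       G p (south_west N a) (c, j) - G p (south_west N a) (c, j - 1)
         \<le> J (direction hi) (c, j) p)"
    using AE_space
  proof eventually_elim
    case (elim p)
    show ?case
    proof (intro impI allI)
      fix a j assume p: "p \<notin> B1 \<union> B2" and a: "s * L \<le> a" "a \<le> (s + 7) * L" and j: "- K \<le> j" "j \<le> K"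
      have a': "q \<le> a" "a \<le> q + 7 * L" using a q7 by (auto simp: q_def)
      let ?w = "\<lambda>v. \<omega> v p"
      \<comment> \<open>A horizontal exit at the greatest height \<open>K\<close> implies one at
        every lower height, so the single event \<open>B1\<close> covers the whole column.\<close>
      have H: "V_at lo p (- q, - (int N - q) - 1) (c, j)
          \<le> H_at lo p (- q, - (int N - q) - 1) (c, j)"
      proof (rule H_exit_down)
        have z: "(- q, - (int N - q) - 1) + (q + c, int N - q + 1 + K) = (c, K)" by simp
        show "V_at lo p (- q, - (int N - q) - 1) (c, K)
            \<le> H_at lo p (- q, - (int N - q) - 1) (c, K)"
          using p elim(3) unfolding B1_def z by (simp add: not_le)
      qed (use qL qN Lpos K c j in auto)
      have 1: "J (direction lo) (c, j) p
          \<le> lpp ?w (- q, - (int N - q)) (c, j) - lpp ?w (- q, - (int N - q)) (c, j - 1)"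
        by (rule J_le_increment[OF elim(1) _ _ H]) (use qL qN Lpos K c j in auto)
      have 2: "lpp ?w (- q, - (int N - q)) (c, j) - lpp ?w (- q, - (int N - q)) (c, j - 1)
          \<le> lpp ?w (- a, - (int N - a)) (c, j) - lpp ?w (- a, - (int N - a)) (c, j - 1)"
        by (rule lpp_increments_mono(1)) (use a' qL qN Lpos K c j in auto)
      \<comment> \<open>Symmetrically the lowest height decides; it is \<open>- K - 1\<close>
        because \<open>increment_le_J\<close> tests the exit at \<open>j - 1\<close>.\<close>
      have V: "H_at hi p (- f - 1, - (int N - f)) (c, j - 1)
          \<le> V_at hi p (- f - 1, - (int N - f)) (c, j - 1)"
      proof (rule V_exit_up)
        have z: "(- f - 1, - (int N - f)) + (c + f + 1, int N - f - K - 1) = (c, - K - 1)" by simp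
        show "H_at hi p (- f - 1, - (int N - f)) (c, - K - 1)
            \<le> V_at hi p (- f - 1, - (int N - f)) (c, - K - 1)"
          using p elim(3) unfolding B2_def z by (simp add: not_le)
      qed (use qL qN Lpos K c j in \<open>auto simp: f_def\<close>)
      have 3: "lpp ?w (- f, - (int N - f)) (c, j) - lpp ?w (- f, - (int N - f)) (c, j - 1) \<le> J (direction hi) (c, j) p"
        by (rule increment_le_J[OF elim(2) _ _ V]) (use qL qN Lpos K c j in \<open>auto simp: f_def\<close>)
      have 4: "lpp ?w (- a, - (int N - a)) (c, j) - lpp ?w (- a, - (int N - a)) (c, j - 1)
          \<le> lpp ?w (- f, - (int N - f)) (c, j) - lpp ?w (- f, - (int N - f)) (c, j - 1)"
        by (rule lpp_increments_mono(1)) (use a' qL qN Lpos K c j in \<open>auto simp: f_def\<close>)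
      show "J (direction lo) (c, j) p
         \<le> lpp ?w (south_west N a) (c, j) - lpp ?w (south_west N a) (c, j - 1) \<and>
       lpp ?w (south_west N a) (c, j) - lpp ?w (south_west N a) (c, j - 1)
         \<le> J (direction hi) (c, j) p"
        unfolding south_west_def using 1 2 3 4 by linarith
    qed
  qed
  moreover have "prob (B1 \<union> B2) \<le> 2 * (C * crit N L powr - \<nu>)"
    using p1 p2 measure_Un_le[of B1 M B2] by simp
  ultimately show ?thesis using that[of "B1 \<union> B2"] unfolding lo_def hi_def by auto
qed

end

lemma int_sum_last':
  "k < (n::int) \<Longrightarrow> (\<Sum>i=k + 1..n. f i) = (\<Sum>i=k + 1..n - 1. f i) + (f n :: real)"
proof -
  assume "k < n"
  then have "{k + 1..n} = insert n {k + 1..n - 1}" by auto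
  then show ?thesis by simp
qed

text \<open>The function \<open>\<Phi>\<close> is the best weight of a path that moves from column
  \<open>0\<close> to column \<open>1\<close> at height \<open>j\<close>; by \<open>eq\<close> it is
  maximal at \<open>0\<close>. In both directions \<open>\<Phi> k - \<Phi> 0\<close> bounds the walk
  from above.\<close>

lemma walk_nonpositive:
  fixes J\<^sub>1 J\<^sub>2 :: "int \<Rightarrow> real" and a b K k :: int and N :: nat
  assumes ab: "0 \<le> a" "1 \<le> b" "a + K \<le> N" "b + K \<le> N"
    and eq: "lpp w (south_west N a) (north_east N b) =
      lpp w (south_west N a) (0, 0) + lpp w (1, 0) (north_east N b)"
  shows "\<lbrakk>0 < k; k \<le> K;
      \<And>j. 0 < j \<Longrightarrow> j \<le> k \<Longrightarrow> J\<^sub>1 j \<le> lpp w (south_west N a) (0, j) - lpp w (south_west N a) (0, j - 1);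
      \<And>j. 0 < j \<Longrightarrow> j \<le> k \<Longrightarrow> lpp w (1, j - 1) (north_east N b) - lpp w (1, j) (north_east N b) \<le> J\<^sub>2 j\<rbrakk>
    \<Longrightarrow> (\<Sum>j=1..k. J\<^sub>1 j - J\<^sub>2 j) \<le> 0"
    and "\<lbrakk>k < 0; - K \<le> k;
      \<And>j. k < j \<Longrightarrow> j \<le> 0 \<Longrightarrow> lpp w (south_west N a) (0, j) - lpp w (south_west N a) (0, j - 1) \<le> J\<^sub>1 j;
      \<And>j. k < j \<Longrightarrow> j \<le> 0 \<Longrightarrow> J\<^sub>2 j \<le> lpp w (1, j - 1) (north_east N b) - lpp w (1, j) (north_east N b)\<rbrakk>
    \<Longrightarrow> - (\<Sum>j=k + 1..0. J\<^sub>1 j - J\<^sub>2 j) \<le> 0"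
proof -
  define \<Phi> where "\<Phi> j = lpp w (south_west N a) (0, j) + lpp w (1, j) (north_east N b)" for j
  have \<Phi>: "\<Phi> k \<le> \<Phi> 0" if "- K \<le> k" "k \<le> K"
  proof -
    have "\<Phi> k \<le> lpp w (south_west N a) (north_east N b)"
      unfolding \<Phi>_def using that ab
      by (intro lpp_concat) (auto simp: south_west_def north_east_def up_right_step_def)
    then show ?thesis using eq by (simp add: \<Phi>_def)
  qed
  {
    assume k: "0 < k" "k \<le> K"
      and 1: "\<And>j. 0 < j \<Longrightarrow> j \<le> k \<Longrightarrow> J\<^sub>1 j \<le> lpp w (south_west N a) (0, j) - lpp w (south_west N a) (0, j - 1)"
      and 2: "\<And>j. 0 < j \<Longrightarrow> j \<le> k \<Longrightarrow> lpp w (1, j - 1) (north_east N b) - lpp w (1, j) (north_east N b) \<le> J\<^sub>2 j"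
    have "(\<Sum>j=1..k. J\<^sub>1 j - J\<^sub>2 j) - (\<Sum>j=1..0. J\<^sub>1 j - J\<^sub>2 j) \<le> \<Phi> k - \<Phi> 0"
    proof (rule telescope_le)
      fix i :: int assume i: "0 < i" "i \<le> k"
      have "(\<Sum>j=1..i. J\<^sub>1 j - J\<^sub>2 j) - (\<Sum>j=1..i - 1. J\<^sub>1 j - J\<^sub>2 j) = J\<^sub>1 i - J\<^sub>2 i"
        using int_sum_last[of i "\<lambda>j. J\<^sub>1 j - J\<^sub>2 j"] i by simp
      then show "(\<Sum>j=1..i. J\<^sub>1 j - J\<^sub>2 j) - (\<Sum>j=1..i - 1. J\<^sub>1 j - J\<^sub>2 j) \<le> \<Phi> i - \<Phi> (i - 1)"
        using 1[OF i] 2[OF i] by (simp add: \<Phi>_def)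
    qed (use k in auto)
    then show "(\<Sum>j=1..k. J\<^sub>1 j - J\<^sub>2 j) \<le> 0" using \<Phi> k by simp
  }
  {
    assume k: "k < 0" "- K \<le> k"
      and 1: "\<And>j. k < j \<Longrightarrow> j \<le> 0 \<Longrightarrow> lpp w (south_west N a) (0, j) - lpp w (south_west N a) (0, j - 1) \<le> J\<^sub>1 j"
      and 2: "\<And>j. k < j \<Longrightarrow> j \<le> 0 \<Longrightarrow> J\<^sub>2 j \<le> lpp w (1, j - 1) (north_east N b) - lpp w (1, j) (north_east N b)"
    have "\<Phi> 0 - \<Phi> k \<le> (\<Sum>j=k + 1..0. J\<^sub>1 j - J\<^sub>2 j) - (\<Sum>j=k + 1..k. J\<^sub>1 j - J\<^sub>2 j)"
    proof (rule telescope_le)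
      fix i :: int assume i: "k < i" "i \<le> 0"
      have "(\<Sum>j=k + 1..i. J\<^sub>1 j - J\<^sub>2 j) - (\<Sum>j=k + 1..i - 1. J\<^sub>1 j - J\<^sub>2 j) = J\<^sub>1 i - J\<^sub>2 i"
        using int_sum_last'[of k i "\<lambda>j. J\<^sub>1 j - J\<^sub>2 j"] i by simp
      then show "\<Phi> i - \<Phi> (i - 1) \<le> (\<Sum>j=k + 1..i. J\<^sub>1 j - J\<^sub>2 j) - (\<Sum>j=k + 1..i - 1. J\<^sub>1 j - J\<^sub>2 j)"
        using 1[OF i] 2[OF i] by (simp add: \<Phi>_def)
    qed (use k in auto)
    then show "- (\<Sum>j=k + 1..0. J\<^sub>1 j - J\<^sub>2 j) \<le> 0" using \<Phi> k by simp
  }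
qed

text \<open>The first passage time ends at the origin and the second one starts at its right
  neighbour, so the equality expresses that a geodesic uses this edge. One window \<open>A\<close>
  restricts both endpoints.\<close>

definition crosses :: "(site \<Rightarrow> real) \<Rightarrow> nat \<Rightarrow> (int \<Rightarrow> bool) \<Rightarrow> bool" where
  "crosses w N A \<longleftrightarrow> (\<exists>a b. A a \<and> A b \<and> lpp w (south_west N a) (north_east N b) =
     lpp w (south_west N a) (0, 0) + lpp w (1, 0) (north_east N b))"

lemma pred_crosses:
  assumes [measurable]: "\<And>v. W v \<in> borel_measurable Z"
  shows "Measurable.pred Z (\<lambda>p. crosses (\<lambda>v. W v p) N A)"
  unfolding crosses_def by measurable

text \<open>Statements about increments towards the north-east are those of
  \<open>boundary_env\<close> for the reflected field, available under the prefix
  \<open>rev\<close>.\<close>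

locale two_sided =
  boundary_env M \<omega> I J \<nu> + rev: boundary_env M "\<lambda>x. \<omega> (- x)" "\<lambda>\<xi> x. I' \<xi> (- x)" "\<lambda>\<xi> x. J' \<xi> (- x)" \<nu>
  for M :: "'a measure" and \<omega> I J I' J' \<nu>
begin

definition walk_event :: "nat \<Rightarrow> real \<times> real \<Rightarrow> real \<times> real \<Rightarrow> 'a set" where
  "walk_event N lo hi = {p \<in> space M.
          (SUP k\<in>{k. 0 < k \<and> of_int k \<le> real N powr (2 / 3)}.
             ereal (walk J J' lo hi k p)) \<le> 0 \<and>
          (SUP k\<in>{k. - (real N powr (2 / 3)) + 1 \<le> of_int k \<and> k < 0}.
             ereal (walk J J' hi lo k p)) \<le> 0}"

definition walk_tail :: "real \<Rightarrow> real \<Rightarrow> real \<Rightarrow> real \<Rightarrow> bool" where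
  "walk_tail a\<^sub>0 \<delta> C\<^sub>3 N\<^sub>3 \<longleftrightarrow> (\<forall>N::nat. real N \<ge> N\<^sub>3 \<longrightarrow>
      (\<forall>\<eta>_lo\<in>ri_U. \<forall>\<eta>_up\<in>ri_U. \<forall>\<xi>_lo\<in>ri_U. \<forall>\<xi>_up\<in>ri_U.
        fst \<eta>_lo \<in> {\<delta><..<1 - \<delta>} \<longrightarrow> fst \<eta>_up \<in> {\<delta><..<1 - \<delta>} \<longrightarrow>
        fst \<xi>_lo \<in> {\<delta><..<1 - \<delta>} \<longrightarrow> fst \<xi>_up \<in> {\<delta><..<1 - \<delta>} \<longrightarrow>
        - (real N powr (- a\<^sub>0 / 2)) \<le> fst \<xi>_lo - fst \<eta>_up \<longrightarrow> fst \<xi>_lo - fst \<eta>_up < 0 \<longrightarrow>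
        - (real N powr (- a\<^sub>0 / 2)) \<le> fst \<eta>_lo - fst \<xi>_up \<longrightarrow> fst \<eta>_lo - fst \<xi>_up < 0 \<longrightarrow>
        measure M {p \<in> space M.
          (SUP k\<in>{k. 0 < k \<and> of_int k \<le> real N powr (2 / 3)}.
             ereal (walk J J' \<xi>_lo \<eta>_up k p)) \<le> 0 \<and>
          (SUP k\<in>{k. - (real N powr (2 / 3)) + 1 \<le> of_int k \<and> k < 0}.
             ereal (walk J J' \<xi>_up \<eta>_lo k p)) \<le> 0}
        \<le> C\<^sub>3 * real N powr (- a\<^sub>0)))"

text \<open>Only two directions enter: the lower one as \<open>\<xi>_lo\<close> and
  \<open>\<eta>_lo\<close>, the upper one as \<open>\<xi>_up\<close> and \<open>\<eta>_up\<close>,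
  so the two gap conditions coincide.\<close>

lemma walk_tailD:
  assumes W: "walk_tail a\<^sub>0 \<delta> C\<^sub>3 N\<^sub>3" and \<delta>: "0 < \<delta>" and N: "N\<^sub>3 \<le> real N"
    and lh: "\<delta> < lo" "hi < 1 - \<delta>" "lo < hi" "hi - lo \<le> real N powr (- a\<^sub>0 / 2)"
  shows "prob (walk_event N (direction lo) (direction hi)) \<le> C\<^sub>3 * real N powr - a\<^sub>0"
proof -
  have ri: "direction lo \<in> ri_U" "direction hi \<in> ri_U" using lh \<delta> by auto
  show ?thesis
    unfolding walk_event_def
    by (rule W[unfolded walk_tail_def, rule_format, OF N ri(1,2,1,2)]) (use lh in auto)
qed

lemma walk_event_iff:
  "p \<in> walk_event N lo hi \<longleftrightarrow> p \<in> space M \<and>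
     (\<forall>k. 0 < k \<and> of_int k \<le> real N powr (2 / 3) \<longrightarrow> walk J J' lo hi k p \<le> 0) \<and>
     (\<forall>k. - (real N powr (2 / 3)) + 1 \<le> of_int k \<and> k < 0 \<longrightarrow> walk J J' hi lo k p \<le> 0)"
  by (simp add: walk_event_def SUP_le_iff zero_ereal_def)

lemma J'_meas: "\<xi> \<in> ri_U \<Longrightarrow> J' \<xi> x \<in> borel_measurable M"
  using rev.J_meas[of \<xi> "- x"] by simp

lemma walk_event_measurable:
  assumes "lo \<in> ri_U" "hi \<in> ri_U"
  shows "walk_event N lo hi \<in> events"
proof -
  note [measurable] = J_meas[OF assms(1)] J_meas[OF assms(2)] J'_meas[OF assms(1)] J'_meas[OF assms(2)]
  have "walk_event N lo hi = {p \<in> space M.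
     (\<forall>k. 0 < k \<and> of_int k \<le> real N powr (2 / 3) \<longrightarrow> walk J J' lo hi k p \<le> 0) \<and>
     (\<forall>k. - (real N powr (2 / 3)) + 1 \<le> of_int k \<and> k < 0 \<longrightarrow> walk J J' hi lo k p \<le> 0)}"
    using walk_event_iff by blast
  also have "\<dots> \<in> events" unfolding walk_def by measurable
  finally show ?thesis .
qed

lemma lpp_reverse:
  "lpp (\<lambda>v. \<omega> (- v) p) (south_west N b) (- 1, 1 - j) = G p (1, j - 1) (north_east N b)"
  using lpp_reflect[of "\<lambda>v. \<omega> v p" "north_east N b" "(1, j - 1)"]
  by (simp add: south_west_def north_east_def)

text \<open>Outside two exceptional events, the increments on column \<open>0\<close> seen from the
  south-west and on column \<open>1\<close> seen from the north-east are squeezed between boundary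
  weights, and a crossing at height \<open>0\<close> puts the realization into
  \<open>walk_event\<close>.\<close>

lemma near_crossing_prob:
  fixes s L :: int and N :: nat and D C R C' R' c\<^sub>3 :: real
  assumes eb: "exit_bounds D C R" "rev.exit_bounds D C' R'" and D: "0 < D"
    and s: "D < (s - 1) * L / N" "(s + 8) * L / N < 1 - D"
    and N: "R \<le> N / 2" "R' \<le> N / 2" and L: "R \<le> crit N L" "R' \<le> crit N L"
    and K: "2 * real N powr (2 / 3) + 6 \<le> L"
    and W: "prob (walk_event N (direction ((s - 1) * L / N)) (direction ((s + 8) * L / N))) \<le> c\<^sub>3"
  shows "prob {p \<in> space M. crosses (\<lambda>v. \<omega> v p) N (\<lambda>a. s * L \<le> a \<and> a \<le> (s + 7) * L)}
    \<le> 2 * (C * crit N L powr - \<nu>) + 2 * (C' * crit N L powr - \<nu>) + c\<^sub>3"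
proof -
  define lo where "lo = (s - 1) * L / real N"
  define hi where "hi = (s + 8) * L / real N"
  define K where "K = \<lfloor>real N powr (2 / 3)\<rfloor> + 1"
  have Npos: "0 < real N"
  proof -
    have "0 < R" using eb by (simp add: exit_bounds_def)
    then show ?thesis using N by linarith
  qed
  have K0: "0 \<le> K" "2 * K + 4 \<le> L"
  proof -
    have "0 \<le> real N powr (2 / 3)" by simp
    then show "0 \<le> K" by (simp add: K_def)
    have "2 * real_of_int K + 4 = 2 * real_of_int \<lfloor>real N powr (2 / 3)\<rfloor> + 6" by (simp add: K_def)
    also have "\<dots> \<le> 2 * real N powr (2 / 3) + 6" by (intro add_right_mono mult_left_mono) auto
    finally have "2 * real_of_int K + 4 \<le> real_of_int L" using K by simp
    then show "2 * K + 4 \<le> L" by linarith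
  qed
  have K1: "k \<le> K" if "real_of_int k \<le> real N powr (2 / 3)" for k
    using that by (simp add: K_def le_floor_iff[symmetric])
  have s2: "0 < (s - 1) * L" "(s + 8) * L < int N"
  proof -
    have "0 < real_of_int ((s - 1) * L) / real N" using s D by simp
    then show "0 < (s - 1) * L" using Npos by (simp add: zero_less_divide_iff del: of_int_mult of_int_diff)
    have "real_of_int ((s + 8) * L) / real N < 1" using s D by simp
    then show "(s + 8) * L < int N" using Npos by (simp add: pos_divide_less_eq del: of_int_mult of_int_add)
  qed
  obtain B where B: "B \<in> events" "prob B \<le> 2 * (C * crit N L powr - \<nu>)"
    and Bn: "AE p in M. p \<notin> B \<longrightarrow> (\<forall>a j. s * L \<le> a \<longrightarrow> a \<le> (s + 7) * L \<longrightarrow> - K \<le> j \<longrightarrow> j \<le> K \<longrightarrow>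
       J (direction lo) (0, j) p
         \<le> G p (south_west N a) (0, j) - G p (south_west N a) (0, j - 1) \<and>
       G p (south_west N a) (0, j) - G p (south_west N a) (0, j - 1)
         \<le> J (direction hi) (0, j) p)"
    unfolding lo_def hi_def
    by (rule near_block[OF eb(1) D s N(1) L(1) K0, of 0]) auto
  \<comment> \<open>Reflection sends \<open>(- 1, 1 - j)\<close> to \<open>(1, j - 1)\<close>, the
    site at which the walk evaluates \<open>J'\<close>.\<close>
  obtain B' where B': "B' \<in> events" "prob B' \<le> 2 * (C' * crit N L powr - \<nu>)"
    and Bn': "AE p in M. p \<notin> B' \<longrightarrow> (\<forall>a j. s * L \<le> a \<longrightarrow> a \<le> (s + 7) * L \<longrightarrow> - K \<le> j \<longrightarrow> j \<le> K \<longrightarrow>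
       J' (direction lo) (- (- 1, j)) p
         \<le> lpp (\<lambda>v. \<omega> (- v) p) (south_west N a) (- 1, j) - lpp (\<lambda>v. \<omega> (- v) p) (south_west N a) (- 1, j - 1) \<and>
       lpp (\<lambda>v. \<omega> (- v) p) (south_west N a) (- 1, j) - lpp (\<lambda>v. \<omega> (- v) p) (south_west N a) (- 1, j - 1)
         \<le> J' (direction hi) (- (- 1, j)) p)"
    unfolding lo_def hi_def
    by (rule rev.near_block[OF eb(2) D s N(2) L(2) K0, of "- 1"]) auto
  let ?W = "walk_event N (direction lo) (direction hi)"
  have lohi: "0 < lo" "lo < 1" "0 < hi" "hi < 1"
  proof -
    show "0 < lo" "hi < 1" using s D by (simp_all add: lo_def hi_def)
    moreover have "lo < hi"
      unfolding lo_def hi_def using K0 Npos by (intro divide_strict_right_mono) (auto simp: algebra_simps)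
    ultimately show "lo < 1" "0 < hi" by auto
  qed
  have W_ev: "?W \<in> events" using lohi by (intro walk_event_measurable) auto
  have "prob {p \<in> space M. crosses (\<lambda>v. \<omega> v p) N (\<lambda>a. s * L \<le> a \<and> a \<le> (s + 7) * L)} \<le> prob (B \<union> B' \<union> ?W)"
  proof (rule finite_measure_mono_AE)
    show "AE p in M. p \<in> {p \<in> space M. crosses (\<lambda>v. \<omega> v p) N (\<lambda>a. s * L \<le> a \<and> a \<le> (s + 7) * L)}
        \<longrightarrow> p \<in> B \<union> B' \<union> ?W"
      using Bn Bn' AE_space
    proof eventually_elim
      case (elim p)
      let ?w = "\<lambda>v. \<omega> v p"
      show ?case
      proof
        assume "p \<in> {p \<in> space M. crosses (\<lambda>v. \<omega> v p) N (\<lambda>a. s * L \<le> a \<and> a \<le> (s + 7) * L)}"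
        then obtain a b where a: "s * L \<le> a" "a \<le> (s + 7) * L" and b: "s * L \<le> b" "b \<le> (s + 7) * L"
          and eq: "lpp ?w (south_west N a) (north_east N b) =
            lpp ?w (south_west N a) (0, 0) + lpp ?w (1, 0) (north_east N b)"
          by (auto simp: crosses_def)
        have ab: "0 \<le> a" "1 \<le> b" "a + K \<le> int N" "b + K \<le> int N"
        proof -
          define u where "u = (s - 1) * L"
          define v where "v = (s + 8) * L"
          have "s * L = u + L" "(s + 7) * L = v - L" by (simp_all add: u_def v_def algebra_simps)
          then have "u + L \<le> a" "a \<le> v - L" "u + L \<le> b" "b \<le> v - L" using a b by simp_all
          moreover have "0 < u" "v < int N" using s2 by (simp_all only: u_def v_def)
          moreover have "K \<le> L" "0 \<le> L" using K0 by simp_all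
          ultimately show "0 \<le> a" "1 \<le> b" "a + K \<le> int N" "b + K \<le> int N" by simp_all
        qed
        show "p \<in> B \<union> B' \<union> ?W"
        proof (rule ccontr)
          assume "p \<notin> B \<union> B' \<union> ?W"
          then have nB: "p \<notin> B" "p \<notin> B'" "p \<notin> ?W" by auto
          note F = elim(1)[rule_format, OF nB(1) a]
          have F': "J' (direction lo) (1, j - 1) p \<le> lpp ?w (1, j - 1) (north_east N b) - lpp ?w (1, j) (north_east N b)"
            "lpp ?w (1, j - 1) (north_east N b) - lpp ?w (1, j) (north_east N b) \<le> J' (direction hi) (1, j - 1) p"
            if "- K \<le> 1 - j" "1 - j \<le> K" for j
            using elim(2)[rule_format, OF nB(2) b that] lpp_reverse[of p N b j] lpp_reverse[of p N b "j + 1"]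
            by simp_all
          have "p \<in> ?W"
            unfolding walk_event_iff
          proof (intro conjI allI impI; (elim conjE)?)
            show "p \<in> space M" by (rule elim(3))
          next
            fix k assume k: "0 < k" "real_of_int k \<le> real N powr (2 / 3)"
            have "(\<Sum>j=1..k. J (direction lo) (0, j) p - J' (direction hi) (1, j - 1) p) \<le> 0"
              using k(1) K1[OF k(2)] by (intro walk_nonpositive(1)[OF ab eq] F[THEN conjunct1] F') auto
            then show "walk J J' (direction lo) (direction hi) k p \<le> 0" using k by (simp add: walk_def)
          next
            fix k assume k: "- (real N powr (2 / 3)) + 1 \<le> real_of_int k" "k < 0"
            have kK: "- K \<le> k" using K1[of "- k"] k by linarith
            have "- (\<Sum>j=k + 1..0. J (direction hi) (0, j) p - J' (direction lo) (1, j - 1) p) \<le> 0"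
              using k(2) kK by (intro walk_nonpositive(2)[OF ab eq] F[THEN conjunct2] F') auto
            then show "walk J J' (direction hi) (direction lo) k p \<le> 0" using k by (simp add: walk_def)
          qed
          then show False using nB by simp
        qed
      qed
    qed
  qed (use B B' W_ev in auto)
  also have "\<dots> \<le> prob B + prob B' + prob ?W"
    using B B' W_ev measure_Un_le[of "B \<union> B'" M ?W] measure_Un_le[of B M B'] by auto
  finally show ?thesis using B B' W by (simp add: lo_def hi_def)
qed

lemma crossing_prob:
  fixes L :: int and N :: nat and D C R C' R' c\<^sub>3 :: real
  assumes eb: "exit_bounds D C R" "rev.exit_bounds D C' R'" and D: "0 < D"
    and N: "R \<le> N / 2" "R' \<le> N / 2" and L: "R \<le> crit N L" "R' \<le> crit N L"
    and K: "2 * real N powr (2 / 3) + 6 \<le> L" and LD: "8 * L < D * N"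
    and c\<^sub>3: "0 \<le> c\<^sub>3"
    and W: "\<And>lo hi. D < lo \<Longrightarrow> hi < 1 - D \<Longrightarrow> hi = lo + 9 * L / N \<Longrightarrow>
      prob (walk_event N (direction lo) (direction hi)) \<le> c\<^sub>3"
  shows "prob {p \<in> space M. crosses (\<lambda>v. \<omega> v p) N (\<lambda>a. 2 * D * N \<le> a \<and> a \<le> (1 - 2 * D) * N)}
    \<le> (N / L + 1) * (4 * (C * crit N L powr - \<nu>) + 4 * (C' * crit N L powr - \<nu>) + c\<^sub>3)"
proof -
  have Npos: "0 < real N"
  proof -
    have "0 < R" using eb by (simp add: exit_bounds_def)
    then show ?thesis using N by linarith
  qed
  have L6: "6 \<le> L" using K powr_ge_zero[of "real N" "2 / 3"] by linarith
  define T where "T = {s \<in> {0..int N div L}. D < (s - 1) * L / N \<and> (s + 8) * L / N < 1 - D}"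
  have "T \<subseteq> {0..int N div L}" by (auto simp: T_def)
  then have T: "finite T" "real (card T) \<le> N / L + 1"
    using card_blocks[of L T N] L6 by simp_all
  define E1 where "E1 = {p \<in> space M. deviates (\<lambda>v. \<omega> v p) N L D}"
  define E2 where "E2 = {p \<in> space M. deviates (\<lambda>v. \<omega> (- v) p) N L D}"
  define E3 where "E3 s = {p \<in> space M. crosses (\<lambda>v. \<omega> v p) N (\<lambda>a. s * L \<le> a \<and> a \<le> (s + 7) * L)}" for s
  have ev: "E1 \<in> events" "E2 \<in> events" "E3 s \<in> events" for s
    unfolding E1_def E2_def E3_def
    using pred_deviates[of \<omega> M N L D] pred_deviates[of "\<lambda>v. \<omega> (- v)" M N L D]
      pred_crosses[of \<omega> M N "\<lambda>a. s * L \<le> a \<and> a \<le> (s + 7) * L"] by (auto simp: pred_def)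
  have "{p \<in> space M. crosses (\<lambda>v. \<omega> v p) N (\<lambda>a. 2 * D * N \<le> a \<and> a \<le> (1 - 2 * D) * N)}
      \<subseteq> E1 \<union> E2 \<union> (\<Union>s\<in>T. E3 s)"
  proof
    fix p assume "p \<in> {p \<in> space M. crosses (\<lambda>v. \<omega> v p) N (\<lambda>a. 2 * D * N \<le> a \<and> a \<le> (1 - 2 * D) * N)}"
    then obtain a b where p: "p \<in> space M" and a: "2 * D * N \<le> a" "a \<le> (1 - 2 * D) * N"
      and b: "2 * D * N \<le> b" "b \<le> (1 - 2 * D) * N"
      and eq: "G p (south_west N a) (north_east N b) =
            G p (south_west N a) (0, 0) + G p (1, 0) (north_east N b)"
      by (auto simp: crosses_def)
    let ?w = "\<lambda>v. \<omega> v p"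
    have DN: "0 < D * N" using D Npos by simp
    have DN': "(1 - 2 * D) * N = N - 2 * (D * N)" by (simp add: algebra_simps)
    have "0 < real_of_int a" "real_of_int a < real_of_int (int N)"
      "0 < real_of_int b" "real_of_int b < real_of_int (int N)"
      using a b DN unfolding DN' by auto
    then have a1: "0 < a" "a < int N" "0 < b" "b < int N"
      by (simp_all only: of_int_less_iff of_int_0_less_iff)
    \<comment> \<open>Using the edge entails passing through the origin, which is the form required
      by \<open>deviates\<close>.\<close>
    have thr: "lpp ?w (south_west N a) (north_east N b) =
            lpp ?w (south_west N a) (0, 0) + lpp ?w (0, 0) (north_east N b) - \<omega> (0, 0) p"
    proof (rule antisym)
      have "\<omega> (0, 0) p + lpp ?w (1, 0) (north_east N b) \<le> lpp ?w (0, 0) (north_east N b)"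
        using lpp_concat[of "(0, 0)" "(0, 0)" "(1, 0)" "north_east N b" ?w] a1
        by (simp add: north_east_def up_right_step_def)
      then show "lpp ?w (south_west N a) (north_east N b) \<le>
            lpp ?w (south_west N a) (0, 0) + lpp ?w (0, 0) (north_east N b) - \<omega> (0, 0) p"
        using eq by simp
      show "lpp ?w (south_west N a) (0, 0) + lpp ?w (0, 0) (north_east N b) - \<omega> (0, 0) p
          \<le> lpp ?w (south_west N a) (north_east N b)"
        using a1 by (intro lpp_concat_overlap) (auto simp: south_west_def north_east_def)
    qed
    have dn: "D * N \<le> a" "a \<le> (1 - D) * N" "D * N \<le> b" "b \<le> (1 - D) * N"
      using a b DN by (auto simp: algebra_simps)
    \<comment> \<open>A deviation to the right; one to the left, which is a deviation to the right
      in the reflected environment with the endpoints exchanged; or two parameters inside a common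
      window of seven blocks.\<close>
    consider "a + 5 * L \<le> b" | "b + 5 * L \<le> a" | "\<bar>a - b\<bar> < 5 * L" by linarith
    then show "p \<in> E1 \<union> E2 \<union> (\<Union>s\<in>T. E3 s)"
    proof cases
      case 1
      have "deviates ?w N L D"
        unfolding deviates_def by (intro exI conjI) (rule dn 1 thr)+
      then show ?thesis using p by (simp add: E1_def)
    next
      case 2
      have r: "lpp (\<lambda>v. \<omega> (- v) p) (south_west N b) (north_east N a) = lpp ?w (south_west N a) (north_east N b)"
        "lpp (\<lambda>v. \<omega> (- v) p) (south_west N b) (0, 0) = lpp ?w (0, 0) (north_east N b)"
        "lpp (\<lambda>v. \<omega> (- v) p) (0, 0) (north_east N a) = lpp ?w (south_west N a) (0, 0)"
        using lpp_reflect[of ?w "north_east N b" "south_west N a"] lpp_reflect[of ?w "north_east N b" "(0, 0)"]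
          lpp_reflect[of ?w "(0, 0)" "south_west N a"] by (simp_all add: south_west_def north_east_def zero_prod_def[symmetric])
      have "deviates (\<lambda>v. \<omega> (- v) p) N L D"
        unfolding deviates_def
      proof (intro exI conjI)
        show "lpp (\<lambda>v. \<omega> (- v) p) (south_west N b) (north_east N a) =
          lpp (\<lambda>v. \<omega> (- v) p) (south_west N b) (0, 0) + lpp (\<lambda>v. \<omega> (- v) p) (0, 0) (north_east N a) - \<omega> (- (0, 0)) p"
          unfolding r using thr by simp
      qed (rule dn 2)+
      then show ?thesis using p by (simp add: E2_def)
    next
      case 3
      define s where "s = min a b div L"
      have "s * L = min a b - min a b mod L" by (simp add: s_def minus_mod_eq_div_mult)
      moreover have "0 \<le> min a b mod L" "min a b mod L < L" using L6 by simp_all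
      ultimately have sL: "s * L \<le> min a b" "min a b < s * L + L" by auto
      have x: "(s + 7) * L = s * L + 7 * L" "(s - 1) * L = s * L - L" "(s + 8) * L = s * L + 8 * L"
        by (simp_all add: algebra_simps)
      have "s \<in> T"
        unfolding T_def
      proof (intro CollectI conjI)
        have "0 \<le> s" using a1 L6 by (simp add: s_def pos_imp_zdiv_nonneg_iff)
        moreover have "s \<le> int N div L" unfolding s_def using a1 L6 by (intro zdiv_mono1) auto
        ultimately show "s \<in> {0..int N div L}" by simp
        \<comment> \<open>The margin \<open>D * N\<close> between the range of \<open>a\<close>,
          \<open>b\<close> and the admissible directions exceeds \<open>8 * L\<close>, which leaves
          room for the bounding directions of the window.\<close>
        have "2 * (D * N) \<le> min a b" using a b by auto
        then have "D * N < (s - 1) * L" unfolding x using sL LD L6 by linarith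
        then show "D < (s - 1) * L / N" using Npos by (simp add: pos_less_divide_eq)
        have "min a b \<le> N - 2 * (D * N)" using a b unfolding DN' by auto
        then have "(s + 8) * L < N - D * N" unfolding x using sL LD L6 by linarith
        also have "N - D * N = (1 - D) * N" by (simp add: algebra_simps)
        finally show "(s + 8) * L / N < 1 - D" using Npos by (simp only: pos_divide_less_eq)
      qed
      moreover have "p \<in> E3 s"
        unfolding E3_def crosses_def x using p eq sL 3
        by (intro CollectI conjI exI[of _ a] exI[of _ b]) auto
      ultimately show ?thesis by blast
    qed
  qed
  then have "prob {p \<in> space M. crosses (\<lambda>v. \<omega> v p) N (\<lambda>a. 2 * D * N \<le> a \<and> a \<le> (1 - 2 * D) * N)}
      \<le> prob (E1 \<union> E2 \<union> (\<Union>s\<in>T. E3 s))"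
    using ev T by (intro finite_measure_mono) auto
  also have "\<dots> \<le> prob E1 + prob E2 + prob (\<Union>s\<in>T. E3 s)"
    using ev T measure_Un_le[of "E1 \<union> E2" M "\<Union>s\<in>T. E3 s"] measure_Un_le[of E1 M E2] by auto
  also have "prob E1 \<le> (N / L + 1) * (2 * (C * crit N L powr - \<nu>))"
    unfolding E1_def using L6 by (intro deviation_prob[OF eb(1) D N(1) _ L(1)]) auto
  also have "prob E2 \<le> (N / L + 1) * (2 * (C' * crit N L powr - \<nu>))"
    unfolding E2_def using L6 by (intro rev.deviation_prob[OF eb(2) D N(2) _ L(2)]) auto
  also have "prob (\<Union>s\<in>T. E3 s) \<le> (N / L + 1) * (2 * (C * crit N L powr - \<nu>) + 2 * (C' * crit N L powr - \<nu>) + c\<^sub>3)"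
  proof -
    have E3: "prob (E3 s) \<le> 2 * (C * crit N L powr - \<nu>) + 2 * (C' * crit N L powr - \<nu>) + c\<^sub>3" if "s \<in> T" for s
      unfolding E3_def
    proof (rule near_crossing_prob[OF eb D _ _ N L K])
      show s: "D < (s - 1) * L / N" "(s + 8) * L / N < 1 - D" using that by (auto simp: T_def)
      show "prob (walk_event N (direction ((s - 1) * L / N)) (direction ((s + 8) * L / N))) \<le> c\<^sub>3"
        by (rule W[OF s]) (simp add: algebra_simps add_divide_distrib diff_divide_distrib)
    qed
    have "prob (\<Union>s\<in>T. E3 s) \<le> (\<Sum>s\<in>T. prob (E3 s))" using T ev by (intro measure_UNION_le) auto
    also have "\<dots> \<le> (\<Sum>s\<in>T. 2 * (C * crit N L powr - \<nu>) + 2 * (C' * crit N L powr - \<nu>) + c\<^sub>3)"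
      by (intro sum_mono E3)
    also have "\<dots> = real (card T) * (2 * (C * crit N L powr - \<nu>) + 2 * (C' * crit N L powr - \<nu>) + c\<^sub>3)" by simp
    also have "\<dots> \<le> (N / L + 1) * (2 * (C * crit N L powr - \<nu>) + 2 * (C' * crit N L powr - \<nu>) + c\<^sub>3)"
      using T(2) c\<^sub>3 eb by (intro mult_right_mono) (auto simp: exit_bounds_def rev.exit_bounds_def)
    finally show ?thesis .
  qed
  finally show ?thesis by (simp add: algebra_simps)
qed

end

context two_sided
begin

lemma crossing_decay:
  fixes D C R C' R' C\<^sub>3 N\<^sub>3 a\<^sub>0 :: real
  assumes eb: "exit_bounds D C R" "rev.exit_bounds D C' R'" and D: "0 < D"
    and W: "\<And>lo hi N. N\<^sub>3 \<le> real N \<Longrightarrow> D < lo \<Longrightarrow> hi < 1 - D \<Longrightarrow> lo < hi \<Longrightarrow>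
      hi - lo \<le> real N powr (- a\<^sub>0 / 2) \<Longrightarrow>
      prob (walk_event N (direction lo) (direction hi)) \<le> C\<^sub>3 * real N powr - a\<^sub>0"
    and C\<^sub>3: "0 \<le> C\<^sub>3" and a\<^sub>0: "0 < a\<^sub>0" "a\<^sub>0 < 2 / 3" and \<nu>: "a\<^sub>0 / 2 < \<nu> * (1 / 3 - a\<^sub>0 / 2)"
  shows "\<exists>K e. 0 < e \<and> eventually (\<lambda>N.
    prob {p \<in> space M. crosses (\<lambda>v. \<omega> v p) N (\<lambda>a. 2 * D * N \<le> a \<and> a \<le> (1 - 2 * D) * N)}
      \<le> K * real N powr - e) sequentially"
proof -
  \<comment> \<open>The tilt across a window is \<open>9 * L N / N\<close>; the divisor
    \<open>20\<close> keeps it below \<open>N powr (- a\<^sub>0 / 2)\<close> even after rounding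
    up.\<close>
  define L where "L N = \<lceil>real N powr (1 - a\<^sub>0 / 2) / 20\<rceil>" for N :: nat
  define b where "b = 1 / 3 - a\<^sub>0 / 2"
  \<comment> \<open>The constant in the lower bound \<open>k * N powr b\<close> for
    \<open>crit N (L N)\<close>: \<open>1 / 40\<close> comes from \<open>L N / (2 * N)\<close>, the
    other factor from \<open>N / 2\<close>.\<close>
  define k where "k = (1 / 40) * (1 / 2) powr (1 / 3 :: real)"
  \<comment> \<open>About \<open>N powr (a\<^sub>0 / 2)\<close> blocks multiply error terms of order
    \<open>N powr - (\<nu> * b)\<close> and \<open>N powr - a\<^sub>0\<close>; \<open>e\<close> is
    the smaller of the two surpluses.\<close>
  define e where "e = min (\<nu> * b - a\<^sub>0 / 2) (a\<^sub>0 / 2)"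
  define c where "c = 4 * (C * k powr - \<nu>) + 4 * (C' * k powr - \<nu>) + C\<^sub>3"
  have b: "0 < b" using a\<^sub>0 by (simp add: b_def)
  have k: "0 < k" by (simp add: k_def)
  have C: "0 < C" "0 < C'" using eb by (auto simp: exit_bounds_def rev.exit_bounds_def)
  have e: "0 < e" using \<nu> a\<^sub>0 by (simp add: e_def b_def)
  have "eventually (\<lambda>N. 20 \<le> real N powr (1 - a\<^sub>0 / 2)) sequentially" using a\<^sub>0 by real_asymp
  \<comment> \<open>Here \<open>a\<^sub>0 < 2 / 3\<close> enters: a block outgrows the range
    \<open>N powr (2 / 3)\<close> of the walk.\<close>
  moreover have "eventually (\<lambda>N. 2 * real N powr (2 / 3) + 6 \<le> real N powr (1 - a\<^sub>0 / 2) / 20) sequentially"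
    using a\<^sub>0 by real_asymp
  moreover have "eventually (\<lambda>N. real N powr (- a\<^sub>0 / 2) < D) sequentially" using a\<^sub>0 D by real_asymp
  moreover have "eventually (\<lambda>N. max R R' \<le> k * real N powr b) sequentially" using b k by real_asymp
  moreover have "eventually (\<lambda>N. max R R' \<le> real N / 2) sequentially" by real_asymp
  moreover have "eventually (\<lambda>N. max N\<^sub>3 1 \<le> real N) sequentially" by real_asymp
  ultimately have "eventually (\<lambda>N.
    prob {p \<in> space M. crosses (\<lambda>v. \<omega> v p) N (\<lambda>a. 2 * D * N \<le> a \<and> a \<le> (1 - 2 * D) * N)}
      \<le> 21 * c * real N powr - e) sequentially"
  proof eventually_elim
    case (elim N)
    define H where "H = real N powr (- a\<^sub>0 / 2)"
    have N1: "1 \<le> real N" "0 < real N" using elim(6) by auto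
    have NH: "real N powr (1 - a\<^sub>0 / 2) = N * H"
      using N1 powr_add[of "real N" 1 "- a\<^sub>0 / 2"] by (simp add: H_def)
    have H: "0 < H" "H \<le> 1"
    proof -
      show "0 < H" using N1 by (simp add: H_def)
      have "H \<le> real N powr 0" unfolding H_def using N1 a\<^sub>0 by (intro powr_mono) auto
      then show "H \<le> 1" using N1 by simp
    qed
    have L1: "N * H / 20 \<le> L N" "L N \<le> N * H / 20 + 1" unfolding L_def NH by linarith+
    have L2: "L N \<le> N * H / 10" using L1(2) elim(1) unfolding NH by simp
    have L0: "0 < real_of_int (L N)" using L1(1) elim(1) unfolding NH by linarith
    have crit: "k * real N powr b \<le> crit N (L N)"
    proof -
      have "real N powr b = H * real N powr (1 / 3)"
        by (simp add: H_def b_def powr_add[symmetric])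
      then have "k * real N powr b = H / 40 * ((1 / 2) powr (1 / 3) * real N powr (1 / 3))"
        by (simp add: k_def)
      also have "(1 / 2) powr (1 / 3) * real N powr (1 / 3) = (real N / 2) powr (1 / 3)"
        by (subst powr_mult[symmetric]) auto
      also have "H / 40 * (real N / 2) powr (1 / 3) \<le> crit N (L N)"
        unfolding crit_def
      proof (rule mult_right_mono)
        have "H / 40 = (N * H / 20) / (2 * real N)" using N1 by simp
        also have "\<dots> \<le> L N / (2 * real N)" using L1(1) N1 by (intro divide_right_mono) auto
        finally show "H / 40 \<le> L N / (2 * real N)" .
      qed auto
      finally show ?thesis .
    qed
    have crit_pow: "crit N (L N) powr - \<nu> \<le> k powr - \<nu> * real N powr - (\<nu> * b)"
    proof -
      have "crit N (L N) powr - \<nu> \<le> (k * real N powr b) powr - \<nu>"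
        using crit k N1 nu_pos by (intro powr_mono2') auto
      also have "\<dots> = k powr - \<nu> * real N powr - (\<nu> * b)"
        using k N1 by (simp add: powr_mult powr_powr mult.commute)
      finally show ?thesis .
    qed
    have "prob {p \<in> space M. crosses (\<lambda>v. \<omega> v p) N (\<lambda>a. 2 * D * N \<le> a \<and> a \<le> (1 - 2 * D) * N)}
      \<le> (N / L N + 1) * (4 * (C * crit N (L N) powr - \<nu>) + 4 * (C' * crit N (L N) powr - \<nu>) + C\<^sub>3 * real N powr - a\<^sub>0)"
    proof (rule crossing_prob[OF eb D])
      show "R \<le> N / 2" "R' \<le> N / 2" using elim(5) by auto
      show "R \<le> crit N (L N)" "R' \<le> crit N (L N)" using elim(4) crit by auto
      show "2 * real N powr (2 / 3) + 6 \<le> L N" using elim(2) L1(1) unfolding NH by linarith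
      show "8 * L N < D * N"
      proof -
        have "8 * L N \<le> N * H" using L2 L0 by simp
        also have "\<dots> < N * D" using elim(3) N1 unfolding H_def by (intro mult_strict_left_mono) auto
        finally show ?thesis by (simp add: mult.commute)
      qed
      show "0 \<le> C\<^sub>3 * real N powr - a\<^sub>0" using C\<^sub>3 by simp
      fix lo hi assume lh: "D < lo" "hi < 1 - D" "hi = lo + 9 * L N / N"
      have "9 * L N / N \<le> H"
      proof -
        have "9 * L N \<le> N * H" using L2 L0 by simp
        then show ?thesis using N1 by (simp add: pos_divide_le_eq mult.commute[of H])
      qed
      moreover have "0 < 9 * L N / N" using L0 N1 by simp
      ultimately show "prob (walk_event N (direction lo) (direction hi)) \<le> C\<^sub>3 * real N powr - a\<^sub>0"
        using lh elim(6) by (intro W) (auto simp: H_def)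
    qed
    also have "\<dots> \<le> (21 * real N powr (a\<^sub>0 / 2)) * (c * real N powr - (e + a\<^sub>0 / 2))"
    proof (rule mult_mono)
      have "N / L N \<le> N / (N * H / 20)" using L1(1) L0 N1 H by (intro divide_left_mono) auto
      also have "\<dots> = 20 / H" using N1 by simp
      finally have "N / L N + 1 \<le> 20 / H + 1 / H" using H by (intro add_mono) auto
      also have "\<dots> = 21 * real N powr (a\<^sub>0 / 2)"
        using N1 by (simp add: H_def powr_minus_divide)
      finally show "N / L N + 1 \<le> 21 * real N powr (a\<^sub>0 / 2)" .
      have p1: "real N powr - (\<nu> * b) \<le> real N powr - (e + a\<^sub>0 / 2)"
        "real N powr - a\<^sub>0 \<le> real N powr - (e + a\<^sub>0 / 2)"
        using N1 by (auto intro!: powr_mono simp: e_def min_def)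
      have q: "crit N (L N) powr - \<nu> \<le> k powr - \<nu> * real N powr - (e + a\<^sub>0 / 2)"
        by (rule order.trans[OF crit_pow]) (intro mult_left_mono p1 powr_ge_zero)
      have "4 * (C * crit N (L N) powr - \<nu>) + 4 * (C' * crit N (L N) powr - \<nu>) + C\<^sub>3 * real N powr - a\<^sub>0
        \<le> 4 * (C * (k powr - \<nu> * real N powr - (e + a\<^sub>0 / 2)))
          + 4 * (C' * (k powr - \<nu> * real N powr - (e + a\<^sub>0 / 2))) + C\<^sub>3 * real N powr - (e + a\<^sub>0 / 2)"
        using C C\<^sub>3 q p1 by (intro add_mono mult_left_mono) auto
      also have "\<dots> = c * real N powr - (e + a\<^sub>0 / 2)" by (simp add: c_def algebra_simps)
      finally show "4 * (C * crit N (L N) powr - \<nu>) + 4 * (C' * crit N (L N) powr - \<nu>) + C\<^sub>3 * real N powr - a\<^sub>0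
        \<le> c * real N powr - (e + a\<^sub>0 / 2)" .
    qed (use C C\<^sub>3 in auto)
    also have "\<dots> = 21 * c * (real N powr (a\<^sub>0 / 2) * real N powr - (e + a\<^sub>0 / 2))" by simp
    also have "real N powr (a\<^sub>0 / 2) * real N powr - (e + a\<^sub>0 / 2) = real N powr - e"
      by (subst powr_add[symmetric]) simp
    finally show ?case .
  qed
  then show ?thesis using e by blast
qed

text \<open>Translation invariance carries the estimate to every site, and along dyadic scales any
  negative power is summable.\<close>

lemma crossing_finitely_often:
  fixes D K e :: real
  assumes e: "0 < e" and decay: "eventually (\<lambda>N.
    prob {p \<in> space M. crosses (\<lambda>v. \<omega> v p) N (\<lambda>a. 2 * D * N \<le> a \<and> a \<le> (1 - 2 * D) * N)}
      \<le> K * real N powr - e) sequentially"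
  shows "AE p in M. \<forall>x. eventually (\<lambda>i. \<not> crosses (\<lambda>v. \<omega> (v + x) p) (2 ^ i)
    (\<lambda>a. 2 * D * 2 ^ i \<le> a \<and> a \<le> (1 - 2 * D) * 2 ^ i)) sequentially"
proof -
  have "AE p in M. eventually (\<lambda>i. \<not> crosses (\<lambda>v. \<omega> (v + x) p) (2 ^ i)
    (\<lambda>a. 2 * D * 2 ^ i \<le> a \<and> a \<le> (1 - 2 * D) * 2 ^ i)) sequentially" for x
  proof -
    define E where "E i = {p \<in> space M. crosses (\<lambda>v. \<omega> (v + x) p) (2 ^ i)
      (\<lambda>a. 2 * D * 2 ^ i \<le> a \<and> a \<le> (1 - 2 * D) * 2 ^ i)}" for i :: nat
    interpret fp: field_pair M "\<lambda>v. \<omega> (v + x)" \<omega> "\<lambda>\<xi> v. I \<xi> (v + x)" "\<lambda>\<xi> v. J \<xi> (v + x)" I J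
      by (rule field_pair_translate)
    \<comment> \<open>Any direction serves to read off the weights \<open>\<omega>\<close> from the
      field.\<close>
    have ri: "direction (1 / 2) \<in> ri_U" by simp
    have E: "E i \<in> events" "prob (E i) = prob {p \<in> space M. crosses (\<lambda>v. \<omega> v p) (2 ^ i)
      (\<lambda>a. 2 * D * 2 ^ i \<le> a \<and> a \<le> (1 - 2 * D) * 2 ^ i)}" for i
    proof -
      have P: "Measurable.pred (field_space UNIV) (\<lambda>f. crosses (\<lambda>v. fst (f (v, direction (1 / 2)))) (2 ^ i)
          (\<lambda>a. 2 * D * 2 ^ i \<le> a \<and> a \<le> (1 - 2 * D) * 2 ^ i))"
        by (rule pred_crosses) (rule field_component_measurable[OF ri])
      show "E i \<in> events" "prob (E i) = prob {p \<in> space M. crosses (\<lambda>v. \<omega> v p) (2 ^ i)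
          (\<lambda>a. 2 * D * 2 ^ i \<le> a \<and> a \<le> (1 - 2 * D) * 2 ^ i)}"
        unfolding E_def
        using fp.prob_eq(1,2)[of "\<lambda>_. direction (1 / 2)" "\<lambda>w I J. crosses w (2 ^ i)
          (\<lambda>a. 2 * D * 2 ^ i \<le> a \<and> a \<le> (1 - 2 * D) * 2 ^ i)", OF ri P] by simp_all
    qed
    have "filterlim (\<lambda>i::nat. (2::nat) ^ i) at_top sequentially"
      by (rule filterlim_at_top_mono[OF filterlim_ident]) (auto intro!: always_eventually less_imp_le[OF less_exp])
    from eventually_compose_filterlim[OF decay this]
    have ev: "eventually (\<lambda>i. norm (prob (E i)) \<le> K * (2 ^ i) powr - e) sequentially"
      unfolding E(2) by (auto elim!: eventually_mono)
    have "summable (\<lambda>i. prob (E i))"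
      by (rule summable_comparison_test_ev[OF ev]) (intro summable_mult summable_dyadic e)
    then have "AE p in M. eventually (\<lambda>i. p \<in> space M - E i) sequentially"
      using E(1) by (intro borel_cantelli_AE1) (auto simp: less_top[symmetric])
    then show ?thesis by eventually_elim (auto simp: E_def elim: eventually_mono)
  qed
  then show ?thesis by (simp add: AE_all_countable)
qed

end

section \<open>Bi-infinite geodesics\<close>

lemma bi_infinite_step: "bi_infinite_geodesic w \<pi> \<Longrightarrow> up_right_step (\<pi> n) (\<pi> (n + 1))"
  by (simp add: bi_infinite_geodesic_def)

lemma bi_infinite_step_cases:
  assumes "bi_infinite_geodesic w \<pi>"
  shows "\<pi> (n + 1) = \<pi> n + (1, 0) \<or> \<pi> (n + 1) = \<pi> n + (0, 1)"
  using bi_infinite_step[OF assms, of n] by (auto simp: up_right_step_def algebra_simps)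

text \<open>Cutting at a step rather than at a site shares no weight between the two parts, which
  are geodesics themselves.\<close>

lemma bi_infinite_split:
  assumes bg: "bi_infinite_geodesic w \<pi>" and "m \<le> k" "k < n"
  shows "lpp w (\<pi> m) (\<pi> n) = lpp w (\<pi> m) (\<pi> k) + lpp w (\<pi> (k + 1)) (\<pi> n)"
proof -
  have g: "path_weight w (map \<pi> [i..j]) = lpp w (\<pi> i) (\<pi> j)" if "i \<le> j" for i j
    using bg that by (auto simp: bi_infinite_geodesic_def geodesic_def)
  have "[m..n] = [m..k] @ [k + 1..n]" using assms by (intro upto_split2) auto
  then have "path_weight w (map \<pi> [m..n]) = path_weight w (map \<pi> [m..k]) + path_weight w (map \<pi> [k + 1..n])"
    by simp
  then show ?thesis using g[of m n] g[of m k] g[of "k + 1" n] assms by simp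
qed

lemma bi_infinite_coords:
  assumes bg: "bi_infinite_geodesic w \<pi>" and "m \<le> n"
  shows "fst (\<pi> m) \<le> fst (\<pi> n) \<and> snd (\<pi> m) \<le> snd (\<pi> n) \<and>
    fst (\<pi> n) + snd (\<pi> n) = fst (\<pi> m) + snd (\<pi> m) + (n - m)"
  using assms(2)
proof (induction n rule: int_ge_induct)
  case (step i)
  then show ?case using bi_infinite_step_cases[OF bg, of i] by auto
qed simp

text \<open>Turns statements about the past of a path into statements about its future; indices are
  reversed along with sites so that steps remain up-right.\<close>

lemma bi_infinite_reflect:
  assumes bg: "bi_infinite_geodesic w \<pi>"
  shows "bi_infinite_geodesic (\<lambda>v. w (- v)) (\<lambda>n. - \<pi> (- n))"
  unfolding bi_infinite_geodesic_def
proof (intro conjI allI impI)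
  fix n
  show "up_right_step (- \<pi> (- n)) (- \<pi> (- (n + 1)))"
  proof -
    have "\<pi> (- (n + 1) + 1) = \<pi> (- (n + 1)) + (1, 0) \<or> \<pi> (- (n + 1) + 1) = \<pi> (- (n + 1)) + (0, 1)"
      by (rule bi_infinite_step_cases[OF bg])
    moreover have "- (n + 1) + 1 = - n" by simp
    ultimately have "\<pi> (- n) = \<pi> (- (n + 1)) + (1, 0) \<or> \<pi> (- n) = \<pi> (- (n + 1)) + (0, 1)"
      by (simp only:)
    moreover have "- u - - v = e" if "v = u + e" for u v e :: site using that by simp
    ultimately have "- \<pi> (- (n + 1)) - - \<pi> (- n) = (1, 0) \<or> - \<pi> (- (n + 1)) - - \<pi> (- n) = (0, 1)"
      by blast
    then show ?thesis by (simp only: up_right_step_def insert_iff empty_iff simp_thms)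
  qed
next
  fix m n :: int assume mn: "m \<le> n"
  have g: "geodesic w (\<pi> (- n)) (\<pi> (- m)) (map \<pi> [- n..- m])"
    using bg mn by (simp add: bi_infinite_geodesic_def)
  have up: "map (\<lambda>i. \<pi> (- i)) [m..n] = rev (map \<pi> [- n..- m])"
  proof (rule nth_equalityI)
    show "length (map (\<lambda>i. \<pi> (- i)) [m..n]) = length (rev (map \<pi> [- n..- m]))" by simp
    fix i assume "i < length (map (\<lambda>i. \<pi> (- i)) [m..n])"
    then have i: "i < nat (n - m + 1)" by simp
    have "rev (map \<pi> [- n..- m]) ! i = map \<pi> [- n..- m] ! (nat (n - m + 1) - 1 - i)"
      using i by (subst rev_nth) auto
    also have "\<dots> = \<pi> (- n + int (nat (n - m + 1) - 1 - i))"
      using i by (subst nth_map) (auto simp: nth_upto)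
    also have "- n + int (nat (n - m + 1) - 1 - i) = - (m + int i)" using i mn by simp
    finally show "map (\<lambda>i. \<pi> (- i)) [m..n] ! i = rev (map \<pi> [- n..- m]) ! i"
      using i by (simp add: nth_upto)
  qed
  have m: "map (\<lambda>n. - \<pi> (- n)) [m..n] = rev (map uminus (map \<pi> [- n..- m]))"
    using arg_cong[OF up, of "map uminus"] by (simp add: rev_map comp_def)
  have st: "up_right_step (- u) (- v) = up_right_step v u" for u v
    by (cases u; cases v) (auto simp: up_right_step_def)
  have ne: "map \<pi> [- n..- m] \<noteq> []" using mn by simp
  have sw: "(\<Sum>v\<leftarrow>map uminus xs. w (- v)) = (\<Sum>v\<leftarrow>xs. w v)" for xs by (simp add: comp_def)
  show "geodesic (\<lambda>v. w (- v)) (- \<pi> (- m)) (- \<pi> (- n)) (map (\<lambda>n. - \<pi> (- n)) [m..n])"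
    unfolding geodesic_def m lpp_reflect
    using g ne
    by (auto simp: geodesic_def up_right_paths_def path_weight_def hd_rev last_rev hd_map last_map
        successively_map st sw rev_map[symmetric] simp del: map_map)
qed

lemma bi_infinite_nontrivial:
  assumes bg: "bi_infinite_geodesic w \<pi>" and nt: "\<not> trivial_path \<pi>"
  shows "\<exists>n. \<pi> (n + 1) = \<pi> n + (1, 0)" "\<exists>n. \<pi> (n + 1) = \<pi> n + (0, 1)"
proof -
  have *: "\<pi> = (\<lambda>j. \<pi> 0 + (j * fst e, j * snd e))" if "\<And>n. \<pi> (n + 1) = \<pi> n + e" for e
  proof
    fix j :: int
    show "\<pi> j = \<pi> 0 + (j * fst e, j * snd e)"
    proof (induction j rule: int_induct[where k = 0])
      case base then show ?case by (cases "\<pi> 0") simp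
    next
      case (step1 i)
      then show ?case using that[of i] by (cases "\<pi> 0"; cases e) (simp add: algebra_simps)
    next
      case (step2 i)
      then show ?case using that[of "i - 1"] by (cases "\<pi> 0"; cases e; cases "\<pi> (i - 1)") (simp add: algebra_simps)
    qed
  qed
  show "\<exists>n. \<pi> (n + 1) = \<pi> n + (1, 0)"
  proof (rule ccontr)
    assume "\<not> ?thesis"
    then have "\<pi> (n + 1) = \<pi> n + (0, 1)" for n using bi_infinite_step_cases[OF bg] by blast
    from *[OF this] have "\<pi> = (\<lambda>j. \<pi> 0 + (0, j))"
      unfolding fst_conv snd_conv mult_zero_right mult_1_right .
    then show False using nt unfolding trivial_path_def by blast
  qed
  show "\<exists>n. \<pi> (n + 1) = \<pi> n + (0, 1)"
  proof (rule ccontr)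
    assume "\<not> ?thesis"
    then have "\<pi> (n + 1) = \<pi> n + (1, 0)" for n using bi_infinite_step_cases[OF bg] by blast
    from *[OF this] have "\<pi> = (\<lambda>j. \<pi> 0 + (j, 0))"
      unfolding fst_conv snd_conv mult_zero_right mult_1_right .
    then show False using nt unfolding trivial_path_def by blast
  qed
qed

text \<open>The conclusion of \<open>not_asymptotic_to_e1\<close> and
  \<open>not_asymptotic_to_e2\<close> for one realization, isolated so that the remaining argument
  is deterministic and applies to the reflected weights as well.\<close>

definition avoids_axes :: "(site \<Rightarrow> real) \<Rightarrow> bool" where
  "avoids_axes w \<longleftrightarrow>
   (\<forall>x1 x2 y1 y2 (a :: nat \<Rightarrow> int).
     eventually (\<lambda>i. (x1 - a i, x2 - (2 ^ i - a i)) \<le> (y1, y2 - 1) \<and>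
       lpp w (x1 - a i, x2 - (2 ^ i - a i)) (y1, y2)
       = lpp w (x1 - a i, x2 - (2 ^ i - a i)) (y1, y2 - 1) + w (y1, y2)) sequentially \<longrightarrow>
     (\<exists>\<epsilon>>0. eventually (\<lambda>i. \<epsilon> * 2 ^ i \<le> real_of_int (2 ^ i - a i)) sequentially)) \<and>
   (\<forall>x1 x2 y1 y2 (b :: nat \<Rightarrow> int).
     eventually (\<lambda>i. (x1 - (2 ^ i - b i), x2 - b i) \<le> (y1 - 1, y2) \<and>
       lpp w (x1 - (2 ^ i - b i), x2 - b i) (y1, y2)
       = lpp w (x1 - (2 ^ i - b i), x2 - b i) (y1 - 1, y2) + w (y1, y2)) sequentially \<longrightarrow>
     (\<exists>\<epsilon>>0. eventually (\<lambda>i. \<epsilon> * 2 ^ i \<le> real_of_int (2 ^ i - b i)) sequentially))"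

lemma eventually_dyadic_ge: "eventually (\<lambda>i::nat. (c::int) \<le> 2 ^ i) sequentially"
proof -
  have "filterlim (\<lambda>i::nat. (2::int) ^ i) at_top sequentially"
    by (rule filterlim_at_top_mono[OF filterlim_int_sequentially]) (auto intro!: always_eventually less_imp_le[OF of_nat_less_two_power])
  then show ?thesis by (simp add: filterlim_at_top)
qed

text \<open>A vertical step anywhere on the path keeps its past away from the horizontal axis, and a
  horizontal step keeps it away from the vertical one; a non-trivial path has both.\<close>

lemma backward_direction:
  assumes bg: "bi_infinite_geodesic w \<pi>" and av: "avoids_axes w"
    and e1: "\<pi> (n1 + 1) = \<pi> n1 + (1, 0)" and e2: "\<pi> (n2 + 1) = \<pi> n2 + (0, 1)"
  shows "\<exists>\<epsilon>>0. eventually (\<lambda>i. \<epsilon> * 2 ^ i \<le> real_of_int (fst (\<pi> n) - fst (\<pi> (n - 2 ^ i))) \<and>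
    \<epsilon> * 2 ^ i \<le> real_of_int (2 ^ i - (fst (\<pi> n) - fst (\<pi> (n - 2 ^ i))))) sequentially"
proof -
  define a where "a i = fst (\<pi> n) - fst (\<pi> (n - 2 ^ i))" for i :: nat
  define x1 where "x1 = fst (\<pi> n)"
  define x2 where "x2 = snd (\<pi> n)"
  have pos: "\<pi> (n - 2 ^ i) = (x1 - a i, x2 - (2 ^ i - a i))" for i :: nat
    using bi_infinite_coords[OF bg, of "n - 2 ^ i" n] by (simp add: prod_eq_iff a_def x1_def x2_def)
  have last: "lpp w (\<pi> m) (\<pi> (k + 1)) = lpp w (\<pi> m) (\<pi> k) + w (\<pi> (k + 1)) \<and> \<pi> m \<le> \<pi> k" if "m \<le> k" for m k
    using bi_infinite_split[OF bg that, of "k + 1"] bi_infinite_coords[OF bg that]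
    by (simp add: less_eq_prod_def)
  have ev: "eventually (\<lambda>i::nat. lpp w (\<pi> (n - 2 ^ i)) (\<pi> (k + 1)) = lpp w (\<pi> (n - 2 ^ i)) (\<pi> k) + w (\<pi> (k + 1))
      \<and> \<pi> (n - 2 ^ i) \<le> \<pi> k) sequentially" for k
    using eventually_dyadic_ge[of "n - k"] by eventually_elim (rule last, simp)
  obtain y1 y2 where y: "\<pi> n2 = (y1, y2 - 1)" "\<pi> (n2 + 1) = (y1, y2)"
    using e2 by (cases "\<pi> n2") (metis add.commute add_Pair add_diff_cancel_right' add.right_neutral)
  obtain z1 z2 where z: "\<pi> n1 = (z1 - 1, z2)" "\<pi> (n1 + 1) = (z1, z2)"
    using e1 by (cases "\<pi> n1") (metis add.commute add_Pair add_diff_cancel_right' add.right_neutral)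
  note A1 = av[unfolded avoids_axes_def, THEN conjunct1, rule_format]
  note A2 = av[unfolded avoids_axes_def, THEN conjunct2, rule_format]
  have "\<exists>\<epsilon>>0. eventually (\<lambda>i. \<epsilon> * 2 ^ i \<le> real_of_int (2 ^ i - a i)) sequentially"
    by (rule A1) (use ev[of n2] in \<open>unfold y pos, elim eventually_mono, blast\<close>)
  then obtain \<epsilon> where \<epsilon>: "\<epsilon> > 0" "eventually (\<lambda>i. \<epsilon> * 2 ^ i \<le> real_of_int (2 ^ i - a i)) sequentially" by blast
  \<comment> \<open>The second clause of \<open>avoids_axes\<close> is parametrized by the vertical
    displacement, which is \<open>2 ^ i - a i\<close> here.\<close>
  have "eventually (\<lambda>i. (x1 - (2 ^ i - (2 ^ i - a i)), x2 - (2 ^ i - a i)) \<le> (z1 - 1, z2) \<and>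
       lpp w (x1 - (2 ^ i - (2 ^ i - a i)), x2 - (2 ^ i - a i)) (z1, z2)
       = lpp w (x1 - (2 ^ i - (2 ^ i - a i)), x2 - (2 ^ i - a i)) (z1 - 1, z2) + w (z1, z2)) sequentially"
    using ev[of n1] unfolding z pos by (simp add: conj_commute)
  then have "\<exists>\<epsilon>>0. eventually (\<lambda>i. \<epsilon> * 2 ^ i \<le> real_of_int (2 ^ i - (2 ^ i - a i))) sequentially"
    by (rule A2)
  then obtain \<epsilon>' where \<epsilon>': "\<epsilon>' > 0" "eventually (\<lambda>i. \<epsilon>' * 2 ^ i \<le> real_of_int (a i)) sequentially" by auto
  have "eventually (\<lambda>i. min \<epsilon> \<epsilon>' * 2 ^ i \<le> real_of_int (a i) \<and> min \<epsilon> \<epsilon>' * 2 ^ i \<le> real_of_int (2 ^ i - a i)) sequentially"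
    using \<epsilon>(2) \<epsilon>'(2)
  proof eventually_elim
    case (elim i)
    have "min \<epsilon> \<epsilon>' * 2 ^ i \<le> \<epsilon> * 2 ^ i" "min \<epsilon> \<epsilon>' * 2 ^ i \<le> \<epsilon>' * 2 ^ i"
      by (intro mult_right_mono; simp)+
    then show ?case using elim by (meson order.trans)
  qed
  then show ?thesis using \<epsilon>(1) \<epsilon>'(1) unfolding a_def by (intro exI[of _ "min \<epsilon> \<epsilon>'"]) auto
qed

text \<open>The past and, by reflection, the future keep a positive distance from the axes, hence
  lie in one of the windows at all large dyadic scales. The horizontal edge at \<open>n1\<close> is
  then crossed at each of these scales.\<close>

lemma no_bi_infinite_geodesic:
  fixes D :: "nat \<Rightarrow> real"
  assumes av: "avoids_axes w" "avoids_axes (\<lambda>v. w (- v))"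
    and D: "\<And>\<epsilon>. \<epsilon> > 0 \<Longrightarrow> \<exists>n. D n \<le> \<epsilon>"
    and cr: "\<And>n x. eventually (\<lambda>i. \<not> crosses (\<lambda>v. w (v + x)) (2 ^ i)
      (\<lambda>a. 2 * D n * 2 ^ i \<le> a \<and> a \<le> (1 - 2 * D n) * 2 ^ i)) sequentially"
    and bg: "bi_infinite_geodesic w \<pi>" and nt: "\<not> trivial_path \<pi>"
  shows False
proof -
  obtain n1 n2 where e1: "\<pi> (n1 + 1) = \<pi> n1 + (1, 0)" and e2: "\<pi> (n2 + 1) = \<pi> n2 + (0, 1)"
    using bi_infinite_nontrivial[OF bg nt] by blast
  define x where "x = \<pi> n1"
  define a where "a i = fst x - fst (\<pi> (n1 - 2 ^ i))" for i :: nat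
  define b where "b i = fst (\<pi> (n1 + 2 ^ i)) - fst x" for i :: nat
  obtain \<epsilon> where \<epsilon>: "\<epsilon> > 0" "eventually (\<lambda>i. \<epsilon> * 2 ^ i \<le> real_of_int (a i) \<and> \<epsilon> * 2 ^ i \<le> real_of_int (2 ^ i - a i)) sequentially"
    using backward_direction[OF bg av(1) e1 e2, of n1] unfolding a_def x_def by blast
  \<comment> \<open>Reflection reverses indices, so the step leaving \<open>n1\<close> becomes the
    step leaving \<open>- n1 - 1\<close>.\<close>
  have r1: "- \<pi> (- ((- n1 - 1) + 1)) = - \<pi> (- (- n1 - 1)) + (1, 0)"
  proof -
    have "- ((- n1 - 1) + 1) = n1" "- (- n1 - 1) = n1 + 1" by simp_all
    then show ?thesis unfolding e1 by (simp only: e1) (cases "\<pi> n1"; simp)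
  qed
  have r2: "- \<pi> (- ((- n2 - 1) + 1)) = - \<pi> (- (- n2 - 1)) + (0, 1)"
  proof -
    have "- ((- n2 - 1) + 1) = n2" "- (- n2 - 1) = n2 + 1" by simp_all
    then show ?thesis unfolding e2 by (simp only: e2) (cases "\<pi> n2"; simp)
  qed
  obtain \<epsilon>' where \<epsilon>': "\<epsilon>' > 0" "eventually (\<lambda>i. \<epsilon>' * 2 ^ i \<le> real_of_int (b i) \<and> \<epsilon>' * 2 ^ i \<le> real_of_int (2 ^ i - b i)) sequentially"
    using backward_direction[OF bi_infinite_reflect[OF bg] av(2) r1 r2, of "- n1"]
    unfolding b_def x_def by (auto simp: algebra_simps)
  obtain n where n: "D n \<le> min \<epsilon> \<epsilon>' / 2" using D[of "min \<epsilon> \<epsilon>' / 2"] \<epsilon>(1) \<epsilon>'(1) by auto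
  have "eventually (\<lambda>i::nat. False) sequentially"
    using cr[of x n] \<epsilon>(2) \<epsilon>'(2)
  proof eventually_elim
    case (elim i)
    have d: "2 * D n * 2 ^ i \<le> \<epsilon> * 2 ^ i" "2 * D n * 2 ^ i \<le> \<epsilon>' * 2 ^ i"
      using n by (intro mult_right_mono; simp)+
    have pa: "\<pi> (n1 - 2 ^ i) = south_west (2 ^ i) (a i) + x"
      using bi_infinite_coords[OF bg, of "n1 - 2 ^ i" n1] by (simp add: prod_eq_iff south_west_def a_def x_def)
    have pb: "\<pi> (n1 + 2 ^ i) = north_east (2 ^ i) (b i) + x"
      using bi_infinite_coords[OF bg, of n1 "n1 + 2 ^ i"] by (simp add: prod_eq_iff north_east_def b_def x_def)
    have p0: "\<pi> n1 = (0, 0) + x" "\<pi> (n1 + 1) = (1, 0) + x"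
      unfolding e1 unfolding x_def by (cases "\<pi> n1"; simp)+
    have "lpp w (\<pi> (n1 - 2 ^ i)) (\<pi> (n1 + 2 ^ i)) = lpp w (\<pi> (n1 - 2 ^ i)) (\<pi> n1) + lpp w (\<pi> (n1 + 1)) (\<pi> (n1 + 2 ^ i))"
      by (rule bi_infinite_split[OF bg]) auto
    then have "crosses (\<lambda>v. w (v + x)) (2 ^ i) (\<lambda>a. 2 * D n * 2 ^ i \<le> a \<and> a \<le> (1 - 2 * D n) * 2 ^ i)"
      unfolding crosses_def lpp_translate pa pb p0
    proof (intro exI conjI)
      have e: "(1 - 2 * D n) * 2 ^ i = 2 ^ i - 2 * D n * 2 ^ i" by (simp add: algebra_simps)
      show "2 * D n * 2 ^ i \<le> a i" "2 * D n * 2 ^ i \<le> b i"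
        using elim(2,3) d by (meson order.trans)+
      have f: "real_of_int (2 ^ i - a i) = 2 ^ i - real_of_int (a i)"
        "real_of_int (2 ^ i - b i) = 2 ^ i - real_of_int (b i)" by simp_all
      show "a i \<le> (1 - 2 * D n) * 2 ^ i" "b i \<le> (1 - 2 * D n) * 2 ^ i"
        unfolding e using elim(2,3) d unfolding f by linarith+
    qed
    then show False using elim(1) by simp
  qed
  then show False by simp
qed

section \<open>Consequences of the hypotheses\<close>

text \<open>
  Along a ray from the origin both one-sided difference quotients of a homogeneous function are
  governed by the same right derivative, so Euler's identity holds for the one-sided gradient.
\<close>

lemma grad_plus_euler:
  assumes hom: "\<And>c x. 0 \<le> c \<Longrightarrow> 0 \<le> x \<Longrightarrow> \<gamma> (c *\<^sub>R x) = c * \<gamma> (x :: real \<times> real)"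
    and t: "0 < t" "t < 1" and grad: "has_grad_plus \<gamma> (direction t) v"
  shows "\<gamma> (direction t) = t * fst v + (1 - t) * snd v"
proof -
  define g where "g = \<gamma> (direction t)"
  \<comment> \<open>Chosen such that \<open>direction t - r \<epsilon> *\<^sub>R (0, 1)\<close>,
    scaled by \<open>(t + \<epsilon>) / t\<close>, is
    \<open>direction t + \<epsilon> *\<^sub>R (1, 0)\<close>; homogeneity then converts one
    difference quotient into the other.\<close>
  define r where "r \<epsilon> = \<epsilon> * (1 - t) / (t + \<epsilon>)" for \<epsilon>
  have r: "filterlim r (at_right 0) (at_right 0)"
    unfolding filterlim_at
  proof
    have "(r \<longlongrightarrow> 0 * (1 - t) / (t + 0)) (at_right 0)"
      unfolding r_def by (intro tendsto_intros) (use t in auto)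
    then show "(r \<longlongrightarrow> 0) (at_right 0)" by simp
    show "eventually (\<lambda>\<epsilon>. r \<epsilon> \<in> {0<..} \<and> r \<epsilon> \<noteq> 0) (at_right 0)"
      using eventually_at_right_less[of 0] by eventually_elim (use t in \<open>auto simp: r_def\<close>)
  qed
  have l1: "((\<lambda>\<epsilon>. (\<gamma> (direction t + \<epsilon> *\<^sub>R (1, 0)) - g) / \<epsilon>) \<longlongrightarrow> fst v) (at_right 0)"
    and l2: "((\<lambda>\<epsilon>. (g - \<gamma> (direction t - \<epsilon> *\<^sub>R (0, 1))) / \<epsilon>) \<longlongrightarrow> snd v) (at_right 0)"
    using grad by (auto simp: has_grad_plus_def g_def)
  have "((\<lambda>\<epsilon>. g / t - (1 - t) / t * ((g - \<gamma> (direction t - r \<epsilon> *\<^sub>R (0, 1))) / r \<epsilon>))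
      \<longlongrightarrow> g / t - (1 - t) / t * snd v) (at_right 0)"
    by (intro tendsto_intros filterlim_compose[OF l2 r])
  moreover have "eventually (\<lambda>\<epsilon>. g / t - (1 - t) / t * ((g - \<gamma> (direction t - r \<epsilon> *\<^sub>R (0, 1))) / r \<epsilon>)
      = (\<gamma> (direction t + \<epsilon> *\<^sub>R (1, 0)) - g) / \<epsilon>) (at_right 0)"
    using eventually_at_right_less[of 0]
  proof eventually_elim
    case (elim \<epsilon>)
    define u where "u = \<gamma> (direction t - r \<epsilon> *\<^sub>R (0, 1))"
    have "\<epsilon> * (1 - t) \<le> (t + \<epsilon>) * (1 - t)" using t by (intro mult_right_mono) auto
    then have "r \<epsilon> \<le> 1 - t" using t elim by (simp add: r_def pos_divide_le_eq mult.commute)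
    then have "0 \<le> direction t - r \<epsilon> *\<^sub>R (0, 1)"
      using t by (simp add: direction_def less_eq_prod_def)
    then have "\<gamma> (((t + \<epsilon>) / t) *\<^sub>R (direction t - r \<epsilon> *\<^sub>R (0, 1))) = (t + \<epsilon>) / t * u"
      unfolding u_def using t elim by (intro hom) auto
    moreover have "((t + \<epsilon>) / t) *\<^sub>R (direction t - r \<epsilon> *\<^sub>R (0, 1)) = direction t + \<epsilon> *\<^sub>R (1, 0)"
    proof -
      have "1 - t - r \<epsilon> = ((1 - t) * (t + \<epsilon>) - \<epsilon> * (1 - t)) / (t + \<epsilon>)"
        using t elim by (simp add: r_def diff_divide_distrib)
      also have "(1 - t) * (t + \<epsilon>) - \<epsilon> * (1 - t) = (1 - t) * t" by (simp add: algebra_simps)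
      finally have "(t + \<epsilon>) / t * (1 - t - r \<epsilon>) = 1 - t" using t elim by simp
      then show ?thesis using t by (simp add: direction_def)
    qed
    ultimately have "\<gamma> (direction t + \<epsilon> *\<^sub>R (1, 0)) = (t + \<epsilon>) / t * u" by simp
    moreover have "g / t - (1 - t) / t * ((g - u) / r \<epsilon>) = ((t + \<epsilon>) / t * u - g) / \<epsilon>"
    proof -
      have "(1 - t) / t * ((g - u) / r \<epsilon>) = (g - u) * (t + \<epsilon>) / (t * \<epsilon>)"
        using t elim by (simp add: r_def field_simps)
      also have "g / t - \<dots> = (g * \<epsilon> - (g - u) * (t + \<epsilon>)) / (t * \<epsilon>)"
        using t elim by (simp add: field_simps)
      also have "g * \<epsilon> - (g - u) * (t + \<epsilon>) = (t + \<epsilon>) * u - g * t" by (simp add: algebra_simps)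
      also have "((t + \<epsilon>) * u - g * t) / (t * \<epsilon>) = ((t + \<epsilon>) / t * u - g) / \<epsilon>"
        using t elim by (simp add: field_simps)
      finally show ?thesis .
    qed
    ultimately show ?case by (simp add: u_def)
  qed
  ultimately have "((\<lambda>\<epsilon>. (\<gamma> (direction t + \<epsilon> *\<^sub>R (1, 0)) - g) / \<epsilon>) \<longlongrightarrow> g / t - (1 - t) / t * snd v) (at_right 0)"
    by (rule Lim_transform_eventually)
  then have "fst v = g / t - (1 - t) / t * snd v"
    using tendsto_unique[OF trivial_limit_at_right_real l1] by blast
  then show ?thesis using t by (simp add: g_def field_simps)
qed

text \<open>As \<open>u\<close> is at least \<open>\<mu>\<close>, the identity bounds
  \<open>v\<close> above by \<open>(g - \<tau> * \<mu>) / (1 - \<tau>)\<close>, which tends to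
  \<open>\<mu>\<close> even if \<open>u\<close> is unbounded.\<close>

lemma sandwich_expectation:
  fixes \<mu> :: real and g v u \<tau> :: "nat \<Rightarrow> real"
  assumes \<tau>: "\<And>m. \<tau> m = 1 / (real m + 2)" and g: "g \<longlonglongrightarrow> \<mu>"
    and eq: "\<And>m. g m = (1 - \<tau> m) * v m + \<tau> m * u m" and ge: "\<And>m. \<mu> \<le> v m" "\<And>m. \<mu> \<le> u m"
  shows "v \<longlonglongrightarrow> \<mu>"
proof (rule tendsto_sandwich[where f = "\<lambda>_. \<mu>"])
  have \<tau>01: "0 < \<tau> m" "\<tau> m < 1" for m unfolding \<tau> by (auto simp: field_simps)
  have "\<tau> \<longlonglongrightarrow> 0" unfolding \<tau>[abs_def] by real_asymp
  then have "(\<lambda>m. (g m - \<tau> m * \<mu>) / (1 - \<tau> m)) \<longlonglongrightarrow> (\<mu> - 0 * \<mu>) / (1 - 0)"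
    by (intro tendsto_intros g) auto
  then show "(\<lambda>m. (g m - \<tau> m * \<mu>) / (1 - \<tau> m)) \<longlonglongrightarrow> \<mu>" by simp
  have "v m \<le> (g m - \<tau> m * \<mu>) / (1 - \<tau> m)" for m
  proof -
    have "\<tau> m * \<mu> \<le> \<tau> m * u m" using \<tau>01[of m] ge by (intro mult_left_mono) auto
    then have "v m * (1 - \<tau> m) \<le> g m - \<tau> m * \<mu>" unfolding eq by (simp add: mult.commute)
    then show ?thesis using \<tau>01[of m] by (simp add: pos_le_divide_eq)
  qed
  then show "eventually (\<lambda>m. v m \<le> (g m - \<tau> m * \<mu>) / (1 - \<tau> m)) sequentially" by simp
qed (use ge in auto)

section \<open>The limit shape on the axes\<close>

context prob_space
begin

text \<open>Second moments give almost sure convergence to the mean along a subsequence, which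
  identifies a limit already known to exist.\<close>

lemma average_limit_unique:
  fixes \<omega> :: "'b \<Rightarrow> 'a \<Rightarrow> real" and u :: "nat \<Rightarrow> 'b"
  assumes ind: "indep_vars (\<lambda>_. borel) \<omega> UNIV"
    and ident: "\<And>x y. distr M borel (\<omega> x) = distr M borel (\<omega> y)"
    and sq: "\<And>x. integrable M (\<lambda>p. (\<omega> x p)\<^sup>2)" and inj: "inj u"
    and lim: "AE p in M. (\<lambda>n. (\<Sum>i\<le>n. \<omega> (u i) p) / real n) \<longlonglongrightarrow> c"
  shows "expectation (\<omega> x) = c"
proof -
  have rv [measurable]: "\<omega> y \<in> borel_measurable M" for y
    using ind by (auto simp: indep_vars_def)
  have int: "integrable M (\<omega> y)" for y
    by (rule square_integrable_imp_integrable[OF rv sq])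
  define \<mu> where "\<mu> = expectation (\<omega> x)"
  define s where "s = expectation (\<lambda>p. (\<omega> x p - \<mu>)\<^sup>2)"
  have mean: "expectation (\<omega> y) = \<mu>" and var: "expectation (\<lambda>p. (\<omega> y p - \<mu>)\<^sup>2) = s" for y
  proof -
    have "expectation (\<omega> z) = (\<integral>r. r \<partial>distr M borel (\<omega> z))"
      "expectation (\<lambda>p. (\<omega> z p - \<mu>)\<^sup>2) = (\<integral>r. (r - \<mu>)\<^sup>2 \<partial>distr M borel (\<omega> z))" for z
      by (simp_all add: integral_distr)
    then show "expectation (\<omega> y) = \<mu>" "expectation (\<lambda>p. (\<omega> y p - \<mu>)\<^sup>2) = s"
      using ident[of y x] by (simp_all add: \<mu>_def s_def)
  qed
  define Y where "Y i p = \<omega> (u i) p - \<mu>" for i p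
  have Yint: "integrable M (\<lambda>p. Y i p * Y j p)"
    and Yexp: "expectation (\<lambda>p. Y i p * Y j p) = (if i = j then s else 0)" for i j
  proof -
    have "integrable M (\<lambda>p. Y i p * Y j p) \<and> expectation (\<lambda>p. Y i p * Y j p) = (if i = j then s else 0)"
    proof (cases "i = j")
      case True
      have "(\<lambda>p. Y i p * Y i p) = (\<lambda>p. (\<omega> (u i) p)\<^sup>2 - 2 * \<mu> * \<omega> (u i) p + \<mu>\<^sup>2)"
        by (simp add: Y_def fun_eq_iff power2_eq_square algebra_simps)
      then have "integrable M (\<lambda>p. Y i p * Y i p)" using sq int by simp
      then show ?thesis using True var[of "u i"] by (simp add: Y_def power2_eq_square)
    next
      case False
      have "indep_var borel (\<omega> (u i)) borel (\<omega> (u j))"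
        using False inj by (intro indep_pair[OF ind]) (auto dest: injD)
      from indep_var_compose[OF this, of "\<lambda>r. r - \<mu>" borel "\<lambda>r. r - \<mu>" borel]
      have "indep_var borel (Y i) borel (Y j)" by (simp add: Y_def[abs_def] comp_def)
      moreover have "integrable M (Y k)" "expectation (Y k) = 0" for k
        using int mean[of "u k"] by (simp_all add: Y_def[abs_def] prob_space)
      ultimately show ?thesis
        using False by (simp add: indep_var_integrable indep_var_lebesgue_integral)
    qed
    then show "integrable M (\<lambda>p. Y i p * Y j p)"
      "expectation (\<lambda>p. Y i p * Y j p) = (if i = j then s else 0)" by auto
  qed
  define Z where "Z n p = ((\<Sum>i\<le>n. Y i p) / real n)\<^sup>2" for n p
  have Z: "Z n p = (\<Sum>i\<le>n. \<Sum>j\<le>n. Y i p * Y j p) / (real n)\<^sup>2" for n p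
    by (simp add: Z_def power_divide power2_eq_square sum_product)
  have Zint: "integrable M (Z n)" for n
    unfolding Z[abs_def] using Yint by simp
  have Zexp: "(\<integral>p. norm (Z n p) \<partial>M) = (real n + 1) * s / (real n)\<^sup>2" for n
  proof -
    have "(\<integral>p. norm (Z n p) \<partial>M) = expectation (Z n)" by (simp add: Z_def[abs_def])
    also have "\<dots> = (\<Sum>i\<le>n. \<Sum>j\<le>n. if i = j then s else 0) / (real n)\<^sup>2"
      unfolding Z[abs_def] using Yint by (simp add: Yexp)
    also have "\<dots> = (real n + 1) * s / (real n)\<^sup>2" by (simp add: sum.delta)
    finally show ?thesis .
  qed
  have "(\<lambda>n. \<integral>p. norm (Z n p) \<partial>M) \<longlonglongrightarrow> 0"
    unfolding Zexp by real_asymp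
  from tendsto_L1_AE_subseq[OF Zint this]
  obtain r where r: "strict_mono r" "AE p in M. (\<lambda>n. Z (r n) p) \<longlonglongrightarrow> 0" by auto
  from r(2) lim have "AE p in M. (c - \<mu>)\<^sup>2 = 0"
  proof eventually_elim
    case (elim p)
    \<comment> \<open>There are \<open>n + 1\<close> summands over the divisor \<open>n\<close>, so
      the centring carries the factor \<open>(n + 1) / n\<close>.\<close>
    have "(\<lambda>n. (\<Sum>i\<le>n. \<omega> (u i) p) / real n - \<mu> * ((real n + 1) / real n)) \<longlonglongrightarrow> c - \<mu> * 1"
      by (intro tendsto_intros elim(2)) real_asymp
    moreover have "(\<Sum>i\<le>n. \<omega> (u i) p) / real n - \<mu> * ((real n + 1) / real n) = (\<Sum>i\<le>n. Y i p) / real n" for n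
      by (simp add: Y_def sum_subtractf diff_divide_distrib algebra_simps add_divide_distrib)
    ultimately have "(\<lambda>n. (\<Sum>i\<le>n. Y i p) / real n) \<longlonglongrightarrow> c - \<mu>" by simp
    then have "(\<lambda>n. Z n p) \<longlonglongrightarrow> (c - \<mu>)\<^sup>2" unfolding Z_def by (intro tendsto_intros)
    from LIMSEQ_subseq_LIMSEQ[OF this r(1)] have "(\<lambda>n. Z (r n) p) \<longlonglongrightarrow> (c - \<mu>)\<^sup>2"
      by (simp add: comp_def)
    then show ?case using elim(1) by (rule LIMSEQ_unique)
  qed
  then show ?thesis by (simp add: \<mu>_def)
qed

text \<open>Along an axis there is a single up-right path, so passage times are sums of independent
  weights and the shape limit is their average.\<close>

lemma shape_on_axes:
  fixes \<omega> :: "site \<Rightarrow> 'a \<Rightarrow> real"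
  assumes ind: "indep_vars (\<lambda>_. borel) \<omega> UNIV"
    and ident: "\<And>x y. distr M borel (\<omega> x) = distr M borel (\<omega> y)"
    and sq: "\<And>x. integrable M (\<lambda>p. (\<omega> x p)\<^sup>2)" and shape: "limit_shape M \<omega> \<gamma>"
  shows "\<gamma> (1, 0) = expectation (\<omega> x)" "\<gamma> (0, 1) = expectation (\<omega> x)"
proof -
  have hom: "\<gamma> (c *\<^sub>R z) = c * \<gamma> z" if "0 \<le> c" "0 \<le> z" for c z
    using shape that unfolding limit_shape_def by blast
  have conv: "AE p in M. (\<lambda>n::nat.
           Max ((\<lambda>x. \<bar>lpp (\<lambda>v. \<omega> v p) (0, 0) x - \<gamma> (of_int (fst x), of_int (snd x))\<bar>) `
                  {x. (0, 0) \<le> x \<and> fst x + snd x = int n}) / real n) \<longlonglongrightarrow> 0"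
    using shape unfolding limit_shape_def by blast
  have fin: "finite {x::site. (0, 0) \<le> x \<and> fst x + snd x = int n}" for n
    by (rule finite_subset[of _ "{0..int n} \<times> {0..int n}"]) auto
  have axis: "expectation (\<omega> x) = c"
    if e: "\<And>n::nat. (0, 0) \<le> e n \<and> fst (e n) + snd (e n) = int n"
      and c: "\<And>n. \<gamma> (of_int (fst (e n)), of_int (snd (e n))) = real n * c"
      and G: "\<And>w n. lpp w (0, 0) (e n) = (\<Sum>i\<le>n. w (e i))" and inj: "inj e" for e :: "nat \<Rightarrow> site" and c
  proof (rule average_limit_unique[OF ind ident sq inj])
    show "AE p in M. (\<lambda>n. (\<Sum>i\<le>n. \<omega> (e i) p) / real n) \<longlonglongrightarrow> c"
      using conv
    proof eventually_elim
      case (elim p)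
      have "(\<lambda>n. (\<Sum>i\<le>n. \<omega> (e i) p) / real n - c) \<longlonglongrightarrow> 0"
      proof (rule Lim_null_comparison[OF _ elim])
        have "norm ((\<Sum>i\<le>n. \<omega> (e i) p) / real n - c) \<le> Max ((\<lambda>x. \<bar>lpp (\<lambda>v. \<omega> v p) (0, 0) x - \<gamma> (of_int (fst x), of_int (snd x))\<bar>) `
                  {x. (0, 0) \<le> x \<and> fst x + snd x = int n}) / real n" if n: "0 < n" for n
        proof -
          have "norm ((\<Sum>i\<le>n. \<omega> (e i) p) / real n - c) = \<bar>(\<Sum>i\<le>n. \<omega> (e i) p) - real n * c\<bar> / real n"
            using n by (simp add: field_simps)
          also have "\<dots> \<le> Max ((\<lambda>x. \<bar>lpp (\<lambda>v. \<omega> v p) (0, 0) x - \<gamma> (of_int (fst x), of_int (snd x))\<bar>) `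
                  {x. (0, 0) \<le> x \<and> fst x + snd x = int n}) / real n"
          proof (intro divide_right_mono Max_ge)
            show "\<bar>(\<Sum>i\<le>n. \<omega> (e i) p) - real n * c\<bar> \<in> (\<lambda>x. \<bar>lpp (\<lambda>v. \<omega> v p) (0, 0) x - \<gamma> (of_int (fst x), of_int (snd x))\<bar>) `
                  {x. (0, 0) \<le> x \<and> fst x + snd x = int n}"
              by (rule image_eqI[of _ _ "e n"]) (use e[of n] c[of n] G[of "\<lambda>v. \<omega> v p" n] in auto)
          qed (use fin in auto)
          finally show ?thesis .
        qed
        then show "eventually (\<lambda>n. norm ((\<Sum>i\<le>n. \<omega> (e i) p) / real n - c) \<le> Max ((\<lambda>x. \<bar>lpp (\<lambda>v. \<omega> v p) (0, 0) x - \<gamma> (of_int (fst x), of_int (snd x))\<bar>) `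
                  {x. (0, 0) \<le> x \<and> fst x + snd x = int n}) / real n) sequentially"
          by (meson eventually_gt_at_top eventually_mono)
      qed
      then show ?case by (simp add: LIM_zero_iff)
    qed
  qed
  have "lpp w (0, 0) (int n, 0) = (\<Sum>i\<le>n. w (int i, 0))" "lpp w (0, 0) (0, int n) = (\<Sum>i\<le>n. w (0, int i))" for w n
  proof (induction n)
    case (Suc n)
    { case 1 show ?case using Suc(1) lpp_row[of 0 "int (Suc n)" w 0] by simp }
    { case 2 show ?case using Suc(2) lpp_column[of 0 "int (Suc n)" w 0] by simp }
  qed simp_all
  moreover have "\<gamma> (real n, 0) = real n * \<gamma> (1, 0)" "\<gamma> (0, real n) = real n * \<gamma> (0, 1)" for n
    using hom[of "real n" "(1, 0)"] hom[of "real n" "(0, 1)"] by (simp_all add: less_eq_prod_def)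
  ultimately show "\<gamma> (1, 0) = expectation (\<omega> x)" "\<gamma> (0, 1) = expectation (\<omega> x)"
    using axis[of "\<lambda>n. (int n, 0)" "\<gamma> (1, 0)"] axis[of "\<lambda>n. (0, int n)" "\<gamma> (0, 1)"]
    by (simp_all add: inj_def)
qed

end

section \<open>Transfer to the reflected field and conclusion\<close>

lemma distr_eq_integral:
  fixes f g :: "'a \<Rightarrow> real"
  assumes "f \<in> borel_measurable M" "g \<in> borel_measurable M" "distr M borel f = distr M borel g"
  shows "integrable M f \<longleftrightarrow> integrable M g" "integral\<^sup>L M f = integral\<^sup>L M g"
proof -
  have "integrable M h \<longleftrightarrow> integrable (distr M borel h) (\<lambda>r. r)"
    "integral\<^sup>L M h = integral\<^sup>L (distr M borel h) (\<lambda>r. r)" if "h \<in> borel_measurable M" for h :: "'a \<Rightarrow> real"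
    using that by (simp_all add: integrable_distr_eq integral_distr)
  then show "integrable M f \<longleftrightarrow> integrable M g" "integral\<^sup>L M f = integral\<^sup>L M g"
    using assms by metis+
qed

text \<open>Almost sure properties pass through \<open>AE_transfer\<close>, the tail through
  \<open>prob_eq\<close>, and expectations through the one-site laws.\<close>

lemma boundary_env_law_cong:
  assumes env: "boundary_env M \<omega> I J \<nu>" and fp: "field_pair M \<omega> \<omega>' I J I' J'"
  shows "boundary_env M \<omega>' I' J' \<nu>"
proof -
  interpret boundary_env M \<omega> I J \<nu> by (rule env)
  interpret field_pair M \<omega> \<omega>' I J I' J' by (rule fp)
  note comp = field_component_measurable
  have ri: "direction (1 / 2) \<in> ri_U" by simp
  have w_eq: "expectation (\<omega> x) = expectation (\<omega>' x)" and w_int: "integrable M (\<omega>' x)" for x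
    using distr_eq_integral[OF field_pair.w_meas[OF fp] component_distr_eq(1)[OF ri]] w_integrable by blast+
  have I_eq: "expectation (I \<xi> x) = expectation (I' \<xi> x)" "integrable M (I' \<xi> x)"
    and J_eq: "expectation (J \<xi> x) = expectation (J' \<xi> x)" "integrable M (J' \<xi> x)" if \<xi>: "\<xi> \<in> ri_U" for \<xi> x
    using distr_eq_integral[OF field_pair.I_meas[OF fp \<xi>] component_distr_eq(2)[OF \<xi>]] I_integrable[OF \<xi>]
      distr_eq_integral[OF field_pair.J_meas[OF fp \<xi>] component_distr_eq(3)[OF \<xi>]] J_integrable[OF \<xi>] by blast+
  show ?thesis
  proof (unfold_locales)
    show "\<omega>' x \<in> borel_measurable M" for x by (rule field_pair.w_meas(2)[OF fp])
    show "I' \<xi> x \<in> borel_measurable M" "J' \<xi> x \<in> borel_measurable M" if "\<xi> \<in> ri_U" for \<xi> x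
      using field_pair.I_meas(2)[OF fp that] field_pair.J_meas(2)[OF fp that] .
    show "AE p in M. consistent_weights (\<lambda>v. \<omega>' v p) (\<lambda>v. I' \<xi> v p) (\<lambda>v. J' \<xi> v p)" if \<xi>: "\<xi> \<in> ri_U" for \<xi>
    proof (rule AE_transfer[of "\<lambda>_. \<xi>" "\<lambda>w I J. consistent_weights w (I 0) (J 0)", OF \<xi> _ consistent[OF \<xi>]])
      show "Measurable.pred (field_space UNIV) (\<lambda>f. consistent_weights (\<lambda>x. fst (f (x, \<xi>)))
          (\<lambda>x. fst (snd (f (x, \<xi>)))) (\<lambda>x. snd (snd (f (x, \<xi>)))))"
        by (rule pred_consistent) (rule comp[OF \<xi>])+
    qed
    show "AE p in M. \<forall>x. I' \<zeta> x p \<le> I' \<xi> x p \<and> J' \<xi> x p \<le> J' \<zeta> x p"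
      if \<xi>: "\<xi> \<in> ri_U" and \<zeta>: "\<zeta> \<in> ri_U" and le: "fst \<xi> \<le> fst \<zeta>" for \<xi> \<zeta>
    proof -
      have le_pred: "Measurable.pred Z (\<lambda>f. A f \<le> B f)"
        if "A \<in> borel_measurable Z" "B \<in> borel_measurable Z" for A B :: "_ \<Rightarrow> real" and Z
        using that by measurable
      have "Measurable.pred (field_space UNIV) (\<lambda>f. \<forall>x. fst (snd (f (x, \<zeta>))) \<le> fst (snd (f (x, \<xi>)))
          \<and> snd (snd (f (x, \<xi>))) \<le> snd (snd (f (x, \<zeta>))))"
        by (intro pred_intros_countable pred_intros_logic le_pred comp[OF \<xi>] comp[OF \<zeta>])
      \<comment> \<open>The two directions are encoded as a sequence with value \<open>\<xi>\<close>
        at \<open>0\<close> and \<open>\<zeta>\<close> elsewhere.\<close>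
      then show ?thesis
        using AE_transfer[of "\<lambda>m::nat. if m = 0 then \<xi> else \<zeta>" "\<lambda>w I J. \<forall>x. I 1 x \<le> I 0 x \<and> J 0 x \<le> J 1 x"]
          monotone[OF \<xi> \<zeta> le] \<xi> \<zeta> by simp
    qed
    show "boundary_law M (\<lambda>x. \<omega>' (x + z)) (\<lambda>\<xi> x. I' \<xi> (x + z)) (\<lambda>\<xi> x. J' \<xi> (x + z)) = boundary_law M \<omega>' I' J'" for z
      by (rule trans[OF translate[symmetric] trans[OF translation law]])
    show "exit_tail M \<omega>' I' J' \<nu>"
    proof -
      \<comment> \<open>The cone condition guarantees \<open>(0, 0) \<le> (m, n)\<close>, on which
        measurability of the exit set rests.\<close>
      have eq: "far_exit_prob M \<omega> I J \<xi> m n r = far_exit_prob M \<omega>' I' J' \<xi> m n r"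
        if \<xi>: "\<xi> \<in> ri_U" and mn: "(real_of_int m, real_of_int n) \<in> S_cone \<delta>" for \<xi> m n r \<delta>
        unfolding far_exit_prob_def exit_e1_def exit_e2_def
      proof (rule prob_eq(1)[of "\<lambda>_. \<xi>" "\<lambda>w I J. of_int (max \<bar>Max (exit_set w (I 0) (J 0) (0, 0) (m, n))\<bar>
          \<bar>Min (exit_set w (I 0) (J 0) (0, 0) (m, n))\<bar>) \<ge> r", OF \<xi>])
        show "Measurable.pred (field_space UNIV) (\<lambda>f. r \<le>
          of_int (max \<bar>Max (exit_set (\<lambda>x. fst (f (x, \<xi>))) (\<lambda>x. fst (snd (f (x, \<xi>)))) (\<lambda>x. snd (snd (f (x, \<xi>)))) (0, 0) (m, n))\<bar>
            \<bar>Min (exit_set (\<lambda>x. fst (f (x, \<xi>))) (\<lambda>x. fst (snd (f (x, \<xi>)))) (\<lambda>x. snd (snd (f (x, \<xi>)))) (0, 0) (m, n))\<bar>))"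
          by (rule pred_exit_set) (use comp[OF \<xi>] mn in \<open>auto simp: S_cone_def\<close>)
      qed
      have "exit_tail M \<omega> I J \<nu> \<longleftrightarrow> exit_tail M \<omega>' I' J' \<nu>"
        unfolding exit_tail_def exit_tail_at_def
        by (intro bex_cong ball_cong iff_exI iff_allI conj_cong imp_cong refl) (subst eq; assumption?; rule refl)
      then show ?thesis using tail by simp
    qed
    show "0 < \<nu>" by (rule nu_pos)
    show "integrable M (I' \<xi> x)" "integrable M (J' \<xi> x)" if "\<xi> \<in> ri_U" for \<xi> x
      using I_eq(2)[OF that] J_eq(2)[OF that] .
    show "integrable M (\<omega>' x)" for x by (rule w_int)
    show "(\<lambda>m. expectation (I' (direction (1 - 1 / (real m + 2))) x)) \<longlonglongrightarrow> expectation (\<omega>' x)" for x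
    proof -
      have "direction (1 - 1 / (real m + 2)) \<in> ri_U" for m by (simp add: field_simps)
      from I_eq(1)[OF this] show ?thesis using I_expectation[of x] w_eq[of x] by simp
    qed
    show "(\<lambda>m. expectation (J' (direction (1 / (real m + 2))) x)) \<longlonglongrightarrow> expectation (\<omega>' x)" for x
    proof -
      have "direction (1 / (real m + 2)) \<in> ri_U" for m by (simp add: field_simps)
      from J_eq(1)[OF this] show ?thesis using J_expectation[of x] w_eq[of x] by simp
    qed
  qed
qed

lemma (in iid_env) AE_avoids_axes: "AE p in M. avoids_axes (\<lambda>v. \<omega> v p)"
  using not_asymptotic_to_e1 not_asymptotic_to_e2
  by eventually_elim (simp only: avoids_axes_def simp_thms)

lemma (in prob_space) indep_vars_reflect:
  fixes \<omega> :: "site \<Rightarrow> 'a \<Rightarrow> real"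
  assumes "indep_vars (\<lambda>_. borel) \<omega> UNIV"
  shows "indep_vars (\<lambda>_. borel) (\<lambda>x. \<omega> (- x)) UNIV"
proof -
  have "indep_vars (\<lambda>j. PiM {- j} (\<lambda>_. borel)) (\<lambda>j p. restrict (\<lambda>i. \<omega> i p) {- j}) UNIV"
    by (rule indep_vars_restrict[OF assms]) (auto simp: disjoint_family_on_def)
  then have "indep_vars (\<lambda>_. borel) (\<lambda>j p. (\<lambda>f. f (- j)) (restrict (\<lambda>i. \<omega> i p) {- j})) UNIV"
    by (rule indep_vars_compose2) (auto intro!: measurable_component_singleton)
  then show ?thesis by simp
qed

text \<open>The substantial point is the pair of limits of expectations. Euler's identity writes
  \<open>\<gamma>\<close> near an axis as a combination of the two expectations with a vanishing
  coefficient on one of them; continuity of \<open>\<gamma>\<close> and its value on the axis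
  determine the limit of the other.\<close>

lemma (in prob_space) stationary_boundary_env:
  fixes \<omega> :: "site \<Rightarrow> 'a \<Rightarrow> real"
  assumes ind: "indep_vars (\<lambda>_. borel) \<omega> UNIV"
    and ident: "\<And>x y. distr M borel (\<omega> x) = distr M borel (\<omega> y)"
    and sq: "\<And>x. integrable M (\<lambda>p. (\<omega> x p)\<^sup>2)" and shape: "limit_shape M \<omega> \<gamma>"
    and bd: "stationary_boundary M \<omega> \<gamma> I J" and tail: "exit_tail M \<omega> I J \<nu>" and \<nu>: "0 < \<nu>"
  shows "boundary_env M \<omega> I J \<nu>"
proof -
  have rv: "\<omega> x \<in> borel_measurable M" for x using ind unfolding indep_vars_def by blast
  have w_int: "integrable M (\<omega> x)" for x by (rule square_integrable_imp_integrable[OF rv sq])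
  note bd' = bd[unfolded stationary_boundary_def Let_def]
  have meas: "I \<xi> x \<in> borel_measurable M" "J \<xi> x \<in> borel_measurable M" if "\<xi> \<in> ri_U" for \<xi> x
    using bd' that by blast+
  have int: "integrable M (I \<xi> x)" "integrable M (J \<xi> x)"
    and grad: "has_grad_plus \<gamma> \<xi> (expectation (I \<xi> x), expectation (J \<xi> x))" if "\<xi> \<in> ri_U" for \<xi> x
    using bd' that by blast+
  have AE: "AE p in M.
        (\<forall>x. \<forall>\<xi>\<in>ri_U. \<forall>\<zeta>\<in>ri_U. fst \<xi> \<le> fst \<zeta> \<longrightarrow>
           \<omega> x p = min (I \<xi> x p) (J \<xi> x p) \<and>
           \<omega> x p \<le> I \<zeta> x p \<and> I \<zeta> x p \<le> I \<xi> x p \<and>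
           \<omega> x p \<le> J \<xi> x p \<and> J \<xi> x p \<le> J \<zeta> x p) \<and>
        (\<forall>\<xi>\<in>ri_U. \<forall>x y z. x \<le> y \<and> y \<le> z \<longrightarrow>
           lpp_bd (\<lambda>v. \<omega> v p) (\<lambda>v. I \<xi> v p) (\<lambda>v. J \<xi> v p) x y + lpp_bd (\<lambda>v. \<omega> v p) (\<lambda>v. I \<xi> v p) (\<lambda>v. J \<xi> v p) y z
           = lpp_bd (\<lambda>v. \<omega> v p) (\<lambda>v. I \<xi> v p) (\<lambda>v. J \<xi> v p) x z)"
    using bd' by blast
  have cons: "AE p in M. consistent_weights (\<lambda>v. \<omega> v p) (\<lambda>v. I \<xi> v p) (\<lambda>v. J \<xi> v p)" if \<xi>: "\<xi> \<in> ri_U" for \<xi>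
    using AE
  proof eventually_elim
    case (elim p)
    then show ?case using \<xi> unfolding consistent_weights_def by blast
  qed
  have hom: "\<gamma> (c *\<^sub>R z) = c * \<gamma> z" if "0 \<le> c" "0 \<le> z" for c z
    using shape that unfolding limit_shape_def by blast
  have cont: "continuous_on {x. 0 \<le> x} \<gamma>" using shape unfolding limit_shape_def by blast
  have ge: "expectation (\<omega> x) \<le> expectation (I \<xi> x)" "expectation (\<omega> x) \<le> expectation (J \<xi> x)" if \<xi>: "\<xi> \<in> ri_U" for \<xi> x
  proof -
    show "expectation (\<omega> x) \<le> expectation (I \<xi> x)"
      by (rule integral_mono_AE[OF w_int int(1)[OF \<xi>]]) (use cons[OF \<xi>] in eventually_elim, rule consistent_le(1))
    show "expectation (\<omega> x) \<le> expectation (J \<xi> x)"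
      by (rule integral_mono_AE[OF w_int int(2)[OF \<xi>]]) (use cons[OF \<xi>] in eventually_elim, rule consistent_le(2))
  qed
  have lim: "(\<lambda>m. \<gamma> (direction (f m))) \<longlonglongrightarrow> \<gamma> (direction c)"
    if "f \<longlonglongrightarrow> c" "0 \<le> c" "c \<le> 1" "\<And>m. 0 \<le> f m \<and> f m \<le> 1" for f :: "nat \<Rightarrow> real" and c
  proof (rule continuous_on_tendsto_compose[OF cont])
    show "(\<lambda>m. direction (f m)) \<longlonglongrightarrow> direction c"
      unfolding direction_def by (intro tendsto_intros that)
  qed (use that in \<open>auto simp: direction_def less_eq_prod_def\<close>)
  define \<tau> where "\<tau> m = 1 / (real m + 2)" for m :: nat
  have \<tau>: "0 < \<tau> m" "\<tau> m < 1" for m by (auto simp: \<tau>_def field_simps)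
  have \<tau>0: "\<tau> \<longlonglongrightarrow> 0" unfolding \<tau>_def by real_asymp
  have I_lim: "(\<lambda>m. expectation (I (direction (1 - \<tau> m)) x)) \<longlonglongrightarrow> expectation (\<omega> x)" for x
  proof (rule sandwich_expectation[where \<tau> = \<tau> and g = "\<lambda>m. \<gamma> (direction (1 - \<tau> m))"
        and u = "\<lambda>m. expectation (J (direction (1 - \<tau> m)) x)"])
    have "(\<lambda>m. 1 - \<tau> m) \<longlonglongrightarrow> 1 - 0" by (intro tendsto_intros \<tau>0)
    then have "(\<lambda>m. \<gamma> (direction (1 - \<tau> m))) \<longlonglongrightarrow> \<gamma> (direction 1)"
      using \<tau> by (intro lim) (auto simp: less_imp_le)
    then show "(\<lambda>m. \<gamma> (direction (1 - \<tau> m))) \<longlonglongrightarrow> expectation (\<omega> x)"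
      using shape_on_axes(1)[OF ind ident sq shape, of x] by (simp add: direction_def)
    fix m
    have ri: "direction (1 - \<tau> m) \<in> ri_U" using \<tau>[of m] by simp
    show "\<gamma> (direction (1 - \<tau> m)) = (1 - \<tau> m) * expectation (I (direction (1 - \<tau> m)) x)
        + \<tau> m * expectation (J (direction (1 - \<tau> m)) x)"
      using grad_plus_euler[OF hom _ _ grad[OF ri, of x]] \<tau>[of m] by simp
    show "expectation (\<omega> x) \<le> expectation (I (direction (1 - \<tau> m)) x)"
      "expectation (\<omega> x) \<le> expectation (J (direction (1 - \<tau> m)) x)" using ge[OF ri] .
  qed (simp add: \<tau>_def)
  have J_lim: "(\<lambda>m. expectation (J (direction (\<tau> m)) x)) \<longlonglongrightarrow> expectation (\<omega> x)" for x
  proof (rule sandwich_expectation[where \<tau> = \<tau> and g = "\<lambda>m. \<gamma> (direction (\<tau> m))"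
        and u = "\<lambda>m. expectation (I (direction (\<tau> m)) x)"])
    have "(\<lambda>m. \<gamma> (direction (\<tau> m))) \<longlonglongrightarrow> \<gamma> (direction 0)"
      using \<tau> \<tau>0 by (intro lim) (auto simp: less_imp_le)
    then show "(\<lambda>m. \<gamma> (direction (\<tau> m))) \<longlonglongrightarrow> expectation (\<omega> x)"
      using shape_on_axes(2)[OF ind ident sq shape, of x] by (simp add: direction_def)
    fix m
    have ri: "direction (\<tau> m) \<in> ri_U" using \<tau>[of m] by simp
    show "\<gamma> (direction (\<tau> m)) = (1 - \<tau> m) * expectation (J (direction (\<tau> m)) x)
        + \<tau> m * expectation (I (direction (\<tau> m)) x)"
      using grad_plus_euler[OF hom _ _ grad[OF ri, of x]] \<tau>[of m] by simp
    show "expectation (\<omega> x) \<le> expectation (J (direction (\<tau> m)) x)"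
      "expectation (\<omega> x) \<le> expectation (I (direction (\<tau> m)) x)" using ge(2,1)[OF ri] .
  qed (simp add: \<tau>_def)
  show ?thesis
  proof (unfold_locales)
    show "AE p in M. \<forall>x. I \<zeta> x p \<le> I \<xi> x p \<and> J \<xi> x p \<le> J \<zeta> x p"
      if "\<xi> \<in> ri_U" "\<zeta> \<in> ri_U" "fst \<xi> \<le> fst \<zeta>" for \<xi> \<zeta>
      using AE
    proof eventually_elim
      case (elim p)
      then show ?case using that by blast
    qed
    show "boundary_law M (\<lambda>x. \<omega> (x + z)) (\<lambda>\<xi> x. I \<xi> (x + z)) (\<lambda>\<xi> x. J \<xi> (x + z)) = boundary_law M \<omega> I J" for z
      using bd' by blast
  qed (fact rv | erule meas cons int | fact tail \<nu> w_int | rule I_lim[unfolded \<tau>_def] J_lim[unfolded \<tau>_def])+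
qed

theorem theorem5p3:
  fixes M :: "'a measure"
    and \<omega> :: "int \<times> int \<Rightarrow> 'a \<Rightarrow> real"
    and \<gamma> :: "real \<times> real \<Rightarrow> real"
    and I J I' J' :: "real \<times> real \<Rightarrow> int \<times> int \<Rightarrow> 'a \<Rightarrow> real"
    and \<nu> a\<^sub>0 :: real
  assumes prob: "prob_space M"
    and indep: "prob_space.indep_vars M (\<lambda>_. borel) \<omega> UNIV"
    and ident: "\<And>x. distr M borel (\<omega> x) = distr M borel (\<omega> (0, 0))"
    and moment: "\<exists>\<epsilon>>0. integrable M (\<lambda>p. \<bar>\<omega> (0, 0) p\<bar> powr (2 + \<epsilon>))"
    and nondeg: "prob_space.variance M (\<omega> (0, 0)) > 0"
    and shape: "limit_shape M \<omega> \<gamma>"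
    and boundary: "stationary_boundary M \<omega> \<gamma> I J"
    and reflected: "reflected_boundary M \<omega> I J I' J'"
    and nu: "\<nu> > 2"
    and hyp1: "\<exists>\<delta>\<^sub>0\<in>{0<..<1}. \<forall>\<delta>\<in>{0<..<\<delta>\<^sub>0}. \<exists>C\<^sub>0>0. \<forall>\<kappa>\<ge>0. \<exists>N\<^sub>0>0. \<exists>s\<^sub>0>0.
      \<forall>(m::int) (n::int) (s::real) \<xi>.
        (real_of_int m, real_of_int n) \<in> S_cone \<delta> \<longrightarrow>
        real_of_int m \<ge> N\<^sub>0 \<longrightarrow> real_of_int n \<ge> N\<^sub>0 \<longrightarrow> s \<ge> s\<^sub>0 \<longrightarrow>
        \<xi> \<in> ri_U \<longrightarrow> fst \<xi> \<in> {\<delta><..<1 - \<delta>} \<longrightarrow>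
        \<bar>fst \<xi> - of_int m / of_int (m + n)\<bar> \<le> \<kappa> * of_int (m + n) powr (- 1 / 3) \<longrightarrow>
        measure M {p \<in> space M.
          of_int (max
            \<bar>exit_e1 (\<lambda>v. \<omega> v p) (\<lambda>v. I \<xi> v p) (\<lambda>v. J \<xi> v p) (0, 0) (m, n)\<bar>
            \<bar>exit_e2 (\<lambda>v. \<omega> v p) (\<lambda>v. I \<xi> v p) (\<lambda>v. J \<xi> v p) (0, 0) (m, n)\<bar>)
          \<ge> s * of_int (m + n) powr (2 / 3)}
        \<le> C\<^sub>0 * s powr (- \<nu>)"
    and a0: "a\<^sub>0 \<in> {1/3<..<2/3}"
    and hyp2: "\<exists>\<delta>\<^sub>0\<in>{0<..<1}. \<forall>\<delta>\<in>{0<..<\<delta>\<^sub>0::real}. \<exists>C\<^sub>3>0. \<exists>N\<^sub>3>0.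
      \<forall>N::nat. real N \<ge> N\<^sub>3 \<longrightarrow>
      (\<forall>\<eta>_lo\<in>ri_U. \<forall>\<eta>_up\<in>ri_U. \<forall>\<xi>_lo\<in>ri_U. \<forall>\<xi>_up\<in>ri_U.
        fst \<eta>_lo \<in> {\<delta><..<1 - \<delta>} \<longrightarrow> fst \<eta>_up \<in> {\<delta><..<1 - \<delta>} \<longrightarrow>
        fst \<xi>_lo \<in> {\<delta><..<1 - \<delta>} \<longrightarrow> fst \<xi>_up \<in> {\<delta><..<1 - \<delta>} \<longrightarrow>
        - (real N powr (- a\<^sub>0 / 2)) \<le> fst \<xi>_lo - fst \<eta>_up \<longrightarrow> fst \<xi>_lo - fst \<eta>_up < 0 \<longrightarrow>
        - (real N powr (- a\<^sub>0 / 2)) \<le> fst \<eta>_lo - fst \<xi>_up \<longrightarrow> fst \<eta>_lo - fst \<xi>_up < 0 \<longrightarrow>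
        measure M {p \<in> space M.
          (SUP k\<in>{k. 0 < k \<and> of_int k \<le> real N powr (2 / 3)}.
             ereal (walk J J' \<xi>_lo \<eta>_up k p)) \<le> 0 \<and>
          (SUP k\<in>{k. - (real N powr (2 / 3)) + 1 \<le> of_int k \<and> k < 0}.
             ereal (walk J J' \<xi>_up \<eta>_lo k p)) \<le> 0}
        \<le> C\<^sub>3 * real N powr (- a\<^sub>0))"
    and exponents: "a\<^sub>0 < 2 * (\<nu> - 1) / (3 * \<nu>)"
  shows "AE p in M. \<not> (\<exists>\<pi>. bi_infinite_geodesic (\<lambda>v. \<omega> v p) \<pi> \<and> \<not> trivial_path \<pi>)"
proof -
  interpret prob_space M by (rule prob)
  have rv [measurable]: "\<omega> x \<in> borel_measurable M" for x using indep unfolding indep_vars_def by blast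
  have ident': "distr M borel (\<omega> x) = distr M borel (\<omega> y)" for x y
    using ident[of x] ident[of y] by simp
  have transfer: "integrable M (\<lambda>p. f (\<omega> x p)) \<longleftrightarrow> integrable M (\<lambda>p. f (\<omega> (0, 0) p))"
    "expectation (\<lambda>p. f (\<omega> x p)) = expectation (\<lambda>p. f (\<omega> (0, 0) p))"
    if [measurable]: "f \<in> borel_measurable borel" for f :: "real \<Rightarrow> real" and x
  proof -
    have "distr M borel (\<lambda>p. f (\<omega> y p)) = distr (distr M borel (\<omega> y)) borel f" for y
      by (simp add: distr_distr comp_def)
    then have "distr M borel (\<lambda>p. f (\<omega> x p)) = distr M borel (\<lambda>p. f (\<omega> (0, 0) p))"
      by (simp only: ident[of x])
    then show "integrable M (\<lambda>p. f (\<omega> x p)) \<longleftrightarrow> integrable M (\<lambda>p. f (\<omega> (0, 0) p))"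
      "expectation (\<lambda>p. f (\<omega> x p)) = expectation (\<lambda>p. f (\<omega> (0, 0) p))"
      by (intro distr_eq_integral; simp)+
  qed
  have sq0: "integrable M (\<lambda>p. (\<omega> (0, 0) p)\<^sup>2)"
  proof -
    obtain \<epsilon> where \<epsilon>: "\<epsilon> > 0" "integrable M (\<lambda>p. \<bar>\<omega> (0, 0) p\<bar> powr (2 + \<epsilon>))" using moment by blast
    show ?thesis
    proof (rule Bochner_Integration.integrable_bound)
      show "integrable M (\<lambda>p. 1 + \<bar>\<omega> (0, 0) p\<bar> powr (2 + \<epsilon>))" using \<epsilon>(2) by simp
      have "r\<^sup>2 \<le> 1 + \<bar>r\<bar> powr (2 + \<epsilon>)" for r :: real
      proof (cases "\<bar>r\<bar> \<le> 1")
        case True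
        then have "r\<^sup>2 \<le> 1" by (simp add: abs_square_le_1)
        then show ?thesis by (meson add_increasing2 powr_ge_zero)
      next
        case False
        then have "r\<^sup>2 = \<bar>r\<bar> powr 2" by simp
        also have "\<dots> \<le> \<bar>r\<bar> powr (2 + \<epsilon>)" using False \<epsilon>(1) by (intro powr_mono) auto
        finally show ?thesis by simp
      qed
      then show "AE p in M. norm ((\<omega> (0, 0) p)\<^sup>2) \<le> norm (1 + \<bar>\<omega> (0, 0) p\<bar> powr (2 + \<epsilon>))"
        by (auto intro!: AE_I2 order.trans[OF _ abs_ge_self])
    qed simp
  qed
  have sq: "integrable M (\<lambda>p. (\<omega> x p)\<^sup>2)" for x using transfer(1)[of "\<lambda>r. r\<^sup>2" x] sq0 by simp
  have var: "variance (\<omega> x) > 0" for x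
    using nondeg transfer(2)[of "\<lambda>r. r" x] transfer(2)[of "\<lambda>r. (r - expectation (\<omega> (0, 0)))\<^sup>2" x] by simp
  have \<nu>: "0 < \<nu>" using nu by simp
  have "exit_tail M \<omega> I J \<nu>" unfolding exit_tail_def exit_tail_at_def far_exit_prob_def
    by (rule hyp1)
  then have env: "boundary_env M \<omega> I J \<nu>"
    by (rule stationary_boundary_env[OF indep ident' sq shape boundary _ \<nu>])
  \<comment> \<open>The original and the reflected field share a law, which carries all of
    \<open>boundary_env\<close> over.\<close>
  have fp: "field_pair M \<omega> (\<lambda>x. \<omega> (- x)) I J (\<lambda>\<xi> x. I' \<xi> (- x)) (\<lambda>\<xi> x. J' \<xi> (- x))"
  proof unfold_locales
    show "I' \<xi> (- x) \<in> borel_measurable M" "J' \<xi> (- x) \<in> borel_measurable M" if "\<xi> \<in> ri_U" for \<xi> x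
      using reflected that unfolding reflected_boundary_def by blast+
    show "boundary_law M \<omega> I J = boundary_law M (\<lambda>x. \<omega> (- x)) (\<lambda>\<xi> x. I' \<xi> (- x)) (\<lambda>\<xi> x. J' \<xi> (- x))"
      using reflected unfolding reflected_boundary_def by simp
  qed (fact rv | erule boundary_env.I_meas[OF env] boundary_env.J_meas[OF env])+
  interpret two_sided M \<omega> I J I' J' \<nu>
    by (rule two_sided.intro[OF env boundary_env_law_cong[OF env fp]])
  interpret fwd_iid: iid_env M \<omega> I J \<nu>
    by unfold_locales (fact indep ident' sq var)+
  interpret rev_iid: iid_env M "\<lambda>x. \<omega> (- x)" "\<lambda>\<xi> x. I' \<xi> (- x)" "\<lambda>\<xi> x. J' \<xi> (- x)" \<nu>
    by unfold_locales (fact indep_vars_reflect[OF indep] ident' sq var)+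
  obtain \<delta>\<^sub>1 where \<delta>\<^sub>1: "0 < \<delta>\<^sub>1" "\<And>\<delta>. 0 < \<delta> \<Longrightarrow> \<delta> < \<delta>\<^sub>1 \<Longrightarrow> \<exists>C R. exit_bounds \<delta> C R"
    using exit_bounds_exist by force
  obtain \<delta>\<^sub>2 where \<delta>\<^sub>2: "0 < \<delta>\<^sub>2" "\<And>\<delta>. 0 < \<delta> \<Longrightarrow> \<delta> < \<delta>\<^sub>2 \<Longrightarrow> \<exists>C R. rev.exit_bounds \<delta> C R"
    using rev.exit_bounds_exist by force
  obtain \<delta>\<^sub>3 where \<delta>\<^sub>3: "0 < \<delta>\<^sub>3"
    and h2: "\<forall>\<delta>\<in>{0<..<\<delta>\<^sub>3}. \<exists>C\<^sub>3>0. \<exists>N\<^sub>3>0. walk_tail a\<^sub>0 \<delta> C\<^sub>3 N\<^sub>3"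
    using hyp2 unfolding walk_tail_def by (elim bexE) (auto simp del: split_paired_All split_paired_Ex)
  define \<delta>m where "\<delta>m = min \<delta>\<^sub>1 (min \<delta>\<^sub>2 \<delta>\<^sub>3)"
  \<comment> \<open>The windows exhaust all directions, and the offset \<open>2\<close> keeps every
    \<open>D n\<close> below the three thresholds.\<close>
  define D where "D n = \<delta>m / (real n + 2)" for n :: nat
  have \<delta>m: "0 < \<delta>m" using \<delta>\<^sub>1(1) \<delta>\<^sub>2(1) \<delta>\<^sub>3 by (simp add: \<delta>m_def)
  have D: "0 < D n" "D n < \<delta>m" for n
    using \<delta>m by (auto simp: D_def pos_divide_less_eq algebra_simps add_strict_increasing)
  have a0': "0 < a\<^sub>0" "a\<^sub>0 < 2 / 3" using a0 by auto
  \<comment> \<open>The condition on the exponents is equivalent to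
    \<open>1 / 3 < \<nu> * (1 / 3 - a\<^sub>0 / 2)\<close>, and
    \<open>a\<^sub>0 / 2 < 1 / 3\<close>.\<close>
  have expo: "a\<^sub>0 / 2 < \<nu> * (1 / 3 - a\<^sub>0 / 2)"
  proof -
    have "a\<^sub>0 * (3 * \<nu>) < 2 * (\<nu> - 1)" using exponents \<nu> by (simp add: pos_less_divide_eq)
    then have "1 / 3 < \<nu> * (1 / 3 - a\<^sub>0 / 2)" by (simp add: algebra_simps)
    then show ?thesis using a0' by simp
  qed
  have cross: "AE p in M. \<forall>x. eventually (\<lambda>i. \<not> crosses (\<lambda>v. \<omega> (v + x) p) (2 ^ i)
      (\<lambda>a. 2 * D n * 2 ^ i \<le> a \<and> a \<le> (1 - 2 * D n) * 2 ^ i)) sequentially" for n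
  proof -
    obtain C R where eb: "exit_bounds (D n) C R" using \<delta>\<^sub>1(2)[of "D n"] D[of n] by (auto simp: \<delta>m_def)
    obtain C' R' where eb': "rev.exit_bounds (D n) C' R'" using \<delta>\<^sub>2(2)[of "D n"] D[of n] by (auto simp: \<delta>m_def)
    have "D n \<in> {0<..<\<delta>\<^sub>3}" using D[of n] by (auto simp: \<delta>m_def)
    then obtain C\<^sub>3 N\<^sub>3 where C\<^sub>3: "0 < C\<^sub>3" and W: "walk_tail a\<^sub>0 (D n) C\<^sub>3 N\<^sub>3" using h2 by blast
    have "\<exists>K e. 0 < e \<and> eventually (\<lambda>N.
      prob {p \<in> space M. crosses (\<lambda>v. \<omega> v p) N (\<lambda>a. 2 * D n * N \<le> a \<and> a \<le> (1 - 2 * D n) * N)}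
        \<le> K * real N powr - e) sequentially"
    proof (rule crossing_decay[OF eb eb' D(1) _ _ a0' expo])
      show "prob (walk_event N (direction lo) (direction hi)) \<le> C\<^sub>3 * real N powr - a\<^sub>0"
        if "N\<^sub>3 \<le> real N" "D n < lo" "hi < 1 - D n" "lo < hi" "hi - lo \<le> real N powr (- a\<^sub>0 / 2)" for lo hi N
        by (rule walk_tailD[OF W D(1) that])
    qed (use C\<^sub>3 in simp)
    then obtain K e where "0 < e" "eventually (\<lambda>N.
      prob {p \<in> space M. crosses (\<lambda>v. \<omega> v p) N (\<lambda>a. 2 * D n * N \<le> a \<and> a \<le> (1 - 2 * D n) * N)}
        \<le> K * real N powr - e) sequentially"
      by blast
    then show ?thesis by (rule crossing_finitely_often)
  qed
  have "AE p in M. \<forall>n x. eventually (\<lambda>i. \<not> crosses (\<lambda>v. \<omega> (v + x) p) (2 ^ i)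
      (\<lambda>a. 2 * D n * 2 ^ i \<le> a \<and> a \<le> (1 - 2 * D n) * 2 ^ i)) sequentially"
    unfolding AE_all_countable[of "\<lambda>n p. \<forall>x. _ n x p"] by (intro allI cross)
  with fwd_iid.AE_avoids_axes rev_iid.AE_avoids_axes show ?thesis
  proof eventually_elim
    case (elim p)
    show ?case
    proof (rule notI, elim exE conjE)
      fix \<pi> assume \<pi>: "bi_infinite_geodesic (\<lambda>v. \<omega> v p) \<pi>" "\<not> trivial_path \<pi>"
      have small: "\<exists>n. D n \<le> \<epsilon>" if "\<epsilon> > 0" for \<epsilon>
      proof -
        have "D \<longlonglongrightarrow> 0" unfolding D_def by real_asymp
        then have "eventually (\<lambda>n. D n < \<epsilon>) sequentially" using that by (rule order_tendstoD)
        then show ?thesis by (meson eventually_sequentially less_imp_le order_refl)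
      qed
      show False
        by (rule no_bi_infinite_geodesic[OF elim(1,2) small elim(3)[rule_format] \<pi>])
    qed
  qed
qed

end
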